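(* Let $c\in\mathbb{R}\setminus\{0\}$, $L>0$, $H>0$. Let $f$ be the Gaussian forcing with spatial covariance $\mathcal C_f$ (real and even), let $u_0$ be the solution of $$\partial_t u_0(t,x)=2i\pi c\,x\,u_0(t,x)+f(t,x),\qquad u_0(0,x)=0,\qquad x\in\mathbb{R},$$ and define $$v_H(t,x)=(P_Hu_0)(t,x)=\int_{\mathbb{R}} e^{2i\pi kx}\frac{1}{|k|_{1/L}^{H+1/2}}\,\hat u_0(t,k)\,dk .$$ Then $v_H$ is a Gaussian field, statistically homogeneous in $x$ and of zero average. For every $H>0$ it has finite variance at every time $t\ge 0$, and $$\lim_{t\to\infty}\mathbb{E}|v_H(t,x)|^2=\frac{\mathcal C_f(0)}{2|c|}\int_{\mathbb{R}}\frac{1}{|k|_{1/L}^{2H+1}}\,dk<+\infty .$$ Furthermore, $v_H(t,\cdot)$ has asymptotically in time the same local regularity in space as a fractional Brownian motion of parameter $H$, in the following sense. For $\ell\in\mathbb{R}$ the increment $\delta_\ell v_H(t,x)=v_H(t,x+\ell)-v_H(t,x)$ is $$\delta_\ell v_H(t,x)=\int_{\mathbb{R}} e^{2i\pi kx}\,\frac{e^{2i\pi k\ell}-1}{|k|_{1/L}^{H+1/2}}\,\hat u_0(t,k)\,dk,$$ and, for $H\in(0,1)$, $$\lim_{t\to\infty}\mathbb{E}|\delta_\ell v_H(t,x)|^2\ \underset{\ell\to0}{\sim}\ |\ell|^{2H}\,\frac{\mathcal C_f(0)}{2|c|}\int_{\mathbb{R}}\frac{|e^{2i\pi k}-1|^2}{|k|^{2H+1}}\,dk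 ,$$ independently of the precise form of the regularization $|\cdot|_{1/L}$ at small $|k|$.
   Context: Fourier transform: $\hat u(t,k)=\int_{\mathbb{R}}e^{-2i\pi kx}u(t,x)\,dx$, understood in the sense of (random) distributions for homogeneous random fields. Forcing: $f(t,x)\in\mathbb{C}$, $t\ge0$, $x\in\mathbb{R}$, is a zero-mean complex Gaussian field, white in time and statistically homogeneous in space, with $$\mathbb{E}[f(t,x)f^*(t',x')]=\delta(t-t')\,\mathcal C_f(x-x'),\qquad \mathbb{E}[f(t,x)f(t',x')]=0,$$ where $^*$ is complex conjugation and $\mathcal C_f$ is a real, even, positive-definite, smooth and rapidly decaying (Schwartz) function, not identically zero. The solution with zero initial condition is $u_0(t,x)=\int_0^t e^{2i\pi cx(t-s)}f(s,x)\,ds$ (stochastic integral in time). Regularized absolute value: $k\mapsto|k|_{1/L}$ is a smooth, strictly positive function on $\mathbb{R}$, depending only on $|k|$, with $|k|_{1/L}\sim|k|$ as $|k|\to\infty$, and tending to a finite positive value (of order $1/L$) as $k\to0$; for example $|k|_{1/L}^2=k^2+1/L^2$. $P_H$ is the Fourier multiplier with symbol $|k|_{1/L}^{-(H+1/2)}$. "Statistically homogeneous" means that $\mathbb{E}[v_H(t,x)v_H^*(t,y)]$ depends only on $t$ and $x-y$ (and $\mathbb{E}[v_H(t,x)v_H(t,y)]=0$). $A(\ell)\sim B(\ell)$ means $A(\ell)/B(\ell)\to1$. *)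

theory Defs
  imports "HOL-Probability.Probability"
begin

definition iter_deriv :: "nat \<Rightarrow> (real \<Rightarrow> 'a::real_normed_vector) \<Rightarrow> real \<Rightarrow> 'a" where
  "iter_deriv n f = ((\<lambda>g x. vector_derivative g (at x)) ^^ n) f"

definition smooth :: "(real \<Rightarrow> 'a::real_normed_vector) \<Rightarrow> bool" where
  "smooth f \<longleftrightarrow> (\<forall>n x. iter_deriv n f differentiable (at x))"

definition schwartz :: "(real \<Rightarrow> 'a::real_normed_vector) \<Rightarrow> bool" where
  "schwartz f \<longleftrightarrow> smooth f \<and> (\<forall>m n. \<exists>B. \<forall>x. \<bar>x\<bar> ^ m * norm (iter_deriv n f x) \<le> B)"

definition fourier :: "(real \<Rightarrow> complex) \<Rightarrow> real \<Rightarrow> complex" where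
  "fourier \<phi> x = (LINT k|lborel. cis (- (2 * pi * k * x)) * \<phi> k)"

definition sq_integrable :: "'w measure \<Rightarrow> ('w \<Rightarrow> complex) \<Rightarrow> bool" where
  "sq_integrable M X \<longleftrightarrow>
     X \<in> borel_measurable M \<and> integrable M (\<lambda>\<omega>. (cmod (X \<omega>))\<^sup>2)"

text \<open>Degenerate (almost surely constant) variables count as Gaussian.\<close>

definition gaussian_rv :: "'w measure \<Rightarrow> ('w \<Rightarrow> real) \<Rightarrow> bool" where
  "gaussian_rv M X \<longleftrightarrow> X \<in> borel_measurable M \<and>
     ((\<exists>\<mu>. AE \<omega> in M. X \<omega> = \<mu>) \<or>
      (\<exists>\<mu> \<sigma>. \<sigma> > 0 \<and> distributed M lborel X (normal_density \<mu> \<sigma>)))"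

text \<open>Taking the real part of arbitrary complex combinations produces all real linear
  combinations of the real and imaginary parts of the family.\<close>

definition gaussian_family :: "'w measure \<Rightarrow> 'i set \<Rightarrow> ('i \<Rightarrow> 'w \<Rightarrow> complex) \<Rightarrow> bool" where
  "gaussian_family M I X \<longleftrightarrow>
     (\<forall>J a. finite J \<and> J \<subseteq> I \<longrightarrow> gaussian_rv M (\<lambda>\<omega>. Re (\<Sum>j\<in>J. a j * X j \<omega>)))"

text \<open>\<open>I\<close> is the integral over \<open>S\<close> of the curve \<open>g\<close> of square integrable random variables, in the
  weak (Pettis) sense of the Hilbert space of square integrable random variables.\<close>

definition has_L2_integral ::
  "'w measure \<Rightarrow> real set \<Rightarrow> (real \<Rightarrow> 'w \<Rightarrow> complex) \<Rightarrow> ('w \<Rightarrow> complex) \<Rightarrow> bool" where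
  "has_L2_integral M S g I \<longleftrightarrow>
     sq_integrable M I \<and> (\<forall>s\<in>S. sq_integrable M (g s)) \<and>
     (\<forall>Y. sq_integrable M Y \<longrightarrow>
        set_integrable lborel S (\<lambda>s. LINT \<omega>|M. g s \<omega> * cnj (Y \<omega>)) \<and>
        (LINT \<omega>|M. I \<omega> * cnj (Y \<omega>)) = (LINT s:S|lborel. (LINT \<omega>|M. g s \<omega> * cnj (Y \<omega>))))"

definition spatial_covariance :: "(real \<Rightarrow> real) \<Rightarrow> bool" where
  "spatial_covariance C \<longleftrightarrow>
     schwartz C \<and> (\<forall>z. C (- z) = C z) \<and> (\<exists>z. C z \<noteq> 0) \<and>
     (\<forall>X (z :: real \<Rightarrow> complex). finite X \<longrightarrow>
        0 \<le> Re (\<Sum>x\<in>X. \<Sum>y\<in>X. z x * cnj (z y) * complex_of_real (C (x - y))))"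

definition time_test :: "(real \<Rightarrow> complex) \<Rightarrow> bool" where
  "time_test g \<longleftrightarrow>
     g \<in> borel_measurable borel \<and> set_integrable lborel {0..} (\<lambda>s. (cmod (g s))\<^sup>2)"

text \<open>White noise in time has no pointwise values; it is given by its stochastic integrals:
  \<open>F g x\<close> stands for the integral of \<open>g s * f (s, x)\<close> over \<open>s \<ge> 0\<close>. Pairing the covariance
  \<open>\<delta> (t - t') * C (x - x')\<close> with \<open>g\<close> and the conjugate of \<open>h\<close> gives the third condition, which
  also forces \<open>F\<close> to be almost surely linear in \<open>g\<close>.\<close>

definition white_in_time_forcing ::
  "'w measure \<Rightarrow> (real \<Rightarrow> real) \<Rightarrow> ((real \<Rightarrow> complex) \<Rightarrow> real \<Rightarrow> 'w \<Rightarrow> complex) \<Rightarrow> bool" where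
  "white_in_time_forcing M C F \<longleftrightarrow>
     gaussian_family M ({g. time_test g} \<times> UNIV) (\<lambda>(g, x). F g x) \<and>
     (\<forall>g x. time_test g \<longrightarrow> (LINT \<omega>|M. F g x \<omega>) = 0) \<and>
     (\<forall>g h x y. time_test g \<and> time_test h \<longrightarrow>
        (LINT \<omega>|M. F g x \<omega> * cnj (F h y \<omega>)) =
          (LINT s:{0..}|lborel. g s * cnj (h s)) * complex_of_real (C (x - y))) \<and>
     (\<forall>g h x y. time_test g \<and> time_test h \<longrightarrow>
        (LINT \<omega>|M. F g x \<omega> * F h y \<omega>) = 0)"

text \<open>The initial value problem \<open>du/dt = 2 i \<pi> c x u + f\<close>, \<open>u 0 = 0\<close>, integrated in time: since \<open>f\<close>
  is a white noise, the equation for \<open>u\<close> means that \<open>u t x\<close> is the integral over \<open>[0, t]\<close> of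
  \<open>2 i \<pi> c x u\<close> plus that of \<open>f\<close>.\<close>

definition forced_solution ::
  "'w measure \<Rightarrow> real \<Rightarrow> ((real \<Rightarrow> complex) \<Rightarrow> real \<Rightarrow> 'w \<Rightarrow> complex)
     \<Rightarrow> (real \<Rightarrow> real \<Rightarrow> 'w \<Rightarrow> complex) \<Rightarrow> bool" where
  "forced_solution M c F u \<longleftrightarrow>
     (\<forall>x. AE \<omega> in M. u 0 x \<omega> = 0) \<and>
     (\<forall>t\<ge>0. \<forall>x. sq_integrable M (u t x) \<and>
        (\<exists>I. has_L2_integral M {0..t} (\<lambda>s \<omega>. 2 * \<i> * pi * c * x * u s x \<omega>) I \<and>
             (AE \<omega> in M. u t x \<omega> = I \<omega> + F (indicator {0..t}) x \<omega>)))"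

definition duhamel ::
  "real \<Rightarrow> ((real \<Rightarrow> complex) \<Rightarrow> real \<Rightarrow> 'w \<Rightarrow> complex) \<Rightarrow> real \<Rightarrow> real \<Rightarrow> 'w \<Rightarrow> complex" where
  "duhamel c F t x = F (\<lambda>s. indicator {0..t} s * cis (2 * pi * c * x * (t - s))) x"

text \<open>\<open>V\<close> is the value at the test function \<open>\<phi>\<close> of the Fourier transform of \<open>u\<close> as a random
  tempered distribution, i.e. the value of \<open>u\<close> at \<open>fourier \<phi>\<close>.\<close>

definition fourier_pairing ::
  "'w measure \<Rightarrow> (real \<Rightarrow> 'w \<Rightarrow> complex) \<Rightarrow> (real \<Rightarrow> complex) \<Rightarrow> ('w \<Rightarrow> complex) \<Rightarrow> bool" where
  "fourier_pairing M u \<phi> V \<longleftrightarrow>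
     schwartz \<phi> \<and> has_L2_integral M UNIV (\<lambda>x \<omega>. fourier \<phi> x * u x \<omega>) V"

text \<open>\<open>V\<close> is the integral of \<open>\<psi> k\<close> against the Fourier transform of \<open>u\<close>, for \<open>\<psi>\<close> bounded but not
  necessarily a Schwartz function. It is the mean square limit of pairings with test functions
  converging boundedly to \<open>\<psi>\<close>; for a homogeneous field of finite variance the spectral measure is
  finite, so such a convergence takes place in its square integrable functions and the limit does
  not depend on the approximation.\<close>

definition has_spectral_integral ::
  "'w measure \<Rightarrow> (real \<Rightarrow> 'w \<Rightarrow> complex) \<Rightarrow> (real \<Rightarrow> complex) \<Rightarrow> ('w \<Rightarrow> complex) \<Rightarrow> bool" where
  "has_spectral_integral M u \<psi> V \<longleftrightarrow>
     sq_integrable M V \<and>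
     (\<exists>\<phi> U. (\<forall>n::nat. fourier_pairing M u (\<phi> n) (U n)) \<and>
        (\<exists>B. \<forall>n k. cmod (\<phi> n k) \<le> B) \<and> (\<forall>k. (\<lambda>n. \<phi> n k) \<longlonglongrightarrow> \<psi> k) \<and>
        (\<lambda>n. LINT \<omega>|M. (cmod (U n \<omega> - V \<omega>))\<^sup>2) \<longlonglongrightarrow> 0)"

text \<open>\<open>A \<epsilon> k\<close> is the regularized absolute value of \<open>k\<close> at scale \<open>\<epsilon> = 1/L\<close>. The constants \<open>a\<close>, \<open>b\<close>
  are uniform in \<open>\<epsilon>\<close>: this is the meaning of the value near \<open>k = 0\<close> being of order \<open>\<epsilon>\<close>.\<close>

definition regularized_abs :: "(real \<Rightarrow> real \<Rightarrow> real) \<Rightarrow> bool" where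
  "regularized_abs A \<longleftrightarrow>
     (\<forall>\<epsilon>>0. smooth (A \<epsilon>) \<and> (\<forall>k. A \<epsilon> k > 0) \<and> (\<forall>k. A \<epsilon> k = A \<epsilon> \<bar>k\<bar>) \<and>
        ((\<lambda>k. A \<epsilon> k / \<bar>k\<bar>) \<longlongrightarrow> 1) at_infinity) \<and>
     (\<exists>a>0. \<exists>b>0. \<forall>\<epsilon>>0. \<exists>l. (A \<epsilon> \<longlongrightarrow> l) (at 0) \<and> a * \<epsilon> \<le> l \<and> l \<le> b * \<epsilon>)"

text \<open>\<open>v = P\<^sub>H u\<close>, each value being determined up to almost sure equality.\<close>

definition is_P ::
  "'w measure \<Rightarrow> (real \<Rightarrow> real \<Rightarrow> real) \<Rightarrow> real \<Rightarrow> real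
     \<Rightarrow> (real \<Rightarrow> real \<Rightarrow> 'w \<Rightarrow> complex) \<Rightarrow> (real \<Rightarrow> real \<Rightarrow> 'w \<Rightarrow> complex) \<Rightarrow> bool" where
  "is_P M A L H u v \<longleftrightarrow>
     (\<forall>t\<ge>0. \<forall>x. has_spectral_integral M (u t)
        (\<lambda>k. cis (2 * pi * k * x) * complex_of_real (1 / A (1 / L) k powr (H + 1/2))) (v t x))"

end

theory Submission
  imports Defs
begin

text \<open>The covariance of \<open>u\<^sub>0\<close> at time \<open>t\<close> is the Fourier transform of an integrable density \<open>S t\<close>, the
  integral over \<open>0 \<le> s \<le> t\<close> of the translates by \<open>c * s\<close> of the Fourier transform \<open>g\<close> of \<open>C\<close>; second
  moments of \<open>v t\<close> are integrals of weights against \<open>S t\<close>. As \<open>t\<close> grows, \<open>S t\<close> tends to a primitive of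
  \<open>g\<close>, whose even part is the constant \<open>C 0 / (2 * \<bar>c\<bar>)\<close> because \<open>g\<close> is even: for even weights it acts
  as white noise. The increments are handled by scaling \<open>k\<close> by \<open>\<bar>l\<bar>\<close> and dominated convergence.
  Everything is Gaussian as a mean square limit of linear combinations of stochastic integrals of
  the forcing.\<close>

section \<open>Square integrable random variables\<close>

text \<open>The data are known only weakly: the equation for \<open>u\<^sub>0\<close> is an identity
  of Pettis integrals at each \<open>t\<close> and \<open>x\<close>, and \<open>is_P\<close> speaks
  of a mean square limit along unspecified Schwartz approximants. Hence two obstacles. The solution
  has to be identified with the stochastic convolution without pathwise arguments; orthogonality in
  the Hilbert space of square integrable variables replaces them. And each claim about
  \<open>v\<close> has to hold whatever approximants were used, while existence demands that some be
  produced. The relation \<open>spec\<close> between random variables and symbols serves both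
  purposes: it survives linear combinations and bounded pointwise limits of symbols, and it
  determines all covariances. The density is treated as a complex function estimated by its modulus,
  so its positivity never has to be established. For large time it converges only pointwise, and the
  limit is not integrable, its even part being a nonzero constant. What survives is a bound uniform
  in time, the L1 norm of \<open>g\<close> divided by |c|; the weights themselves must therefore be
  integrable, which is the condition 2 H + 1 > 1.\<close>

lemma borel_measurable_cnj [measurable (raw)]:
  assumes "f \<in> borel_measurable M"
  shows "(\<lambda>x. cnj (f x)) \<in> borel_measurable M"
  using borel_measurable_continuous_onI[OF continuous_on_cnj[OF continuous_on_id]] assms
  by (rule measurable_compose_rev)

lemma sq_integrable_mult_cnj:
  assumes "sq_integrable M X" "sq_integrable M Y"
  shows "integrable M (\<lambda>\<omega>. X \<omega> * cnj (Y \<omega>))"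
proof (rule Bochner_Integration.integrable_bound)
  show "integrable M (\<lambda>\<omega>. (cmod (X \<omega>))\<^sup>2 + (cmod (Y \<omega>))\<^sup>2)"
    using assms unfolding sq_integrable_def by auto
  show "(\<lambda>\<omega>. X \<omega> * cnj (Y \<omega>)) \<in> borel_measurable M"
    using assms unfolding sq_integrable_def by auto
  show "AE \<omega> in M. norm (X \<omega> * cnj (Y \<omega>)) \<le> norm ((cmod (X \<omega>))\<^sup>2 + (cmod (Y \<omega>))\<^sup>2)"
  proof (rule AE_I2)
    fix \<omega>
    have "2 * cmod (X \<omega>) * cmod (Y \<omega>) \<le> (cmod (X \<omega>))\<^sup>2 + (cmod (Y \<omega>))\<^sup>2"
      "0 \<le> cmod (X \<omega>) * cmod (Y \<omega>)" by (auto simp: sum_squares_bound)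
    then have "cmod (X \<omega>) * cmod (Y \<omega>) \<le> (cmod (X \<omega>))\<^sup>2 + (cmod (Y \<omega>))\<^sup>2"
      by linarith
    then show "norm (X \<omega> * cnj (Y \<omega>)) \<le> norm ((cmod (X \<omega>))\<^sup>2 + (cmod (Y \<omega>))\<^sup>2)"
      by (simp add: norm_mult)
  qed
qed

lemma cmod_add_sq_le: "(cmod (a + b))\<^sup>2 \<le> 2 * (cmod a)\<^sup>2 + 2 * (cmod b)\<^sup>2"
proof -
  have "(cmod (a + b))\<^sup>2 \<le> (cmod a + cmod b)\<^sup>2"
    by (simp add: norm_triangle_ineq power_mono)
  also have "\<dots> \<le> 2 * (cmod a)\<^sup>2 + 2 * (cmod b)\<^sup>2"
    using sum_squares_bound[of "cmod a" "cmod b"] by (simp add: power2_sum)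
  finally show ?thesis .
qed

lemma sq_integrable_add:
  assumes "sq_integrable M X" "sq_integrable M Y"
  shows "sq_integrable M (\<lambda>\<omega>. X \<omega> + Y \<omega>)"
  unfolding sq_integrable_def
proof
  show "(\<lambda>\<omega>. X \<omega> + Y \<omega>) \<in> borel_measurable M"
    using assms unfolding sq_integrable_def by auto
  show "integrable M (\<lambda>\<omega>. (cmod (X \<omega> + Y \<omega>))\<^sup>2)"
  proof (rule Bochner_Integration.integrable_bound)
    show "integrable M (\<lambda>\<omega>. 2 * (cmod (X \<omega>))\<^sup>2 + 2 * (cmod (Y \<omega>))\<^sup>2)"
      using assms unfolding sq_integrable_def by auto
    show "(\<lambda>\<omega>. (cmod (X \<omega> + Y \<omega>))\<^sup>2) \<in> borel_measurable M"
      using assms unfolding sq_integrable_def by auto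
  qed (use cmod_add_sq_le in auto)
qed

lemma sq_integrable_cmult:
  assumes "sq_integrable M X"
  shows "sq_integrable M (\<lambda>\<omega>. a * X \<omega>)"
  using assms unfolding sq_integrable_def by (auto simp: norm_mult power_mult_distrib)

lemma sq_integrable_diff:
  assumes "sq_integrable M X" "sq_integrable M Y"
  shows "sq_integrable M (\<lambda>\<omega>. X \<omega> - Y \<omega>)"
  using sq_integrable_add[OF assms(1) sq_integrable_cmult[OF assms(2), of "-1"]] by simp

lemma sq_integrable_sum:
  assumes "\<And>i. i \<in> I \<Longrightarrow> sq_integrable M (X i)"
  shows "sq_integrable M (\<lambda>\<omega>. \<Sum>i\<in>I. X i \<omega>)"
  using assms
proof (induction I rule: infinite_finite_induct)
  case (insert i I)
  then show ?case using sq_integrable_add[of M "X i" "\<lambda>\<omega>. \<Sum>i\<in>I. X i \<omega>"] by auto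
qed (auto simp: sq_integrable_def)

lemma sq_integrable_cnj:
  assumes "sq_integrable M X"
  shows "sq_integrable M (\<lambda>\<omega>. cnj (X \<omega>))"
  using assms unfolding sq_integrable_def by auto

lemma (in finite_measure) sq_integrable_const: "sq_integrable M (\<lambda>\<omega>. a)"
  unfolding sq_integrable_def by auto

lemma (in finite_measure) sq_integrable_imp_integrable:
  assumes "sq_integrable M X"
  shows "integrable M X"
  using sq_integrable_mult_cnj[OF assms sq_integrable_const[of 1]] by simp

section \<open>Inner product, Cauchy-Schwarz inequality and completeness\<close>

abbreviation L2_inner :: "'w measure \<Rightarrow> ('w \<Rightarrow> complex) \<Rightarrow> ('w \<Rightarrow> complex) \<Rightarrow> complex" where
  "L2_inner M X Y \<equiv> LINT \<omega>|M. X \<omega> * cnj (Y \<omega>)"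

abbreviation L2_norm_sq :: "'w measure \<Rightarrow> ('w \<Rightarrow> complex) \<Rightarrow> real" where
  "L2_norm_sq M X \<equiv> LINT \<omega>|M. (cmod (X \<omega>))\<^sup>2"

abbreviation L2_dist_sq :: "'w measure \<Rightarrow> ('w \<Rightarrow> complex) \<Rightarrow> ('w \<Rightarrow> complex) \<Rightarrow> real" where
  "L2_dist_sq M X Y \<equiv> LINT \<omega>|M. (cmod (X \<omega> - Y \<omega>))\<^sup>2"

lemma L2_inner_cnj: "L2_inner M X Y = cnj (L2_inner M Y X)"
  unfolding Bochner_Integration.integral_cnj[symmetric] by (simp add: mult.commute)

text \<open>A real quadratic in \<open>s\<close> that is nowhere negative is evaluated at its
  minimum \<open>w / x\<close>. Integrating the product of the moduli makes \<open>w\<close> real,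
  so the phase of the inner product never enters.\<close>

lemma L2_cauchy_schwarz:
  assumes "sq_integrable M X" "sq_integrable M Y"
  shows "(cmod (L2_inner M X Y))\<^sup>2
           \<le> L2_norm_sq M X * L2_norm_sq M Y"
proof -
  define x where "x = L2_norm_sq M X"
  define y where "y = L2_norm_sq M Y"
  define z where "z = L2_inner M X Y"
  have iX: "integrable M (\<lambda>\<omega>. (cmod (X \<omega>))\<^sup>2)" and iY: "integrable M (\<lambda>\<omega>. (cmod (Y \<omega>))\<^sup>2)"
    using assms unfolding sq_integrable_def by auto
  have n: "integrable M (\<lambda>\<omega>. cmod (X \<omega>) * cmod (Y \<omega>))"
    using integrable_norm[OF sq_integrable_mult_cnj[OF assms]] by (simp add: norm_mult)
  define w where "w = (LINT \<omega>|M. cmod (X \<omega>) * cmod (Y \<omega>))"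
  have w: "cmod z \<le> w" "0 \<le> w"
    using integral_norm_bound[of M "\<lambda>\<omega>. X \<omega> * cnj (Y \<omega>)"] unfolding z_def w_def
    by (auto simp: norm_mult)
  have quad: "0 \<le> s\<^sup>2 * x - 2 * s * w + y" for s :: real
  proof -
    have "0 \<le> (LINT \<omega>|M. (s * cmod (X \<omega>) - cmod (Y \<omega>))\<^sup>2)" by simp
    also have "\<dots> = (LINT \<omega>|M. s\<^sup>2 * (cmod (X \<omega>))\<^sup>2 - 2 * s * (cmod (X \<omega>) * cmod (Y \<omega>)) + (cmod (Y \<omega>))\<^sup>2)"
      by (intro Bochner_Integration.integral_cong) (auto simp: power2_diff power_mult_distrib algebra_simps)
    also have "\<dots> = s\<^sup>2 * x - 2 * s * w + y"
      unfolding x_def y_def w_def using iX iY n by simp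
    finally show ?thesis .
  qed
  have x0: "0 \<le> x" unfolding x_def by simp
  have "w\<^sup>2 \<le> x * y"
  proof (cases "x = 0")
    case True
    have "w = 0"
    proof (rule ccontr)
      assume "w \<noteq> 0"
      \<comment> \<open>For \<open>x = 0\<close> the quadratic is affine in \<open>s\<close>; at
        this \<open>s\<close> it would take the value -1.\<close>
      have "2 * ((y + 1) / (2 * w)) * w = y + 1" using \<open>w \<noteq> 0\<close> by simp
      then show False using quad[of "(y + 1) / (2 * w)"] True by simp
    qed
    then show ?thesis using True by simp
  next
    case False
    then have "x > 0" using x0 by simp
    have "(w / x)\<^sup>2 * x - 2 * (w / x) * w + y = y - w\<^sup>2 / x"
      using \<open>x > 0\<close> by (simp add: power2_eq_square field_simps)
    then have "w\<^sup>2 / x \<le> y" using quad[of "w / x"] by linarith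
    then show ?thesis using \<open>x > 0\<close> by (simp add: field_simps)
  qed
  moreover have "(cmod z)\<^sup>2 \<le> w\<^sup>2" using w by (simp add: power_mono)
  ultimately show ?thesis unfolding x_def y_def z_def by linarith
qed

text \<open>Mean square convergence implies weak convergence. Through this, identities tested
  against a fixed variable pass to mean square limits.\<close>

lemma L2_tendsto_pairing:
  assumes "\<And>n. sq_integrable M (X n)" "sq_integrable M X'" "sq_integrable M Y"
    and "(\<lambda>n::nat. L2_dist_sq M (X n) X') \<longlonglongrightarrow> 0"
  shows "(\<lambda>n. L2_inner M (X n) Y) \<longlonglongrightarrow> L2_inner M X' Y"
proof -
  let ?y = "L2_norm_sq M Y"
  have lim: "(\<lambda>n. sqrt (L2_dist_sq M (X n) X' * ?y)) \<longlonglongrightarrow> 0"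
    using tendsto_real_sqrt[OF tendsto_mult_left_zero[OF assms(4), of ?y]] by simp
  have "(\<lambda>n. (L2_inner M (X n) Y) - L2_inner M X' Y) \<longlonglongrightarrow> 0"
  proof (rule Lim_null_comparison[OF _ lim], rule always_eventually, rule allI)
    fix n
    have "L2_inner M (X n) Y - L2_inner M X' Y
        = (LINT \<omega>|M. (X n \<omega> - X' \<omega>) * cnj (Y \<omega>))"
      using sq_integrable_mult_cnj[OF assms(1) assms(3)] sq_integrable_mult_cnj[OF assms(2,3)]
      by (simp add: left_diff_distrib)
    then show "cmod (L2_inner M (X n) Y - L2_inner M X' Y)
        \<le> sqrt (L2_dist_sq M (X n) X' * ?y)"
      using L2_cauchy_schwarz[OF sq_integrable_diff[OF assms(1,2)] assms(3)]
      by (simp add: real_le_rsqrt)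
  qed
  then show ?thesis by (simp add: LIM_zero_iff)
qed

lemma L2_norm_zero_AE:
  assumes "sq_integrable M X" "L2_norm_sq M X = 0"
  shows "AE \<omega> in M. X \<omega> = 0"
proof -
  have "AE \<omega> in M. (cmod (X \<omega>))\<^sup>2 = 0"
    using assms integral_nonneg_eq_0_iff_AE[of M "\<lambda>\<omega>. (cmod (X \<omega>))\<^sup>2"]
    unfolding sq_integrable_def by auto
  then show ?thesis by auto
qed

lemma complex_norm_sq_cnj: "complex_of_real ((cmod z)\<^sup>2) = z * cnj z"
  using complex_norm_square by simp

lemma L2_norm_sq_eq:
  "complex_of_real (L2_norm_sq M X) = L2_inner M X X"
  unfolding complex_norm_sq_cnj[symmetric] by (rule integral_complex_of_real[symmetric])

lemma L2_integral_add_sq_le: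
  assumes "sq_integrable M X" "sq_integrable M Y"
  shows "(LINT \<omega>|M. (cmod (X \<omega> + Y \<omega>))\<^sup>2)
           \<le> 2 * L2_norm_sq M X + 2 * L2_norm_sq M Y"
proof -
  have "(LINT \<omega>|M. (cmod (X \<omega> + Y \<omega>))\<^sup>2) \<le> (LINT \<omega>|M. 2 * (cmod (X \<omega>))\<^sup>2 + 2 * (cmod (Y \<omega>))\<^sup>2)"
    using assms sq_integrable_add[OF assms] unfolding sq_integrable_def
    by (intro integral_mono) (auto simp: cmod_add_sq_le)
  also have "\<dots> = 2 * L2_norm_sq M X + 2 * L2_norm_sq M Y"
    using assms unfolding sq_integrable_def by simp
  finally show ?thesis .
qed

lemma (in prob_space) L1_le_L2:
  assumes "sq_integrable M X"
  shows "(LINT \<omega>|M. cmod (X \<omega>)) \<le> sqrt (L2_norm_sq M X)"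
proof -
  have "sq_integrable M (\<lambda>\<omega>. complex_of_real (cmod (X \<omega>)))"
    using assms unfolding sq_integrable_def by auto
  from L2_cauchy_schwarz[OF this sq_integrable_const[of 1]]
  have "(LINT \<omega>|M. cmod (X \<omega>))\<^sup>2 \<le> L2_norm_sq M X"
    by (simp add: prob_space)
  then show ?thesis by (rule real_le_rsqrt)
qed

text \<open>The Riesz--Fischer argument: a subsequence with summable increments converges almost surely,
  and Fatou's lemma upgrades this to mean square convergence.\<close>

lemma (in prob_space) L2_complete:
  fixes V :: "nat \<Rightarrow> 'a \<Rightarrow> complex"
  assumes V: "\<And>n. sq_integrable M (V n)"
    and b: "b \<longlonglongrightarrow> 0" "\<And>n m. L2_dist_sq M (V n) (V m) \<le> b n + b m"
  obtains W where "sq_integrable M W" "(\<lambda>n. L2_dist_sq M (V n) W) \<longlonglongrightarrow> 0"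
proof -
  have [measurable]: "\<And>n. V n \<in> borel_measurable M" using V unfolding sq_integrable_def by auto
  \<comment> \<open>Two such bounds add up to (1/4)^j for a squared distance, hence (1/2)^j in norm,
    which is summable.\<close>
  have "\<forall>j. \<exists>N. \<forall>n\<ge>N. b n < (1/4)^j / 2"
    using b(1) by (auto simp: eventually_sequentially dest!: order_tendstoD(2)[where a = "_ / 2"])
  then obtain N where N: "\<And>j n. n \<ge> N j \<Longrightarrow> b n < (1/4)^j / 2" by metis
  \<comment> \<open>The partial sum of the thresholds dominates each of them and is monotone, and
    the summand \<open>j\<close> forces \<open>r\<close> to infinity.\<close>
  define r where "r j = (\<Sum>i\<le>j. N i) + j" for j
  have rN: "N j \<le> r j" for j unfolding r_def by (simp add: member_le_sum trans_le_add1)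
  have rS: "N j \<le> r (Suc j)" for j
    using rN[of j] unfolding r_def by simp
  have r: "filterlim r at_top sequentially"
    by (rule filterlim_at_top_mono[OF filterlim_ident]) (auto simp: r_def)
  let ?D = "\<lambda>j \<omega>. V (r (Suc j)) \<omega> - V (r j) \<omega>"
  have D: "sq_integrable M (?D j)" for j by (intro sq_integrable_diff V)
  have inc: "(LINT \<omega>|M. cmod (?D j \<omega>)) \<le> (1/2)^j" for j
  proof -
    have "L2_norm_sq M (?D j) \<le> (1/4)^j"
      using b(2)[of "r (Suc j)" "r j"] N[OF rN[of j]] N[OF rS[of j]] by linarith
    then have "sqrt (L2_norm_sq M (?D j)) \<le> sqrt ((1/4)^j)" by simp
    also have "sqrt ((1/4::real)^j) = (1/2)^j" by (simp add: real_sqrt_power real_sqrt_divide)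
    finally show ?thesis using L1_le_L2[OF D[of j]] by linarith
  qed
  have "AE \<omega> in M. summable (\<lambda>j. norm (?D j \<omega>))"
  proof -
    have "(\<integral>\<^sup>+\<omega>. (\<Sum>j. ennreal (cmod (?D j \<omega>))) \<partial>M) = (\<Sum>j. \<integral>\<^sup>+\<omega>. ennreal (cmod (?D j \<omega>)) \<partial>M)"
      by (rule nn_integral_suminf) measurable
    also have "\<dots> = (\<Sum>j. ennreal (LINT \<omega>|M. cmod (?D j \<omega>)))"
      using sq_integrable_imp_integrable[OF D] by (subst nn_integral_eq_integral) auto
    also have "\<dots> \<le> (\<Sum>j. ennreal ((1/2)^j))"
      using inc by (intro suminf_le) (auto simp: ennreal_leI)
    also have "\<dots> = ennreal (\<Sum>j. (1/2)^j)"
      by (rule suminf_ennreal2) (auto simp: summable_geometric)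
    also have "\<dots> < \<infinity>" by simp
    finally have "(\<integral>\<^sup>+\<omega>. (\<Sum>j. ennreal (cmod (?D j \<omega>))) \<partial>M) \<noteq> \<infinity>" by simp
    then have "AE \<omega> in M. (\<Sum>j. ennreal (cmod (?D j \<omega>))) \<noteq> \<infinity>"
      by (intro nn_integral_PInf_AE) measurable
    then show ?thesis
    proof (rule AE_mp, intro AE_I2 impI)
      fix \<omega> assume "(\<Sum>j. ennreal (cmod (?D j \<omega>))) \<noteq> \<infinity>"
      then show "summable (\<lambda>j. norm (?D j \<omega>))"
        by (intro summable_suminf_not_top) auto
    qed
  qed
  then have conv: "AE \<omega> in M. convergent (\<lambda>j. V (r j) \<omega>)"
  proof (rule AE_mp, intro AE_I2 impI)
    fix \<omega> assume "summable (\<lambda>j. norm (?D j \<omega>))"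
    then have "summable (\<lambda>j. ?D j \<omega>)" by (rule summable_norm_cancel)
    then have "(\<lambda>n. (\<Sum>j<n. ?D j \<omega>) + V (r 0) \<omega>) \<longlonglongrightarrow> (\<Sum>j. ?D j \<omega>) + V (r 0) \<omega>"
      by (intro tendsto_add summable_LIMSEQ) auto
    then show "convergent (\<lambda>j. V (r j) \<omega>)"
      unfolding sum_lessThan_telescope[of "\<lambda>j. V (r j) \<omega>"] by (auto simp: convergent_def)
  qed
  define W where "W \<omega> = lim (\<lambda>j. V (r j) \<omega>)" for \<omega>
  have [measurable]: "W \<in> borel_measurable M" unfolding W_def by measurable
  have W: "AE \<omega> in M. (\<lambda>j. V (r j) \<omega>) \<longlonglongrightarrow> W \<omega>"
    using conv unfolding W_def by (simp add: convergent_LIMSEQ_iff)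
  have br: "(\<lambda>j. b (r j)) \<longlonglongrightarrow> 0" using filterlim_compose[OF b(1) r] .
  have le: "(\<integral>\<^sup>+\<omega>. ennreal ((cmod (V n \<omega> - W \<omega>))\<^sup>2) \<partial>M) \<le> ennreal (b n)" for n
  proof -
    have "(\<integral>\<^sup>+\<omega>. ennreal ((cmod (V n \<omega> - W \<omega>))\<^sup>2) \<partial>M)
        = (\<integral>\<^sup>+\<omega>. liminf (\<lambda>j. ennreal ((cmod (V n \<omega> - V (r j) \<omega>))\<^sup>2)) \<partial>M)"
    proof (rule nn_integral_cong_AE, rule AE_mp[OF W], intro AE_I2 impI)
      fix \<omega> assume "(\<lambda>j. V (r j) \<omega>) \<longlonglongrightarrow> W \<omega>"
      then have "(\<lambda>j. ennreal ((cmod (V n \<omega> - V (r j) \<omega>))\<^sup>2)) \<longlonglongrightarrow> ennreal ((cmod (V n \<omega> - W \<omega>))\<^sup>2)"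
        by (intro tendsto_ennrealI tendsto_intros)
      then show "ennreal ((cmod (V n \<omega> - W \<omega>))\<^sup>2) = liminf (\<lambda>j. ennreal ((cmod (V n \<omega> - V (r j) \<omega>))\<^sup>2))"
        by (intro lim_imp_Liminf[symmetric]) simp_all
    qed
    also have "\<dots> \<le> liminf (\<lambda>j. \<integral>\<^sup>+\<omega>. ennreal ((cmod (V n \<omega> - V (r j) \<omega>))\<^sup>2) \<partial>M)"
      by (rule nn_integral_liminf) measurable
    also have "\<dots> \<le> liminf (\<lambda>j. ennreal (b n + b (r j)))"
    proof (rule Liminf_mono, rule always_eventually, rule allI)
      fix j
      have "(\<integral>\<^sup>+\<omega>. ennreal ((cmod (V n \<omega> - V (r j) \<omega>))\<^sup>2) \<partial>M)
          = ennreal (L2_dist_sq M (V n) (V (r j)))"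
        using sq_integrable_diff[OF V[of n] V[of "r j"]] unfolding sq_integrable_def
        by (intro nn_integral_eq_integral) auto
      then show "(\<integral>\<^sup>+\<omega>. ennreal ((cmod (V n \<omega> - V (r j) \<omega>))\<^sup>2) \<partial>M) \<le> ennreal (b n + b (r j))"
        using b(2)[of n "r j"] by (simp add: ennreal_leI)
    qed
    also have "\<dots> = ennreal (b n)"
      using br by (intro lim_imp_Liminf tendsto_ennrealI) (auto intro!: tendsto_eq_intros)
    finally show ?thesis .
  qed
  have d: "sq_integrable M (\<lambda>\<omega>. V n \<omega> - W \<omega>)" for n
  proof -
    have "integrable M (\<lambda>\<omega>. (cmod (V n \<omega> - W \<omega>))\<^sup>2)"
    proof (rule integrableI_bounded)
      show "(\<integral>\<^sup>+\<omega>. ennreal (norm ((cmod (V n \<omega> - W \<omega>))\<^sup>2)) \<partial>M) < \<infinity>"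
        using order_le_less_trans[OF le[of n], of \<infinity>] by simp
    qed measurable
    then show ?thesis unfolding sq_integrable_def by auto
  qed
  have "sq_integrable M W"
    using sq_integrable_diff[OF V[of 0] d[of 0]] by simp
  moreover have "(\<lambda>n. L2_dist_sq M (V n) W) \<longlonglongrightarrow> 0"
  proof (rule Lim_null_comparison[OF _ b(1)], rule always_eventually, rule allI)
    fix n
    have "0 \<le> b n" using b(2)[of n n] by simp
    have "ennreal (L2_dist_sq M (V n) W) \<le> ennreal (b n)"
      using le[of n] d[of n] unfolding sq_integrable_def
      by (subst (asm) nn_integral_eq_integral) auto
    then show "norm (L2_dist_sq M (V n) W) \<le> b n"
      using \<open>0 \<le> b n\<close> by (simp add: ennreal_le_iff)
  qed
  ultimately show ?thesis by (rule that)
qed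

section \<open>Gaussian variables and mean square limits\<close>

lemma char_normal:
  assumes X: "distributed M lborel X (\<lambda>x. ennreal (normal_density \<mu> \<sigma> x))" and "\<sigma> > 0" "prob_space M"
  shows "(LINT \<omega>|M. cis (s * X \<omega>)) = cis (s * \<mu>) * exp (- (\<sigma>\<^sup>2 * s\<^sup>2) / 2)"
proof -
  interpret prob_space M by fact
  have Z: "distributed M lborel (\<lambda>\<omega>. (X \<omega> - \<mu>) / \<sigma>) std_normal_density"
    using normal_standard_normal_convert[OF \<open>\<sigma> > 0\<close>, of X \<mu>] X by simp
  have m: "random_variable borel (\<lambda>\<omega>. (X \<omega> - \<mu>) / \<sigma>)"
    using distributed_measurable[OF Z] by simp
  have d: "distr M borel (\<lambda>\<omega>. (X \<omega> - \<mu>) / \<sigma>) = std_normal_distribution"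
    using distributed_distr_eq_density[OF Z] by (simp add: distr_cong[of M M lborel borel])
  have "(LINT \<omega>|M. cis (s * X \<omega>))
      = (LINT \<omega>|M. cis (s * \<mu>) * iexp (s * \<sigma> * ((X \<omega> - \<mu>) / \<sigma>)))"
    using \<open>\<sigma> > 0\<close>
    by (intro Bochner_Integration.integral_cong refl)
       (simp add: cis_conv_exp exp_add[symmetric] right_diff_distrib diff_divide_distrib mult_ac)
  also have "\<dots> = cis (s * \<mu>) * (LINT \<omega>|M. iexp (s * \<sigma> * ((X \<omega> - \<mu>) / \<sigma>)))"
    by (rule integral_mult_right_zero)
  also have "(LINT \<omega>|M. iexp (s * \<sigma> * ((X \<omega> - \<mu>) / \<sigma>))) = char std_normal_distribution (s * \<sigma>)"
    unfolding d[symmetric] char_def using m by (subst integral_distr) auto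
  also have "\<dots> = exp (- (\<sigma>\<^sup>2 * s\<^sup>2) / 2)"
    by (simp add: char_std_normal_distribution power_mult_distrib mult.commute)
  finally show ?thesis .
qed

lemma gaussian_rv_sq_integrable:
  assumes "gaussian_rv M X" "prob_space M"
  shows "integrable M (\<lambda>\<omega>. (X \<omega>)\<^sup>2)"
proof -
  interpret prob_space M by fact
  have [measurable]: "X \<in> borel_measurable M" using assms unfolding gaussian_rv_def by auto
  show ?thesis
    using assms(1)[unfolded gaussian_rv_def, THEN conjunct2]
  proof (elim disjE exE conjE)
    fix \<mu> assume "AE \<omega> in M. X \<omega> = \<mu>"
    then have "AE \<omega> in M. (X \<omega>)\<^sup>2 = \<mu>\<^sup>2" by auto
    then show ?thesis
      using integrable_cong_AE[of "\<lambda>\<omega>. (X \<omega>)\<^sup>2" M "\<lambda>\<omega>. \<mu>\<^sup>2"] by auto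
  next
    fix \<mu> \<sigma> :: real assume "\<sigma> > 0" and X: "distributed M lborel X (\<lambda>x. ennreal (normal_density \<mu> \<sigma> x))"
    have "integrable lborel (\<lambda>x. normal_density \<mu> \<sigma> x * (x - \<mu>)^2)"
      using integrable_normal_moment[OF \<open>\<sigma> > 0\<close>] by simp
    then have "integrable M (\<lambda>\<omega>. (X \<omega> - \<mu>)\<^sup>2)"
      using distributed_integrable[OF X, of "\<lambda>x. (x - \<mu>)^2"] by simp
    then have "integrable M (\<lambda>\<omega>. 2 * (X \<omega> - \<mu>)\<^sup>2 + 2 * \<mu>\<^sup>2)" by auto
    then show ?thesis
    proof (rule Bochner_Integration.integrable_bound)
      show "AE \<omega> in M. norm ((X \<omega>)\<^sup>2) \<le> norm (2 * (X \<omega> - \<mu>)\<^sup>2 + 2 * \<mu>\<^sup>2)"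
      proof (rule AE_I2)
        fix \<omega>
        have "0 \<le> (X \<omega> - 2 * \<mu>)\<^sup>2" by simp
        then show "norm ((X \<omega>)\<^sup>2) \<le> norm (2 * (X \<omega> - \<mu>)\<^sup>2 + 2 * \<mu>\<^sup>2)"
          by (simp add: power2_eq_square algebra_simps)
      qed
    qed simp
  qed
qed

text \<open>Both alternatives in \<open>gaussian_rv\<close> lead to one formula: a constant with
  mean zero is 0, which is the Gaussian of variance 0. Limits can then be taken without separating
  the cases.\<close>

lemma char_centered_gaussian_rv:
  assumes X: "gaussian_rv M X" and "prob_space M" and 0: "(LINT \<omega>|M. X \<omega>) = 0"
  shows "(LINT \<omega>|M. cis (s * X \<omega>)) = exp (- ((LINT \<omega>|M. (X \<omega>)\<^sup>2) * s\<^sup>2) / 2)"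
proof -
  interpret prob_space M by fact
  have [measurable]: "X \<in> borel_measurable M" using assms unfolding gaussian_rv_def by auto
  show ?thesis
    using assms(1)[unfolded gaussian_rv_def, THEN conjunct2]
  proof (elim disjE exE conjE)
    fix \<mu> assume c: "AE \<omega> in M. X \<omega> = \<mu>"
    then have "(LINT \<omega>|M. X \<omega>) = (LINT \<omega>|M. \<mu>)" by (intro integral_cong_AE) auto
    then have \<mu>: "\<mu> = 0" using 0 by (simp add: prob_space)
    have "(LINT \<omega>|M. (X \<omega>)\<^sup>2) = (LINT \<omega>|M. 0)" using c \<mu> by (intro integral_cong_AE) auto
    moreover have "(LINT \<omega>|M. cis (s * X \<omega>)) = (LINT \<omega>|M. 1)"
      using c \<mu> by (intro integral_cong_AE) (auto simp: cis_conv_exp)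
    ultimately show ?thesis by (simp add: prob_space)
  next
    fix \<mu> \<sigma> :: real assume \<sigma>: "\<sigma> > 0" and X: "distributed M lborel X (\<lambda>x. ennreal (normal_density \<mu> \<sigma> x))"
    have \<mu>: "\<mu> = 0" using normal_distributed_expectation[OF \<sigma> X] 0 by simp
    have "(LINT \<omega>|M. (X \<omega>)\<^sup>2) = \<sigma>\<^sup>2" using normal_distributed_variance[OF \<sigma> X] 0 by simp
    then show ?thesis using char_normal[OF X \<sigma> assms(2)] \<mu> by simp
  qed
qed

text \<open>Levy's uniqueness theorem, applied to \<open>X / \<sigma>\<close> so that the comparison
  is with the standard normal law.\<close>

lemma (in prob_space) gaussian_rv_if_char:
  assumes [measurable]: "X \<in> borel_measurable M" and "\<sigma> > 0"
    and c: "\<And>s. (LINT \<omega>|M. cis (s * X \<omega>)) = exp (- (\<sigma>\<^sup>2 * s\<^sup>2) / 2)"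
  shows "gaussian_rv M X"
proof -
  let ?Z = "\<lambda>\<omega>. X \<omega> / \<sigma>"
  have "distr M borel ?Z = std_normal_distribution"
  proof (rule Levy_uniqueness)
    show "real_distribution (distr M borel ?Z)" by (rule real_distribution_distr) measurable
    show "char (distr M borel ?Z) = char std_normal_distribution"
    proof
      fix t
      have "char (distr M borel ?Z) t = (LINT \<omega>|M. cis (t / \<sigma> * X \<omega>))"
        unfolding char_def by (subst integral_distr) (auto simp: cis_conv_exp)
      also have "\<dots> = exp (- (t\<^sup>2) / 2)"
        unfolding c using \<open>\<sigma> > 0\<close> by (simp add: power_divide)
      finally show "char (distr M borel ?Z) t = char std_normal_distribution t"
        by (simp add: char_std_normal_distribution)
    qed
  qed (rule real_dist_normal_dist)
  then have "distributed M lborel ?Z std_normal_density"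
    unfolding distributed_def by (auto simp: distr_cong[of M M borel lborel])
  then have "distributed M lborel X (normal_density 0 \<sigma>)"
    using normal_standard_normal_convert[OF \<open>\<sigma> > 0\<close>, of X 0] by simp
  then show ?thesis unfolding gaussian_rv_def using \<open>\<sigma> > 0\<close> by auto
qed

lemma cis_diff_le: "cmod (cis a - cis b) \<le> \<bar>a - b\<bar>"
proof -
  have "cis a - cis b = cis b * (iexp (a - b) - 1)"
    by (simp add: algebra_simps cis_conv_exp exp_diff)
  then have "cmod (cis a - cis b) = cmod (iexp (a - b) - 1)" by (simp add: norm_mult)
  also have "\<dots> \<le> \<bar>a - b\<bar>" using iexp_approx1[of "a - b" 0] by simp
  finally show ?thesis .
qed

text \<open>The characteristic functions of centred Gaussians depend on the variance alone, and
  variances converge in mean square. Since \<open>cis\<close> is 1-Lipschitz, L1 convergence carries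
  the same characteristic functions to that of \<open>Y\<close>, which is therefore Gaussian,
  degenerate if the limiting variance vanishes.\<close>

lemma (in prob_space) gaussian_rv_L2_limit:
  assumes X: "\<And>n::nat. gaussian_rv M (X n)" "\<And>n. (LINT \<omega>|M. X n \<omega>) = 0"
    and Y: "Y \<in> borel_measurable M" "integrable M (\<lambda>\<omega>. (Y \<omega>)\<^sup>2)"
    and lim: "(\<lambda>n. LINT \<omega>|M. (X n \<omega> - Y \<omega>)\<^sup>2) \<longlonglongrightarrow> 0"
  shows "gaussian_rv M Y"
proof -
  have [measurable]: "\<And>n. X n \<in> borel_measurable M" "Y \<in> borel_measurable M"
    using X Y unfolding gaussian_rv_def by auto
  let ?Y = "\<lambda>\<omega>. complex_of_real (Y \<omega>)" and ?X = "\<lambda>n \<omega>. complex_of_real (X n \<omega>)"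
  have sY: "sq_integrable M ?Y" using Y unfolding sq_integrable_def by auto
  have sX: "sq_integrable M (?X n)" for n
    using gaussian_rv_sq_integrable[OF X(1)[of n] prob_space_axioms] unfolding sq_integrable_def by auto
  let ?d = "\<lambda>n. LINT \<omega>|M. (X n \<omega> - Y \<omega>)\<^sup>2"
  have d: "?d n = L2_dist_sq M (?X n) ?Y" for n
    by (simp flip: of_real_diff)
  define v where "v = (LINT \<omega>|M. (Y \<omega>)\<^sup>2)"
  have v0: "0 \<le> v" unfolding v_def by simp
  have "(\<lambda>n. LINT \<omega>|M. (X n \<omega>)\<^sup>2) \<longlonglongrightarrow> v"
  proof -
    have p: "(\<lambda>n. LINT \<omega>|M. X n \<omega> * Y \<omega>) \<longlonglongrightarrow> v"
    proof -
      have "(\<lambda>n. L2_inner M (?X n) ?Y) \<longlonglongrightarrow> L2_inner M ?Y ?Y"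
        by (rule L2_tendsto_pairing[OF sX sY sY]) (use lim d in simp)
      then have "(\<lambda>n. complex_of_real (LINT \<omega>|M. X n \<omega> * Y \<omega>)) \<longlonglongrightarrow> complex_of_real v"
        unfolding v_def by (simp add: power2_eq_square flip: of_real_mult integral_complex_of_real)
      then show ?thesis by (rule tendsto_of_real_iff[THEN iffD1])
    qed
    \<comment> \<open>Expanding the squared distance expresses the variance through quantities whose
      limits are known.\<close>
    have "(LINT \<omega>|M. (X n \<omega>)\<^sup>2) = ?d n + 2 * (LINT \<omega>|M. X n \<omega> * Y \<omega>) - v" for n
    proof -
      have i: "integrable M (\<lambda>\<omega>. X n \<omega> * Y \<omega>)" "integrable M (\<lambda>\<omega>. (X n \<omega>)\<^sup>2)"
        using sq_integrable_mult_cnj[OF sX sY, of n] sX[of n] unfolding sq_integrable_def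
        by (auto simp: complex_of_real_integrable_eq simp flip: of_real_mult)
      have "?d n = (LINT \<omega>|M. (X n \<omega>)\<^sup>2 - 2 * (X n \<omega> * Y \<omega>) + (Y \<omega>)\<^sup>2)"
        by (intro Bochner_Integration.integral_cong) (auto simp: power2_diff)
      also have "\<dots> = (LINT \<omega>|M. (X n \<omega>)\<^sup>2) - 2 * (LINT \<omega>|M. X n \<omega> * Y \<omega>) + v"
        unfolding v_def using i Y by simp
      finally show ?thesis by simp
    qed
    then show ?thesis using tendsto_diff[OF tendsto_add[OF lim tendsto_mult_left[OF p, of 2]] tendsto_const[of v]]
      by simp
  qed
  then have l1: "(\<lambda>n. LINT \<omega>|M. cis (s * X n \<omega>)) \<longlonglongrightarrow> exp (- (v * s\<^sup>2) / 2)" for s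
    unfolding char_centered_gaussian_rv[OF X(1) prob_space_axioms X(2)]
    by (intro tendsto_intros) auto
  have l2: "(\<lambda>n. LINT \<omega>|M. cis (s * X n \<omega>)) \<longlonglongrightarrow> (LINT \<omega>|M. cis (s * Y \<omega>))" for s
  proof -
    have m: "(\<lambda>x. cis (s * x)) \<in> borel_measurable borel"
      by (intro borel_measurable_continuous_onI continuous_intros)
    have i: "complex_integrable M (\<lambda>\<omega>. cis (s * Z \<omega>))" if "Z \<in> borel_measurable M" for Z
      using measurable_compose[OF that m] by (intro integrable_const_bound[where B = 1]) auto
    have z: "(\<lambda>n. \<bar>s\<bar> * sqrt (?d n)) \<longlonglongrightarrow> 0"
      using tendsto_mult_right_zero[OF tendsto_real_sqrt[OF lim, simplified], of "\<bar>s\<bar>"] by simp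
    have "(\<lambda>n. (LINT \<omega>|M. cis (s * X n \<omega>)) - (LINT \<omega>|M. cis (s * Y \<omega>))) \<longlonglongrightarrow> 0"
    proof (rule Lim_null_comparison[OF _ z], rule always_eventually, rule allI)
      fix n
      have ii: "integrable M (\<lambda>\<omega>. cmod (?X n \<omega> - ?Y \<omega>))"
        by (intro integrable_norm sq_integrable_imp_integrable sq_integrable_diff sX sY)
      have "cmod ((LINT \<omega>|M. cis (s * X n \<omega>)) - (LINT \<omega>|M. cis (s * Y \<omega>)))
          = cmod (LINT \<omega>|M. cis (s * X n \<omega>) - cis (s * Y \<omega>))"
        by (simp add: i)
      also have "\<dots> \<le> (LINT \<omega>|M. \<bar>s\<bar> * cmod (?X n \<omega> - ?Y \<omega>))"
      proof (rule order_trans[OF integral_norm_bound], rule integral_mono)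
        fix \<omega>
        show "cmod (cis (s * X n \<omega>) - cis (s * Y \<omega>)) \<le> \<bar>s\<bar> * cmod (?X n \<omega> - ?Y \<omega>)"
          using cis_diff_le[of "s * X n \<omega>" "s * Y \<omega>"]
          by (simp add: abs_mult flip: of_real_diff right_diff_distrib)
      qed (use i ii in auto)
      also have "\<dots> \<le> \<bar>s\<bar> * sqrt (?d n)"
        unfolding d using L1_le_L2[OF sq_integrable_diff[OF sX[of n] sY]]
        by (simp add: mult_left_mono)
      finally show "norm ((LINT \<omega>|M. cis (s * X n \<omega>)) - (LINT \<omega>|M. cis (s * Y \<omega>))) \<le> \<bar>s\<bar> * sqrt (?d n)" .
    qed
    then show ?thesis by (simp add: LIM_zero_iff)
  qed
  have char: "(LINT \<omega>|M. cis (s * Y \<omega>)) = exp (- (v * s\<^sup>2) / 2)" for s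
    using LIMSEQ_unique[OF l2 l1] .
  show ?thesis
  proof (cases "v = 0")
    case True
    then have "AE \<omega> in M. ?Y \<omega> = 0"
      using L2_norm_zero_AE[OF sY] unfolding v_def by simp
    then show ?thesis unfolding gaussian_rv_def by auto
  next
    case False
    then show ?thesis
      using v0 char by (intro gaussian_rv_if_char[where \<sigma> = "sqrt v"]) auto
  qed
qed

lemma Re_sq_le_cmod_sq: "(Re z)\<^sup>2 \<le> (cmod z)\<^sup>2"
  by (simp add: cmod_power2)

lemma sq_integrable_Re:
  assumes "sq_integrable M X"
  shows "(\<lambda>\<omega>. Re (X \<omega>)) \<in> borel_measurable M" "integrable M (\<lambda>\<omega>. (Re (X \<omega>))\<^sup>2)"
proof -
  show m: "(\<lambda>\<omega>. Re (X \<omega>)) \<in> borel_measurable M"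
    using assms unfolding sq_integrable_def by auto
  show "integrable M (\<lambda>\<omega>. (Re (X \<omega>))\<^sup>2)"
    by (rule Bochner_Integration.integrable_bound[of M "\<lambda>\<omega>. (cmod (X \<omega>))\<^sup>2"])
       (use assms m Re_sq_le_cmod_sq in \<open>auto simp: sq_integrable_def\<close>)
qed

section \<open>Closed linear spans of Gaussian families\<close>

definition L2_span :: "'w measure \<Rightarrow> 'i set \<Rightarrow> ('i \<Rightarrow> 'w \<Rightarrow> complex) \<Rightarrow> ('w \<Rightarrow> complex) set" where
  "L2_span M I X = {V. sq_integrable M V \<and>
     (\<forall>e>0. \<exists>J a. finite J \<and> J \<subseteq> I \<and> (LINT \<omega>|M. (cmod (V \<omega> - (\<Sum>j\<in>J. a j * X j \<omega>)))\<^sup>2) < e)}"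

lemma L2_span_approx:
  assumes "V \<in> L2_span M I X" "e > 0"
  obtains J a where "finite J" "J \<subseteq> I"
    "(LINT \<omega>|M. (cmod (V \<omega> - (\<Sum>j\<in>J. a j * X j \<omega>)))\<^sup>2) < e"
  using assms unfolding L2_span_def by blast

lemma L2_span_base:
  assumes "i \<in> I" "sq_integrable M (X i)"
  shows "X i \<in> L2_span M I X"
  unfolding L2_span_def
proof (intro CollectI conjI allI impI)
  fix e :: real assume "e > 0"
  then show "\<exists>J a. finite J \<and> J \<subseteq> I \<and> (LINT \<omega>|M. (cmod (X i \<omega> - (\<Sum>j\<in>J. a j * X j \<omega>)))\<^sup>2) < e"
    using assms by (intro exI[of _ "{i}"] exI[of _ "\<lambda>_. 1"]) simp
qed (fact assms)

lemma L2_span_limit: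
  assumes V: "\<And>n::nat. V n \<in> L2_span M I X" and W: "sq_integrable M W"
    and X: "\<And>i. i \<in> I \<Longrightarrow> sq_integrable M (X i)"
    and lim: "(\<lambda>n. L2_dist_sq M (V n) W) \<longlonglongrightarrow> 0"
  shows "W \<in> L2_span M I X"
  unfolding L2_span_def
proof (intro CollectI conjI allI impI)
  fix e :: real assume "e > 0"
  \<comment> \<open>Quarters of \<open>e\<close>, because the estimate of the square of a sum
    doubles both terms.\<close>
  then obtain n where n: "L2_dist_sq M (V n) W < e / 4"
    using order_tendstoD(2)[OF lim, of "e / 4"] by (auto simp: eventually_sequentially)
  obtain J a where J: "finite J" "J \<subseteq> I"
    "(LINT \<omega>|M. (cmod (V n \<omega> - (\<Sum>j\<in>J. a j * X j \<omega>)))\<^sup>2) < e / 4"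
    using L2_span_approx[OF V[of n], of "e / 4"] \<open>e > 0\<close> by auto
  have Vn: "sq_integrable M (V n)" using V unfolding L2_span_def by auto
  have S: "sq_integrable M (\<lambda>\<omega>. \<Sum>j\<in>J. a j * X j \<omega>)"
    using J X by (intro sq_integrable_sum sq_integrable_cmult) auto
  have "(LINT \<omega>|M. (cmod ((W \<omega> - V n \<omega>) + (V n \<omega> - (\<Sum>j\<in>J. a j * X j \<omega>))))\<^sup>2)
      \<le> 2 * L2_dist_sq M W (V n)
        + 2 * (LINT \<omega>|M. (cmod (V n \<omega> - (\<Sum>j\<in>J. a j * X j \<omega>)))\<^sup>2)"
    by (intro L2_integral_add_sq_le sq_integrable_diff W Vn S)
  then have "(LINT \<omega>|M. (cmod (W \<omega> - (\<Sum>j\<in>J. a j * X j \<omega>)))\<^sup>2) < e"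
    using n J(3) by (simp add: norm_minus_commute)
  then show "\<exists>J a. finite J \<and> J \<subseteq> I \<and> (LINT \<omega>|M. (cmod (W \<omega> - (\<Sum>j\<in>J. a j * X j \<omega>)))\<^sup>2) < e"
    using J by blast
qed (fact W)

lemma L2_span_lincomb:
  assumes V: "V \<in> L2_span M I X" and W: "W \<in> L2_span M I X"
    and X: "\<And>i. i \<in> I \<Longrightarrow> sq_integrable M (X i)"
  shows "(\<lambda>\<omega>. V \<omega> + b * W \<omega>) \<in> L2_span M I X"
  unfolding L2_span_def
proof (intro CollectI conjI allI impI)
  have sV: "sq_integrable M V" and sW: "sq_integrable M W"
    using V W unfolding L2_span_def by auto
  then show "sq_integrable M (\<lambda>\<omega>. V \<omega> + b * W \<omega>)"
    by (intro sq_integrable_add sq_integrable_cmult)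
  fix e :: real assume "e > 0"
  \<comment> \<open>The summand 1 keeps \<open>k\<close> positive when \<open>b = 0\<close>, so that
    dividing by it is safe.\<close>
  define k where "k = 1 + (cmod b)\<^sup>2"
  have k: "k > 0" "(cmod b)\<^sup>2 \<le> k" unfolding k_def by (auto simp: add_pos_nonneg)
  obtain J a where J: "finite J" "J \<subseteq> I"
    "(LINT \<omega>|M. (cmod (V \<omega> - (\<Sum>j\<in>J. a j * X j \<omega>)))\<^sup>2) < e / 4"
    using L2_span_approx[OF V, of "e / 4"] \<open>e > 0\<close> by auto
  obtain J' a' where J': "finite J'" "J' \<subseteq> I"
    "(LINT \<omega>|M. (cmod (W \<omega> - (\<Sum>j\<in>J'. a' j * X j \<omega>)))\<^sup>2) < e / (4 * k)"
    using L2_span_approx[OF W, of "e / (4 * k)"] \<open>e > 0\<close> k by auto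
  let ?S = "\<lambda>\<omega>. \<Sum>j\<in>J. a j * X j \<omega>" and ?S' = "\<lambda>\<omega>. \<Sum>j\<in>J'. a' j * X j \<omega>"
  have S: "sq_integrable M ?S" "sq_integrable M ?S'"
    using J J' X by (auto intro!: sq_integrable_sum sq_integrable_cmult)
  \<comment> \<open>The index sets may overlap; on the overlap both coefficients contribute.\<close>
  define c where "c j = (if j \<in> J then a j else 0) + b * (if j \<in> J' then a' j else 0)" for j
  have c: "(\<Sum>j\<in>J \<union> J'. c j * X j \<omega>) = ?S \<omega> + b * ?S' \<omega>" for \<omega>
  proof -
    have "(\<Sum>j\<in>J \<union> J'. c j * X j \<omega>)
        = (\<Sum>j\<in>J \<union> J'. (if j \<in> J then a j * X j \<omega> else 0)) + b * (\<Sum>j\<in>J \<union> J'. (if j \<in> J' then a' j * X j \<omega> else 0))"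
      unfolding sum_distrib_left sum.distrib[symmetric] c_def
      by (intro sum.cong) (auto simp: algebra_simps)
    then show ?thesis
      using J(1) J'(1) by (simp add: sum.If_cases Int_absorb1 Int_commute Un_Int_distrib2)
  qed
  have "(LINT \<omega>|M. (cmod ((V \<omega> - ?S \<omega>) + b * (W \<omega> - ?S' \<omega>)))\<^sup>2)
      \<le> 2 * L2_dist_sq M V ?S + 2 * (LINT \<omega>|M. (cmod (b * (W \<omega> - ?S' \<omega>)))\<^sup>2)"
    by (intro L2_integral_add_sq_le sq_integrable_diff sq_integrable_cmult sV sW S)
  also have "(LINT \<omega>|M. (cmod (b * (W \<omega> - ?S' \<omega>)))\<^sup>2) = (cmod b)\<^sup>2 * L2_dist_sq M W ?S'"
    by (simp add: norm_mult power_mult_distrib)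
  also have "\<dots> \<le> k * L2_dist_sq M W ?S'"
    using k by (intro mult_right_mono) auto
  also have "\<dots> < e / 4"
    using J'(3) k by (simp add: field_simps)
  finally have "(LINT \<omega>|M. (cmod ((V \<omega> - ?S \<omega>) + b * (W \<omega> - ?S' \<omega>)))\<^sup>2) < e"
    using J(3) by linarith
  then have "(LINT \<omega>|M. (cmod ((V \<omega> + b * W \<omega>) - (\<Sum>j\<in>J \<union> J'. c j * X j \<omega>)))\<^sup>2) < e"
    unfolding c by (simp add: algebra_simps)
  then show "\<exists>J a. finite J \<and> J \<subseteq> I \<and> (LINT \<omega>|M. (cmod ((V \<omega> + b * W \<omega>) - (\<Sum>j\<in>J. a j * X j \<omega>)))\<^sup>2) < e"
    using J J' by (intro exI[of _ "J \<union> J'"] exI[of _ c]) auto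
qed

lemma L2_span_sum:
  assumes "\<And>k. k \<in> K \<Longrightarrow> V k \<in> L2_span M I X"
    and X: "\<And>i. i \<in> I \<Longrightarrow> sq_integrable M (X i)"
  shows "(\<lambda>\<omega>. \<Sum>k\<in>K. b k * V k \<omega>) \<in> L2_span M I X"
proof -
  have "(\<lambda>\<omega>. 0) \<in> L2_span M I X"
    unfolding L2_span_def sq_integrable_def by (auto intro!: exI[of _ "{}"])
  then show ?thesis using assms(1)
  proof (induction K rule: infinite_finite_induct)
    case (insert k K)
    then show ?case
      using L2_span_lincomb[of "\<lambda>\<omega>. \<Sum>k\<in>K. b k * V k \<omega>" M I X "V k" "b k"] X
      by (simp add: add.commute)
  qed auto
qed

context prob_space
begin

text \<open>The one-point combinations with coefficients 1 and -i are the real and the imaginary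
  part, both Gaussian and hence of finite second moment.\<close>

lemma gaussian_family_sq_integrable:
  assumes "gaussian_family M I X" "i \<in> I"
  shows "sq_integrable M (X i)"
proof -
  have r: "gaussian_rv M (\<lambda>\<omega>. Re (X i \<omega>))"
    using assms(1)[unfolded gaussian_family_def, rule_format, of "{i}" "\<lambda>_. 1"] assms(2) by simp
  have m: "gaussian_rv M (\<lambda>\<omega>. Im (X i \<omega>))"
    using assms(1)[unfolded gaussian_family_def, rule_format, of "{i}" "\<lambda>_. - \<i>"] assms(2) by simp
  have 1: "(\<lambda>\<omega>. Re (X i \<omega>)) \<in> borel_measurable M" "(\<lambda>\<omega>. Im (X i \<omega>)) \<in> borel_measurable M"
    using r m unfolding gaussian_rv_def by auto
  then show ?thesis
    using gaussian_rv_sq_integrable[OF r prob_space_axioms] gaussian_rv_sq_integrable[OF m prob_space_axioms]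
    unfolding sq_integrable_def by (auto simp: cmod_power2 borel_measurable_complex_iff)
qed

text \<open>The mean vanishes on finite combinations and is continuous in mean square.\<close>

lemma L2_span_integral_zero:
  assumes X: "\<And>i. i \<in> I \<Longrightarrow> sq_integrable M (X i)" "\<And>i. i \<in> I \<Longrightarrow> (LINT \<omega>|M. X i \<omega>) = 0"
    and V: "V \<in> L2_span M I X"
  shows "(LINT \<omega>|M. V \<omega>) = 0"
proof -
  have sV: "sq_integrable M V" using V unfolding L2_span_def by auto
  have "cmod (LINT \<omega>|M. V \<omega>) \<le> sqrt e" if "e > 0" for e
  proof -
    obtain J a where J: "finite J" "J \<subseteq> I" "(LINT \<omega>|M. (cmod (V \<omega> - (\<Sum>j\<in>J. a j * X j \<omega>)))\<^sup>2) < e"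
      using L2_span_approx[OF V \<open>e > 0\<close>] .
    have S: "sq_integrable M (\<lambda>\<omega>. \<Sum>j\<in>J. a j * X j \<omega>)"
      using J X by (intro sq_integrable_sum sq_integrable_cmult) auto
    have "(LINT \<omega>|M. (\<Sum>j\<in>J. a j * X j \<omega>)) = 0"
      using J X sq_integrable_imp_integrable[OF X(1)]
      by (subst Bochner_Integration.integral_sum) (auto intro!: sum.neutral)
    then have "(LINT \<omega>|M. V \<omega>) = (LINT \<omega>|M. V \<omega> - (\<Sum>j\<in>J. a j * X j \<omega>))"
      using sq_integrable_imp_integrable[OF sV] sq_integrable_imp_integrable[OF S] by simp
    also have "cmod \<dots> \<le> (LINT \<omega>|M. cmod (V \<omega> - (\<Sum>j\<in>J. a j * X j \<omega>)))" by simp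
    also have "\<dots> \<le> sqrt (LINT \<omega>|M. (cmod (V \<omega> - (\<Sum>j\<in>J. a j * X j \<omega>)))\<^sup>2)"
      by (intro L1_le_L2 sq_integrable_diff sV S)
    also have "\<dots> \<le> sqrt e" using J by simp
    finally show ?thesis .
  qed
  note le = this
  have "cmod (LINT \<omega>|M. V \<omega>) \<le> e" if "e > 0" for e
    using le[of "e\<^sup>2"] \<open>e > 0\<close> by simp
  then show ?thesis using field_le_epsilon[of "cmod (LINT \<omega>|M. V \<omega>)" 0] by simp
qed

text \<open>The closed span of a centred Gaussian family is a Gaussian Hilbert space: a combination
  of elements of the span lies in the span, so its real part is a mean square limit of centred real
  Gaussians.\<close>

lemma gaussian_family_L2_span:
  assumes X: "gaussian_family M I X" "\<And>i. i \<in> I \<Longrightarrow> (LINT \<omega>|M. X i \<omega>) = 0"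
    and V: "\<And>k. k \<in> K \<Longrightarrow> V k \<in> L2_span M I X"
  shows "gaussian_family M K V"
  unfolding gaussian_family_def
proof (intro allI impI)
  fix J b assume J: "finite J \<and> J \<subseteq> K"
  note sX = gaussian_family_sq_integrable[OF X(1)]
  let ?W = "\<lambda>\<omega>. \<Sum>j\<in>J. b j * V j \<omega>"
  have W: "?W \<in> L2_span M I X" using J V sX by (intro L2_span_sum) auto
  then have sW: "sq_integrable M ?W" unfolding L2_span_def by auto
  have "\<forall>n::nat. \<exists>J a. finite J \<and> J \<subseteq> I \<and> (LINT \<omega>|M. (cmod (?W \<omega> - (\<Sum>j\<in>J. a j * X j \<omega>)))\<^sup>2) < 1 / Suc n"
  proof
    fix n :: nat
    show "\<exists>J a. finite J \<and> J \<subseteq> I \<and> (LINT \<omega>|M. (cmod (?W \<omega> - (\<Sum>j\<in>J. a j * X j \<omega>)))\<^sup>2) < 1 / Suc n"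
      by (rule W[unfolded L2_span_def, THEN CollectD, THEN conjunct2, rule_format]) simp
  qed
  from choice[OF this] obtain N where "\<forall>n::nat. \<exists>a. finite (N n) \<and> N n \<subseteq> I
    \<and> (LINT \<omega>|M. (cmod (?W \<omega> - (\<Sum>j\<in>N n. a j * X j \<omega>)))\<^sup>2) < 1 / Suc n" ..
  from choice[OF this] obtain a where N: "\<And>n. finite (N n)" "\<And>n. N n \<subseteq> I"
    "\<And>n::nat. (LINT \<omega>|M. (cmod (?W \<omega> - (\<Sum>j\<in>N n. a n j * X j \<omega>)))\<^sup>2) < 1 / Suc n"
    by blast
  let ?Z = "\<lambda>n \<omega>. \<Sum>j\<in>N n. a n j * X j \<omega>"
  have sZ: "sq_integrable M (?Z n)" for n
    using sX subsetD[OF N(2)] by (intro sq_integrable_sum sq_integrable_cmult) blast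
  show "gaussian_rv M (\<lambda>\<omega>. Re (?W \<omega>))"
  proof (rule gaussian_rv_L2_limit[where X = "\<lambda>n \<omega>. Re (?Z n \<omega>)"])
    show "gaussian_rv M (\<lambda>\<omega>. Re (?Z n \<omega>))" for n
      using X(1) N unfolding gaussian_family_def by blast
    have "(LINT \<omega>|M. ?Z n \<omega>) = 0" for n
      using subsetD[OF N(2)] X(2) sq_integrable_imp_integrable[OF sX]
      by (subst Bochner_Integration.integral_sum) (auto intro!: sum.neutral)
    then show "(LINT \<omega>|M. Re (?Z n \<omega>)) = 0" for n
      using integral_Re[OF sq_integrable_imp_integrable[OF sZ[of n]]] by simp
    show "(\<lambda>\<omega>. Re (?W \<omega>)) \<in> borel_measurable M" "integrable M (\<lambda>\<omega>. (Re (?W \<omega>))\<^sup>2)"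
      by (rule sq_integrable_Re[OF sW])+
    show "(\<lambda>n. LINT \<omega>|M. (Re (?Z n \<omega>) - Re (?W \<omega>))\<^sup>2) \<longlonglongrightarrow> 0"
    proof (rule Lim_null_comparison[OF _ LIMSEQ_inverse_real_of_nat], rule always_eventually, rule allI)
      fix n
      have d: "sq_integrable M (\<lambda>\<omega>. ?W \<omega> - ?Z n \<omega>)" by (intro sq_integrable_diff sW sZ)
      have "(LINT \<omega>|M. (Re (?Z n \<omega>) - Re (?W \<omega>))\<^sup>2) \<le> L2_dist_sq M ?W (?Z n)"
      proof (rule integral_mono')
        show "integrable M (\<lambda>\<omega>. (cmod (?W \<omega> - ?Z n \<omega>))\<^sup>2)" using d unfolding sq_integrable_def by auto
        show "(Re (?Z n \<omega>) - Re (?W \<omega>))\<^sup>2 \<le> (cmod (?W \<omega> - ?Z n \<omega>))\<^sup>2" for \<omega>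
          using Re_sq_le_cmod_sq[of "?W \<omega> - ?Z n \<omega>"]
          unfolding power2_commute[of "Re (?Z n \<omega>)"] minus_complex.sel .
      qed simp
      then show "norm (LINT \<omega>|M. (Re (?Z n \<omega>) - Re (?W \<omega>))\<^sup>2) \<le> inverse (real (Suc n))"
        using N(3)[of n] by (simp add: inverse_eq_divide)
    qed
  qed
qed

end

section \<open>Fourier inversion\<close>

lemma norm_integral_le:
  fixes f :: "'a \<Rightarrow> 'b::{banach,second_countable_topology}"
  assumes "integrable M f" "integrable M g" "\<And>x. norm (f x) \<le> g x"
  shows "norm (LINT x|M. f x) \<le> (LINT x|M. g x)"
  using assms by (intro order_trans[OF integral_norm_bound] integral_mono) auto

lemma lborel_pair_integrable_bound:
  fixes h :: "real \<times> real \<Rightarrow> complex"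
  assumes [measurable]: "h \<in> borel_measurable (lborel \<Otimes>\<^sub>M lborel)"
    and F: "integrable lborel F" and G: "integrable lborel G"
    and le: "\<And>x y. cmod (h (x, y)) \<le> F x * G y"
  shows "integrable (lborel \<Otimes>\<^sub>M lborel) h"
proof (rule lborel_pair.Fubini_integrable)
  show i: "AE x in lborel. integrable lborel (\<lambda>y. h (x, y))"
  proof (rule AE_I2)
    fix x
    show "integrable lborel (\<lambda>y. h (x, y))"
      by (rule Bochner_Integration.integrable_bound[OF integrable_mult_right[OF G, of "F x"]])
         (use le in \<open>auto intro: order_trans[OF _ abs_ge_self]\<close>)
  qed
  show "integrable lborel (\<lambda>x. LBINT y. norm (h (x, y)))"
  proof (rule Bochner_Integration.integrable_bound[OF integrable_mult_left[OF F, of "LBINT y. G y"]])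
    show "AE x in lborel. norm (LBINT y. norm (h (x, y))) \<le> norm (F x * (LBINT y. G y))"
      using i
    proof (rule AE_mp, intro AE_I2 impI)
      fix x assume "integrable lborel (\<lambda>y. h (x, y))"
      then have "(LBINT y. norm (h (x, y))) \<le> (LBINT y. F x * G y)"
        using le G by (intro integral_mono) auto
      then show "norm (LBINT y. norm (h (x, y))) \<le> norm (F x * (LBINT y. G y))"
        by simp
    qed
  qed measurable
qed measurable

lemma borel_measurable_cis [measurable]: "cis \<in> borel_measurable borel"
  by (intro borel_measurable_continuous_onI continuous_intros)

text \<open>This is the characteristic function of the standard normal law at
  \<open>z / \<sigma>\<close>, after the substitution x = 2 pi \<sigma> k.\<close>

lemma integral_cis_gaussian:
  assumes "\<sigma> > 0"
  shows "(LBINT k. cis (2 * pi * k * z) * exp (- (2 * (pi * \<sigma> * k)\<^sup>2)))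
           = complex_of_real (normal_density 0 \<sigma> z)"
proof -
  let ?a = "2 * pi * \<sigma>"
  have a: "?a > 0" "\<sigma> \<noteq> 0" using assms by simp_all
  have "char std_normal_distribution (z / \<sigma>)
      = (LBINT x. complex_of_real (std_normal_density x) * iexp (z / \<sigma> * x))"
    unfolding char_def by (subst integral_density) (auto simp: scaleR_conv_of_real)
  also have "\<dots> = \<bar>?a\<bar> *\<^sub>R (LBINT k. complex_of_real (std_normal_density (0 + ?a * k)) * iexp (z / \<sigma> * (0 + ?a * k)))"
    by (rule lborel_integral_real_affine) (use assms in simp)
  also have "(LBINT k. complex_of_real (std_normal_density (0 + ?a * k)) * iexp (z / \<sigma> * (0 + ?a * k)))
      = (LBINT k. complex_of_real (1 / sqrt (2 * pi)) * (cis (2 * pi * k * z) * exp (- (2 * (pi * \<sigma> * k)\<^sup>2))))"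
    using assms
    by (intro Bochner_Integration.integral_cong refl)
       (simp add: cis_conv_exp std_normal_density_def power_mult_distrib mult_ac exp_of_real)
  also have "\<dots> = complex_of_real (1 / sqrt (2 * pi)) * (LBINT k. cis (2 * pi * k * z) * exp (- (2 * (pi * \<sigma> * k)\<^sup>2)))"
    by (rule integral_mult_right_zero)
  finally have eq: "complex_of_real (exp (- (z / \<sigma>)\<^sup>2 / 2))
      = complex_of_real (?a / sqrt (2 * pi)) * (LBINT k. cis (2 * pi * k * z) * exp (- (2 * (pi * \<sigma> * k)\<^sup>2)))"
    using assms by (simp add: char_std_normal_distribution scaleR_conv_of_real exp_of_real abs_mult)
  have p: "complex_of_real (?a / sqrt (2 * pi)) \<noteq> 0" using assms by simp
  have "(LBINT k. cis (2 * pi * k * z) * exp (- (2 * (pi * \<sigma> * k)\<^sup>2)))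
      = complex_of_real (exp (- (z / \<sigma>)\<^sup>2 / 2)) / complex_of_real (?a / sqrt (2 * pi))"
    unfolding eq using p by (rule nonzero_mult_div_cancel_left[symmetric])
  also have "\<dots> = complex_of_real (sqrt (2 * pi) / ?a * exp (- (z / \<sigma>)\<^sup>2 / 2))"
    by simp
  also have "sqrt (2 * pi) / ?a = 1 / sqrt (2 * pi * \<sigma>\<^sup>2)"
  proof -
    have 1: "sqrt (2 * pi * \<sigma>\<^sup>2) = sqrt (2 * pi) * \<sigma>" using assms by (simp add: real_sqrt_mult)
    have "sqrt (2 * pi) * (sqrt (2 * pi) * \<sigma>) = ?a"
      by (simp only: mult.assoc[symmetric] real_sqrt_mult_self) simp
    then show ?thesis unfolding 1 using assms by (simp add: divide_simps)
  qed
  finally show ?thesis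
    by (simp add: normal_density_def power_divide)
qed

text \<open>The substitution y = x - \<sigma> s moves the dependence on \<open>n\<close> from the
  kernel into the argument of \<open>f\<close>; continuity gives the pointwise limit and boundedness
  the domination.\<close>

lemma gaussian_mollifier_tendsto:
  fixes f :: "real \<Rightarrow> complex"
  assumes f: "continuous_on UNIV f" "\<And>x. cmod (f x) \<le> B"
    and \<sigma>: "\<sigma> \<longlonglongrightarrow> 0" "\<And>n::nat. \<sigma> n > 0"
  shows "(\<lambda>n. LBINT y. f y * normal_density 0 (\<sigma> n) (x - y)) \<longlonglongrightarrow> f x"
proof -
  have [measurable]: "f \<in> borel_measurable borel" by (intro borel_measurable_continuous_onI f)
  have "(LBINT y. f y * normal_density 0 (\<sigma> n) (x - y))
      = (LBINT s. std_normal_density s *\<^sub>R f (x - \<sigma> n * s))" for n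
  proof -
    have "(LBINT y. f y * normal_density 0 (\<sigma> n) (x - y))
        = \<bar>- \<sigma> n\<bar> *\<^sub>R (LBINT s. f (x + (- \<sigma> n) * s) * normal_density 0 (\<sigma> n) (x - (x + (- \<sigma> n) * s)))"
      by (rule lborel_integral_real_affine) (use \<sigma>(2)[of n] in simp)
    also have "\<dots> = (LBINT s. \<sigma> n *\<^sub>R (f (x + (- \<sigma> n) * s) * normal_density 0 (\<sigma> n) (x - (x + (- \<sigma> n) * s))))"
      using \<sigma>(2)[of n] by simp
    also have "\<dots> = (LBINT s. std_normal_density s *\<^sub>R f (x - \<sigma> n * s))"
      using \<sigma>(2)[of n]
      by (intro Bochner_Integration.integral_cong refl)
         (simp add: normal_density_def scaleR_conv_of_real real_sqrt_mult power_mult_distrib field_simps)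
    finally show ?thesis .
  qed
  moreover have "(\<lambda>n. LBINT s. std_normal_density s *\<^sub>R f (x - \<sigma> n * s))
      \<longlonglongrightarrow> (LBINT s. std_normal_density s *\<^sub>R f x)"
  proof (rule integral_dominated_convergence[where w = "\<lambda>s. std_normal_density s * B"])
    show "integrable lborel (\<lambda>s. std_normal_density s * B)" by (auto simp: integrable_normal_density)
    show "AE s in lborel. (\<lambda>n. std_normal_density s *\<^sub>R f (x - \<sigma> n * s)) \<longlonglongrightarrow> std_normal_density s *\<^sub>R f x"
    proof (rule AE_I2, rule tendsto_scaleR[OF tendsto_const])
      fix s
      have "(\<lambda>n. x - \<sigma> n * s) \<longlonglongrightarrow> x - 0 * s" by (intro tendsto_intros \<sigma>)
      then show "(\<lambda>n. f (x - \<sigma> n * s)) \<longlonglongrightarrow> f x"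
        using f(1) by (auto simp: continuous_on_eq_continuous_at intro: isCont_tendsto_compose)
    qed
    show "AE s in lborel. norm (std_normal_density s *\<^sub>R f (x - \<sigma> n * s)) \<le> std_normal_density s * B" for n
      using f(2) by (auto intro!: AE_I2 mult_left_mono)
  qed auto
  moreover have "(LBINT s. std_normal_density s *\<^sub>R f x) = f x"
    by (subst integral_scaleR_left) (auto simp: integrable_normal_density integral_normal_density)
  ultimately show ?thesis by simp
qed

lemma fourier_bounded:
  assumes "integrable lborel f"
  shows "cmod (fourier f k) \<le> (LBINT x. cmod (f x))"
proof -
  have "integrable lborel (\<lambda>x. cis (- (2 * pi * x * k)) * f x)"
    by (rule Bochner_Integration.integrable_bound[OF assms]) (use assms in \<open>auto simp: norm_mult\<close>)
  then show ?thesis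
    unfolding fourier_def using assms
    by (intro norm_integral_le) (auto simp: norm_mult)
qed

lemma continuous_fourier:
  assumes f: "integrable lborel f"
  shows "continuous_on UNIV (fourier f)"
proof -
  have [measurable]: "f \<in> borel_measurable borel" using f by auto
  have "isCont (fourier f) x" for x
  proof (rule continuous_at_sequentiallyI)
    fix u assume u: "u \<longlonglongrightarrow> x"
    show "(\<lambda>n. fourier f (u n)) \<longlonglongrightarrow> fourier f x"
      unfolding fourier_def
    proof (rule integral_dominated_convergence[where w = "\<lambda>k. cmod (f k)"])
      show "AE k in lborel. (\<lambda>n. cis (- (2 * pi * k * u n)) * f k) \<longlonglongrightarrow> cis (- (2 * pi * k * x)) * f k"
        by (intro AE_I2 tendsto_intros u)
    qed (use f in \<open>auto simp: norm_mult\<close>)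
  qed
  then show ?thesis by (simp add: continuous_at_imp_continuous_on)
qed

text \<open>The double integral over \<open>k\<close> and \<open>y\<close> is not absolutely
  convergent, so a Gaussian factor is inserted in \<open>k\<close>. With it Fubini applies and
  yields \<open>f\<close> smoothed by a normal density of width \<open>\<sigma> n\<close>. Letting
  the width tend to 0 removes the factor on one side and the smoothing on the other.\<close>

theorem fourier_inversion:
  fixes f :: "real \<Rightarrow> complex"
  assumes f: "continuous_on UNIV f" "\<And>x. cmod (f x) \<le> B" "integrable lborel f"
    and F: "integrable lborel (fourier f)"
  shows "f x = (LBINT k. cis (2 * pi * k * x) * fourier f k)"
proof -
  define \<sigma> where "\<sigma> n = 1 / real (Suc n)" for n
  have \<sigma>: "\<sigma> n > 0" "\<sigma> \<longlonglongrightarrow> 0" for n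
    unfolding \<sigma>_def using LIMSEQ_inverse_real_of_nat by (auto simp: inverse_eq_divide)
  have [measurable]: "f \<in> borel_measurable borel" "fourier f \<in> borel_measurable borel"
    using f F by auto
  let ?g = "\<lambda>n k. complex_of_real (exp (- (2 * (pi * \<sigma> n * k)\<^sup>2)))"
  have ig: "integrable lborel (\<lambda>k. exp (- (2 * (pi * \<sigma> n * k)\<^sup>2)))" for n
  proof -
    \<comment> \<open>Up to normalization the factor is a normal density of standard deviation 1/(2
      pi \<sigma>).\<close>
    have "integrable lborel (\<lambda>k. sqrt (2 * pi * (1 / (2 * pi * \<sigma> n))\<^sup>2) * normal_density 0 (1 / (2 * pi * \<sigma> n)) k)"
      using \<sigma>(1)[of n] by (auto intro!: integrable_normal_density)
    moreover have "sqrt (2 * pi * (1 / (2 * pi * \<sigma> n))\<^sup>2) * normal_density 0 (1 / (2 * pi * \<sigma> n)) k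
        = exp (- (2 * (pi * \<sigma> n * k)\<^sup>2))" for k
      using \<sigma>(1)[of n] by (simp add: normal_density_def power_divide power_mult_distrib field_simps)
    ultimately show ?thesis by simp
  qed
  have "(\<lambda>n. LBINT k. cis (2 * pi * k * x) * fourier f k * ?g n k)
      \<longlonglongrightarrow> (LBINT k. cis (2 * pi * k * x) * fourier f k)"
  proof (rule integral_dominated_convergence[where w = "\<lambda>k. cmod (fourier f k)"])
    show "AE k in lborel. (\<lambda>n. cis (2 * pi * k * x) * fourier f k * ?g n k) \<longlonglongrightarrow> cis (2 * pi * k * x) * fourier f k"
    proof (rule AE_I2)
      fix k
      have "(\<lambda>n. cis (2 * pi * k * x) * fourier f k * ?g n k)
          \<longlonglongrightarrow> cis (2 * pi * k * x) * fourier f k * complex_of_real (exp (- (2 * (pi * 0 * k)\<^sup>2)))"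
        by (intro tendsto_intros \<sigma>)
      then show "(\<lambda>n. cis (2 * pi * k * x) * fourier f k * ?g n k) \<longlonglongrightarrow> cis (2 * pi * k * x) * fourier f k"
        by simp
    qed
    show "AE k in lborel. norm (cis (2 * pi * k * x) * fourier f k * ?g n k) \<le> cmod (fourier f k)" for n
      by (intro AE_I2) (simp add: norm_mult mult_left_le)
  qed (use F in auto)
  moreover have "(LBINT k. cis (2 * pi * k * x) * fourier f k * ?g n k)
      = (LBINT y. f y * normal_density 0 (\<sigma> n) (x - y))" for n
  proof -
    let ?h = "\<lambda>(k, y). cis (2 * pi * k * (x - y)) * f y * ?g n k"
    have int: "integrable (lborel \<Otimes>\<^sub>M lborel) ?h"
    proof (rule lborel_pair_integrable_bound)
      show "cmod (?h (k, y)) \<le> exp (- (2 * (pi * \<sigma> n * k)\<^sup>2)) * cmod (f y)" for k y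
        by (simp add: norm_mult)
    qed (use ig f in \<open>auto intro: integrable_norm\<close>)
    have "(LBINT k. cis (2 * pi * k * x) * fourier f k * ?g n k)
        = (LBINT k. LBINT y. cis (2 * pi * k * (x - y)) * f y * ?g n k)"
    proof (rule Bochner_Integration.integral_cong[OF refl])
      fix k
      have "cis (2 * pi * k * x) * fourier f k * ?g n k
          = (LBINT y. (cis (2 * pi * k * x) * ?g n k) * (cis (- (2 * pi * y * k)) * f y))"
        unfolding fourier_def by simp
      also have "\<dots> = (LBINT y. cis (2 * pi * k * (x - y)) * f y * ?g n k)"
      proof (intro Bochner_Integration.integral_cong refl)
        fix y
        have "cis (2 * pi * k * (x - y)) = cis (2 * pi * k * x) * cis (- (2 * pi * y * k))"
          by (simp add: cis_mult algebra_simps)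
        then show "(cis (2 * pi * k * x) * ?g n k) * (cis (- (2 * pi * y * k)) * f y)
            = cis (2 * pi * k * (x - y)) * f y * ?g n k" by simp
      qed
      finally show "cis (2 * pi * k * x) * fourier f k * ?g n k
          = (LBINT y. cis (2 * pi * k * (x - y)) * f y * ?g n k)" .
    qed
    also have "\<dots> = (LBINT y. LBINT k. cis (2 * pi * k * (x - y)) * f y * ?g n k)"
      using lborel_pair.Fubini_integral[OF int] by simp
    also have "\<dots> = (LBINT y. f y * (LBINT k. cis (2 * pi * k * (x - y)) * ?g n k))"
      by (simp add: mult_ac flip: integral_mult_right_zero)
    also have "\<dots> = (LBINT y. f y * normal_density 0 (\<sigma> n) (x - y))"
      using integral_cis_gaussian[OF \<sigma>(1)[of n]] by simp
    finally show ?thesis .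
  qed
  ultimately show ?thesis
    using LIMSEQ_unique[OF gaussian_mollifier_tendsto[OF f(1,2) \<sigma>(2,1)]] by simp
qed

section \<open>Schwartz functions and Riemann sums\<close>

lemma integrable_decay_majorant: "integrable lborel (\<lambda>x::real. B / (1 + x\<^sup>2))"
proof -
  have "integrable lborel (\<lambda>x::real. inverse (1 + x\<^sup>2))"
    using integrable_inverse_1_plus_square by (simp add: set_integrable_def)
  then have "integrable lborel (\<lambda>x::real. B * inverse (1 + x\<^sup>2))" by simp
  then show ?thesis by (simp add: divide_inverse)
qed

lemma one_plus_square_pos: "0 < 1 + (x::real)\<^sup>2"
  by (simp add: add_pos_nonneg)

text \<open>Allows the majorant 1/(1 + x^2) to be evaluated at a grid point instead of
  \<open>x\<close>, at the cost of a factor 3.\<close>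

lemma one_plus_square_shift_le:
  assumes "\<bar>x - y\<bar> \<le> (1::real)"
  shows "1 + x\<^sup>2 \<le> 3 * (1 + y\<^sup>2)"
proof -
  have 1: "(x - y)\<^sup>2 \<le> 1" using assms by (simp add: abs_square_le_1)
  have "x\<^sup>2 \<le> 2 * (x - y)\<^sup>2 + 2 * y\<^sup>2"
    using zero_le_power2[of "x - 2 * y"] by (simp add: power2_eq_square algebra_simps)
  also have "\<dots> \<le> 2 * 1 + 2 * y\<^sup>2" using 1 by (intro add_mono mult_left_mono) auto
  also have "\<dots> \<le> 2 + 3 * y\<^sup>2" by simp
  finally show ?thesis by simp
qed

lemma iter_deriv_has_vector_derivative:
  assumes "smooth f"
  shows "(iter_deriv n f has_vector_derivative iter_deriv (Suc n) f x) (at x)"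
  using assms vector_derivative_works unfolding smooth_def by (auto simp: iter_deriv_def)

lemma smooth_imp_continuous:
  assumes "smooth f"
  shows "continuous_on UNIV (iter_deriv n f)"
  using assms by (auto simp: smooth_def intro!: continuous_at_imp_continuous_on differentiable_imp_continuous_within)

lemma schwartz_decay:
  assumes "schwartz f"
  obtains B where "\<And>x. norm (iter_deriv n f x) \<le> B / (1 + x\<^sup>2)"
proof -
  obtain B0 where B0: "\<And>x. \<bar>x\<bar> ^ 0 * norm (iter_deriv n f x) \<le> B0"
    using assms unfolding schwartz_def by blast
  obtain B2 where B2: "\<And>x. \<bar>x\<bar> ^ 2 * norm (iter_deriv n f x) \<le> B2"
    using assms unfolding schwartz_def by blast
  have "norm (iter_deriv n f x) \<le> (B0 + B2) / (1 + x\<^sup>2)" for x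
    using B0[of x] B2[of x] one_plus_square_pos[of x]
    by (simp add: pos_le_divide_eq algebra_simps)
  then show ?thesis by (rule that)
qed

lemma integrable_decay:
  fixes f :: "real \<Rightarrow> complex"
  assumes f: "f \<in> borel_measurable borel" "\<And>x. cmod (f x) \<le> B / (1 + x\<^sup>2)"
  shows "integrable lborel f"
proof (rule Bochner_Integration.integrable_bound[OF integrable_decay_majorant[of B]])
  show "AE x in lborel. cmod (f x) \<le> norm (B / (1 + x\<^sup>2))"
    using f(2) order_trans[OF _ abs_ge_self] unfolding real_norm_def by blast
qed (use f in simp)

lemma tendsto_decay:
  fixes f :: "real \<Rightarrow> complex"
  assumes "\<And>x. cmod (f x) \<le> B / (1 + x\<^sup>2)"
  shows "(f \<longlongrightarrow> 0) at_top" "(f \<longlongrightarrow> 0) at_bot"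
proof -
  have 1: "filterlim (\<lambda>x::real. 1 + x\<^sup>2) at_top at_top"
    by (intro filterlim_tendsto_add_at_top[OF tendsto_const] filterlim_pow_at_top filterlim_ident) simp
  have 2: "filterlim (\<lambda>x::real. 1 + x\<^sup>2) at_top at_bot"
    using 1 unfolding at_top_mirror by (simp add: filterlim_filtermap)
  have l: "((\<lambda>x. B / (1 + x\<^sup>2)) \<longlongrightarrow> 0) at_top" "((\<lambda>x. B / (1 + x\<^sup>2)) \<longlongrightarrow> 0) at_bot"
    by (rule tendsto_divide_0[OF tendsto_const filterlim_at_top_imp_at_infinity], fact 1 2)+
  show "(f \<longlongrightarrow> 0) at_top" "(f \<longlongrightarrow> 0) at_bot"
    by (rule Lim_null_comparison[OF always_eventually l(1)] Lim_null_comparison[OF always_eventually l(2)],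
        use assms in blast)+
qed

text \<open>Integration by parts, in the form that the derivative \<open>g\<close> of the product
  \<open>G\<close> integrates to zero over the line because \<open>G\<close> vanishes at both
  ends.\<close>

lemma fourier_vector_derivative:
  fixes f f' :: "real \<Rightarrow> complex"
  assumes f': "\<And>x. (f has_vector_derivative f' x) (at x)" and c: "continuous_on UNIV f'"
    and B: "\<And>x. cmod (f x) \<le> B / (1 + x\<^sup>2)" "\<And>x. cmod (f' x) \<le> B' / (1 + x\<^sup>2)"
  shows "fourier f' k = 2 * \<i> * pi * k * fourier f k"
proof -
  define G where "G x = cis (- (2 * pi * x * k)) * f x" for x
  define g where "g x = cis (- (2 * pi * x * k)) * f' x - 2 * \<i> * pi * k * (cis (- (2 * pi * x * k)) * f x)" for x
  have cf: "continuous_on UNIV f"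
    using f' by (meson continuous_at_imp_continuous_on has_vector_derivative_continuous)
  have i: "integrable lborel (\<lambda>x. cis (- (2 * pi * x * k)) * f' x)"
          "integrable lborel (\<lambda>x. cis (- (2 * pi * x * k)) * f x)"
    using B c cf
    by (intro integrable_decay[where B = B'] borel_measurable_continuous_onI continuous_intros;
        simp add: norm_mult)
       (use B c cf in \<open>intro integrable_decay[where B = B] borel_measurable_continuous_onI continuous_intros;
        simp add: norm_mult\<close>)
  have "(LBINT x=-\<infinity>..\<infinity>. g x) = 0 - 0"
  proof (rule interval_integral_FTC_integrable[where F = G])
    show "(G has_vector_derivative g x) (at x)" for x
    proof -
      have "((\<lambda>z. exp (- (2 * \<i> * pi * k) * z)) has_field_derivative
          - (2 * \<i> * pi * k) * exp (- (2 * \<i> * pi * k) * complex_of_real x)) (at (complex_of_real x))"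
        by (auto intro!: derivative_eq_intros)
      from has_vector_derivative_mult[OF has_vector_derivative_real_field[OF this] f'[of x]]
      show ?thesis unfolding G_def g_def cis_conv_exp by (simp add: algebra_simps)
    qed
    have "continuous_on UNIV g"
      unfolding g_def by (intro continuous_intros c cf)
    then show "isCont g x" for x by (simp add: continuous_on_eq_continuous_at)
    show "set_integrable lborel (einterval (-\<infinity>) \<infinity>) g"
      unfolding set_integrable_def g_def using i by simp
    have "cmod (G x) \<le> B / (1 + x\<^sup>2)" for x unfolding G_def using B by (simp add: norm_mult)
    then show "((G \<circ> real_of_ereal) \<longlongrightarrow> 0) (at_right (-\<infinity>))" "((G \<circ> real_of_ereal) \<longlongrightarrow> 0) (at_left \<infinity>)"
      using tendsto_decay[of G B] by (simp_all add: ereal_tendsto_simps)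
  qed simp
  then have "(LBINT x. g x) = 0"
    by (simp add: interval_lebesgue_integral_def set_lebesgue_integral_def)
  moreover have "(LBINT x. g x) = fourier f' k - 2 * \<i> * pi * k * fourier f k"
    unfolding g_def fourier_def using i by simp
  ultimately show ?thesis by simp
qed

text \<open>Two derivatives produce the factor (2 pi x)^2, and the transform of the second
  derivative is bounded. This order of decay is the one of the common majorant 1/(1 + x^2).\<close>

lemma schwartz_fourier_decay:
  fixes \<phi> :: "real \<Rightarrow> complex"
  assumes "schwartz \<phi>"
  obtains B where "\<And>x. cmod (fourier \<phi> x) \<le> B / (1 + x\<^sup>2)"
proof -
  have s: "smooth \<phi>" using assms unfolding schwartz_def by auto
  note c = smooth_imp_continuous[OF s] and d = iter_deriv_has_vector_derivative[OF s]
  obtain B0 where B0: "\<And>x. cmod (iter_deriv 0 \<phi> x) \<le> B0 / (1 + x\<^sup>2)" using schwartz_decay[OF assms, of 0] by blast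
  obtain B1 where B1: "\<And>x. cmod (iter_deriv (Suc 0) \<phi> x) \<le> B1 / (1 + x\<^sup>2)"
    using schwartz_decay[OF assms, of "Suc 0"] by blast
  obtain B2 where B2: "\<And>x. cmod (iter_deriv (Suc (Suc 0)) \<phi> x) \<le> B2 / (1 + x\<^sup>2)"
    using schwartz_decay[OF assms, of "Suc (Suc 0)"] by blast
  let ?I = "\<lambda>j. LBINT x. cmod (iter_deriv j \<phi> x)"
  have 0: "iter_deriv 0 \<phi> = \<phi>" by (simp add: iter_deriv_def)
  have F2: "fourier (iter_deriv (Suc (Suc 0)) \<phi>) x = (2 * \<i> * pi * x)\<^sup>2 * fourier \<phi> x" for x
    using fourier_vector_derivative[OF d c B0 B1, of x] fourier_vector_derivative[OF d c B1 B2, of x]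
    unfolding 0 by (simp add: power2_eq_square)
  have "cmod (fourier \<phi> x) \<le> (?I 0 + ?I (Suc (Suc 0))) / (1 + x\<^sup>2)" for x
  proof -
    have i: "integrable lborel (iter_deriv 0 \<phi>)" "integrable lborel (iter_deriv (Suc (Suc 0)) \<phi>)"
      using B0 B2 c by (auto intro!: integrable_decay borel_measurable_continuous_onI)
    have "cmod (fourier \<phi> x) \<le> ?I 0" using fourier_bounded[OF i(1)] unfolding 0 .
    moreover have "x\<^sup>2 * cmod (fourier \<phi> x) \<le> ?I (Suc (Suc 0))"
    proof -
      have "x\<^sup>2 * cmod (fourier \<phi> x) \<le> (2 * pi * x)\<^sup>2 * cmod (fourier \<phi> x)"
      proof (rule mult_right_mono)
        have "1 \<le> (2 * pi)\<^sup>2" using pi_gt3 by (intro one_le_power) simp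
        then show "x\<^sup>2 \<le> (2 * pi * x)\<^sup>2"
          using mult_right_mono[of 1 "(2 * pi)\<^sup>2" "x\<^sup>2"] by (simp add: power_mult_distrib)
      qed simp
      also have "\<dots> = cmod (fourier (iter_deriv (Suc (Suc 0)) \<phi>) x)"
        unfolding F2 by (simp add: norm_mult norm_power power_mult_distrib)
      also have "\<dots> \<le> ?I (Suc (Suc 0))" by (rule fourier_bounded[OF i(2)])
      finally show ?thesis .
    qed
    ultimately show ?thesis
      using one_plus_square_pos[of x] by (simp add: pos_le_divide_eq algebra_simps)
  qed
  then show ?thesis by (rule that)
qed

lemma schwartz_integrable:
  fixes \<phi> :: "real \<Rightarrow> complex"
  assumes "schwartz \<phi>"
  shows "continuous_on UNIV \<phi>" "integrable lborel \<phi>" "integrable lborel (fourier \<phi>)"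
proof -
  show c: "continuous_on UNIV \<phi>"
    using smooth_imp_continuous[of \<phi> 0] assms unfolding schwartz_def by (simp add: iter_deriv_def)
  obtain B where "\<And>x. cmod (iter_deriv 0 \<phi> x) \<le> B / (1 + x\<^sup>2)" using schwartz_decay[OF assms, of 0] by blast
  then show i: "integrable lborel \<phi>"
    using c by (intro integrable_decay borel_measurable_continuous_onI) (auto simp: iter_deriv_def)
  obtain B where "\<And>x. cmod (fourier \<phi> x) \<le> B / (1 + x\<^sup>2)" using schwartz_fourier_decay[OF assms] by blast
  then show "integrable lborel (fourier \<phi>)"
    using continuous_fourier[OF i] by (intro integrable_decay borel_measurable_continuous_onI)
qed

lemma schwartz_fourier_inversion:
  fixes \<phi> :: "real \<Rightarrow> complex"
  assumes "schwartz \<phi>"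
  shows "\<phi> x = (LBINT k. cis (2 * pi * k * x) * fourier \<phi> k)"
proof -
  obtain B where "\<And>x. \<bar>x\<bar> ^ 0 * norm (iter_deriv 0 \<phi> x) \<le> B"
    using assms unfolding schwartz_def by blast
  then show ?thesis
    using schwartz_integrable[OF assms] by (intro fourier_inversion[where B = B]) (auto simp: iter_deriv_def)
qed

lemma schwartz_of_real:
  fixes f :: "real \<Rightarrow> real"
  assumes "schwartz f"
  shows "schwartz (\<lambda>x. complex_of_real (f x))"
proof -
  have s: "smooth f" using assms unfolding schwartz_def by auto
  have it: "iter_deriv n (\<lambda>x. complex_of_real (f x)) = (\<lambda>x. complex_of_real (iter_deriv n f x))" for n
  proof (induction n)
    case (Suc n)
    have "iter_deriv (Suc n) (\<lambda>x. complex_of_real (f x)) = (\<lambda>x. vector_derivative (\<lambda>x. complex_of_real (iter_deriv n f x)) (at x))"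
      unfolding Suc[symmetric] by (simp add: iter_deriv_def)
    also have "\<dots> = (\<lambda>x. complex_of_real (iter_deriv (Suc n) f x))"
      using iter_deriv_has_vector_derivative[OF s]
      by (intro ext vector_derivative_at has_vector_derivative_of_real)
        (auto simp: has_real_derivative_iff_has_vector_derivative)
    finally show ?case .
  qed (simp add: iter_deriv_def)
  show ?thesis
    unfolding schwartz_def smooth_def it
  proof (intro conjI allI)
    fix n x
    have "((\<lambda>x. complex_of_real (iter_deriv n f x)) has_vector_derivative complex_of_real (iter_deriv (Suc n) f x)) (at x)"
      using iter_deriv_has_vector_derivative[OF s, of n x]
      by (intro has_vector_derivative_of_real) (auto simp: has_real_derivative_iff_has_vector_derivative)
    then show "(\<lambda>x. complex_of_real (iter_deriv n f x)) differentiable (at x)"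
      by (rule differentiableI_vector)
  next
    fix m n
    show "\<exists>B. \<forall>x. \<bar>x\<bar> ^ m * cmod (complex_of_real (iter_deriv n f x)) \<le> B"
      using assms unfolding schwartz_def by simp
  qed
qed

text \<open>The summands vary with \<open>n\<close>; they have to converge continuously to the limit.\<close>

lemma riemann_sum_bound_and_limit:
  fixes f :: "nat \<Rightarrow> real \<Rightarrow> complex" and J :: "nat \<Rightarrow> int set"
  defines "R \<equiv> \<lambda>n. (\<Sum>j\<in>J n. f n (of_int j / n) / n)"
  assumes J: "\<And>n. finite (J n)"
    and B: "\<And>n x. cmod (f n x) \<le> B / (1 + x\<^sup>2)"
  shows "\<And>n. cmod (R n) \<le> 3 * B * pi"
    and "\<lbrakk>\<And>x. \<forall>\<^sub>F n in sequentially. \<lfloor>real n * x\<rfloor> \<in> J n;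
          \<And>x X. X \<longlonglongrightarrow> x \<Longrightarrow> (\<lambda>n. f n (X n)) \<longlonglongrightarrow> f' x\<rbrakk>
         \<Longrightarrow> R \<longlonglongrightarrow> (LBINT x. f' x)"
proof -
  \<comment> \<open>The sum is the exact integral of a step function: each cell of length 1/n
    carries the value at its left end, and the cell of \<open>x\<close> has index floor(n x). The
    guard on \<open>n\<close> matches division by zero, which makes \<open>R 0\<close>
    vanish.\<close>
  define g where "g n x = (if \<lfloor>n * x\<rfloor> \<in> J n \<and> n > 0 then f n (of_int \<lfloor>n * x\<rfloor> / n) else 0)" for n :: nat and x :: real
  have B0: "0 \<le> B" using B[of 0 0] order_trans[OF norm_ge_zero B[of 0 0]] by simp
  have floor_close: "\<bar>of_int \<lfloor>n * x\<rfloor> / n - x\<bar> \<le> 1 / n" if "n > 0" for n :: nat and x :: real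
  proof -
    have "of_int \<lfloor>n * x\<rfloor> / n - x = (of_int \<lfloor>n * x\<rfloor> - n * x) / n" using that by (simp add: field_simps)
    moreover have "\<bar>of_int \<lfloor>n * x\<rfloor> - n * x\<bar> \<le> 1" by linarith
    ultimately show ?thesis using that by (simp add: abs_divide divide_right_mono)
  qed
  have gB: "cmod (g n x) \<le> 3 * B / (1 + x\<^sup>2)" for n x
  proof (cases "n > 0")
    case True
    let ?y = "of_int \<lfloor>n * x\<rfloor> / n"
    have "\<bar>x - ?y\<bar> \<le> 1"
      using floor_close[OF True, of x] True by (auto simp: abs_minus_commute divide_simps split: if_splits)
    then have "1 + x\<^sup>2 \<le> 3 * (1 + ?y\<^sup>2)" by (rule one_plus_square_shift_le)
    then have "B / (1 + ?y\<^sup>2) \<le> 3 * B / (1 + x\<^sup>2)"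
      using B0 one_plus_square_pos[of x] one_plus_square_pos[of ?y] mult_left_mono[of "1 + x\<^sup>2" "3 * (1 + ?y\<^sup>2)" B]
      by (simp add: divide_le_eq le_divide_eq mult_ac)
    then show ?thesis
      unfolding g_def using B0 order_trans[OF B[of n ?y]] by (auto simp: add_nonneg_nonneg)
  qed (use B0 in \<open>simp add: g_def add_nonneg_nonneg\<close>)
  have gsum: "g n x = (\<Sum>j\<in>J n. indicator {of_int j / n ..< (of_int j + 1) / n} x *\<^sub>R f n (of_int j / n))" if "n > 0" for n x
  proof -
    have *: "x \<in> {of_int j / n ..< (of_int j + 1) / n} \<longleftrightarrow> j = \<lfloor>n * x\<rfloor>" for j
      using that by (auto simp: eq_commute[of j] floor_eq_iff field_simps)
    have "(\<Sum>j\<in>J n. indicator {of_int j / n ..< (of_int j + 1) / n} x *\<^sub>R f n (of_int j / n))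
        = (\<Sum>j\<in>J n. if j = \<lfloor>n * x\<rfloor> then f n (of_int j / n) else 0)"
      by (intro sum.cong refl) (simp only: indicator_def *, simp)
    then show ?thesis unfolding g_def using that J[of n] by (simp add: sum.delta)
  qed
  have gm: "g n \<in> borel_measurable borel" for n
  proof (cases "n > 0")
    case True
    then have "g n = (\<lambda>x. \<Sum>j\<in>J n. indicator {of_int j / n ..< (of_int j + 1) / n} x *\<^sub>R f n (of_int j / n))"
      using gsum by auto
    then show ?thesis by simp
  next
    case False
    then have "g n = (\<lambda>x. 0)" by (auto simp: g_def)
    then show ?thesis by simp
  qed
  have R: "R n = (LBINT x. g n x)" for n
  proof (cases "n > 0")
    case True
    have "(LBINT x. g n x) = (\<Sum>j\<in>J n. measure lborel {of_int j / n ..< (of_int j + 1) / n} *\<^sub>R f n (of_int j / n))"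
      unfolding gsum[OF True]
      by (subst Bochner_Integration.integral_sum) (auto simp: divide_right_mono)
    also have "\<dots> = R n"
      unfolding R_def using True
      by (intro sum.cong refl) (simp add: divide_right_mono scaleR_conv_of_real field_simps diff_divide_distrib[symmetric])
    finally show ?thesis by simp
  next
    case False
    then show ?thesis by (simp add: R_def g_def)
  qed
  have pi: "(LBINT x. 3 * B / (1 + x\<^sup>2)) = 3 * B * pi"
  proof -
    have "(LBINT x. inverse (1 + x\<^sup>2)) = pi"
      using LBINT_inverse_1_plus_square
      by (simp add: interval_lebesgue_integral_def set_lebesgue_integral_def)
    then show ?thesis by (simp add: divide_inverse)
  qed
  show "cmod (R n) \<le> 3 * B * pi" for n
    unfolding R pi[symmetric]
    by (intro norm_integral_le integrable_decay[OF _ gB] integrable_decay_majorant gB) (simp add: gm)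
  assume Jx: "\<And>x. \<forall>\<^sub>F n in sequentially. \<lfloor>real n * x\<rfloor> \<in> J n"
    and f': "\<And>x X. X \<longlonglongrightarrow> x \<Longrightarrow> (\<lambda>n. f n (X n)) \<longlonglongrightarrow> f' x"
  have lim: "(\<lambda>n. g n x) \<longlonglongrightarrow> f' x" for x
  proof -
    let ?X = "\<lambda>n::nat. of_int \<lfloor>n * x\<rfloor> / n"
    have "(\<lambda>n. ?X n - x) \<longlonglongrightarrow> 0"
    proof (rule Lim_null_comparison[OF _ lim_1_over_n])
      show "\<forall>\<^sub>F n in sequentially. norm (?X n - x) \<le> 1 / real n"
        using eventually_gt_at_top[of 0] by eventually_elim (use floor_close in auto)
    qed
    then have "?X \<longlonglongrightarrow> x" by (simp add: LIM_zero_iff)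
    from f'[OF this] show ?thesis
    proof (rule Lim_transform_eventually)
      show "\<forall>\<^sub>F n in sequentially. f n (?X n) = g n x"
        using Jx[of x] eventually_gt_at_top[of 0] by eventually_elim (simp add: g_def)
    qed
  qed
  have "f' \<in> borel_measurable borel"
    by (rule borel_measurable_LIMSEQ_metric[OF gm lim])
  then show "R \<longlonglongrightarrow> (LBINT x. f' x)"
    unfolding R
    by (intro integral_dominated_convergence[where w = "\<lambda>x. 3 * B / (1 + x\<^sup>2)"])
       (use gm lim gB integrable_decay_majorant in auto)
qed

section \<open>Schwartz approximants built from Gaussians\<close>

lemma power_le_fact_exp: "x \<ge> 0 \<Longrightarrow> x ^ n \<le> fact n * exp (x::real)"
proof -
  assume "x \<ge> 0"
  have "(\<Sum>j\<in>{n}. x ^ j /\<^sub>R fact j) \<le> (\<Sum>j. x ^ j /\<^sub>R fact j)"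
    by (rule sum_le_suminf[OF summable_exp_generic]) (use \<open>x \<ge> 0\<close> in auto)
  then show ?thesis by (simp add: exp_def field_simps)
qed

text \<open>Polynomials times Gaussians of one width 1/N with arbitrary centres b/N. The powers of
  \<open>x\<close> are included to make the class closed under differentiation, so that one bound
  for its members controls all iterated derivatives.\<close>

inductive gauss_comb :: "real \<Rightarrow> (real \<Rightarrow> complex) \<Rightarrow> bool" for N where
  single: "gauss_comb N (\<lambda>x. a * complex_of_real (x ^ m * exp (- (N * x - b)\<^sup>2 / 2)))"
| add: "gauss_comb N f \<Longrightarrow> gauss_comb N g \<Longrightarrow> gauss_comb N (\<lambda>x. f x + g x)"

lemma gauss_comb_std_normal_density:
  "gauss_comb N (\<lambda>k. c * complex_of_real (std_normal_density (b - N * k)))"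
proof -
  have "(\<lambda>k. c * complex_of_real (std_normal_density (b - N * k)))
      = (\<lambda>k. (c * (1 / sqrt (2 * pi))) * complex_of_real (k ^ 0 * exp (- (N * k - b)\<^sup>2 / 2)))"
  proof
    fix k :: real
    have "(b - N * k)\<^sup>2 = (N * k - b)\<^sup>2" by (rule power2_commute)
    then show "c * complex_of_real (std_normal_density (b - N * k))
        = (c * (1 / sqrt (2 * pi))) * complex_of_real (k ^ 0 * exp (- (N * k - b)\<^sup>2 / 2))"
      by (simp add: std_normal_density_def)
  qed
  then show ?thesis by (simp only: gauss_comb.single)
qed

lemma gauss_comb_sum:
  assumes "\<And>i. i \<in> I \<Longrightarrow> gauss_comb N (f i)"
  shows "gauss_comb N (\<lambda>x. \<Sum>i\<in>I. f i x)"
proof -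
  have "gauss_comb N (\<lambda>x. 0)" using gauss_comb.single[of N 0 0 0] by simp
  then show ?thesis using assms
    by (induction I rule: infinite_finite_induct) (auto intro: gauss_comb.add)
qed

lemma gauss_comb_derivative:
  assumes "gauss_comb N f"
  shows "\<exists>f'. gauss_comb N f' \<and> (\<forall>x. (f has_vector_derivative f' x) (at x))"
  using assms
proof induction
  case (single a m b)
  let ?e = "\<lambda>x. exp (- (N * x - b)\<^sup>2 / 2)"
  let ?t = "\<lambda>c j x. c * complex_of_real (x ^ j * ?e x)"
  \<comment> \<open>For \<open>m = 0\<close> the truncated exponent \<open>m - 1\<close> is
    harmless, since the coefficient \<open>a * m\<close> is then zero.\<close>
  let ?f' = "\<lambda>x. ?t (a * m) (m - 1) x + (?t (- (a * N\<^sup>2)) (m + 1) x + ?t (a * b * N) m x)"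
  have "((\<lambda>x. x ^ m * ?e x) has_real_derivative
      (real m * x ^ (m - 1) * ?e x + (- (N\<^sup>2) * (x ^ (m + 1) * ?e x) + b * N * (x ^ m * ?e x)))) (at x)" for x :: real
    by (rule derivative_eq_intros refl | simp)+ (simp add: algebra_simps power2_eq_square)
  then have "((\<lambda>x. a * complex_of_real (x ^ m * ?e x)) has_vector_derivative
      a * complex_of_real (real m * x ^ (m - 1) * ?e x + (- (N\<^sup>2) * (x ^ (m + 1) * ?e x) + b * N * (x ^ m * ?e x)))) (at x)" for x :: real
    by (intro has_vector_derivative_mult_right has_vector_derivative_of_real)
      (simp add: has_real_derivative_iff_has_vector_derivative)
  then have "((\<lambda>x. a * complex_of_real (x ^ m * ?e x)) has_vector_derivative ?f' x) (at x)" for x :: real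
    by (rule has_vector_derivative_eq_rhs) (simp add: algebra_simps)
  moreover have "gauss_comb N ?f'" by (intro gauss_comb.intros)
  ultimately show ?case by blast
next
  case (add f g)
  then show ?case by (blast intro: gauss_comb.add has_vector_derivative_add)
qed

lemma gauss_comb_bounded:
  assumes "gauss_comb N f" "N > 0"
  shows "\<exists>B. \<forall>x. \<bar>x\<bar> ^ m * cmod (f x) \<le> B"
  using assms(1)
proof induction
  case (single a j b)
  let ?e = "\<lambda>x. exp (- (N * x - b)\<^sup>2 / 2)"
  \<comment> \<open>The power of |x| is absorbed by exp |x|; with w = |N x - b| the exponent is at
    most |b|/N + w/N - w^2/2, and completing the square bounds the last two terms by 1/(2
    N^2).\<close>
  let ?K = "fact (m + j) * exp (\<bar>b\<bar> / N + 1 / (2 * N\<^sup>2))"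
  have "\<bar>x\<bar> ^ (m + j) * ?e x \<le> ?K" for x
  proof -
    let ?w = "\<bar>N * x - b\<bar>"
    have "N * \<bar>x\<bar> \<le> ?w + \<bar>b\<bar>" using \<open>N > 0\<close> abs_mult[of N x] by linarith
    then have "\<bar>x\<bar> \<le> (?w + \<bar>b\<bar>) / N" using \<open>N > 0\<close> by (simp add: pos_le_divide_eq mult.commute)
    moreover have "?w / N - ?w\<^sup>2 / 2 \<le> 1 / (2 * N\<^sup>2)"
      using zero_le_power2[of "?w - 1 / N"] by (simp add: power2_diff power_divide field_simps)
    ultimately have e: "\<bar>x\<bar> + - (N * x - b)\<^sup>2 / 2 \<le> \<bar>b\<bar> / N + 1 / (2 * N\<^sup>2)"
      by (simp add: add_divide_distrib)
    have "\<bar>x\<bar> ^ (m + j) * ?e x \<le> fact (m + j) * exp \<bar>x\<bar> * ?e x"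
      using power_le_fact_exp[of "\<bar>x\<bar>" "m + j"] by (intro mult_right_mono) auto
    also have "\<dots> = fact (m + j) * exp (\<bar>x\<bar> + - (N * x - b)\<^sup>2 / 2)"
      by (simp only: exp_add mult.assoc)
    also have "\<dots> \<le> ?K" using e by (intro mult_left_mono) auto
    finally show ?thesis .
  qed
  then have "cmod a * (\<bar>x\<bar> ^ (m + j) * ?e x) \<le> cmod a * ?K" for x
    by (rule mult_left_mono) simp
  moreover have "\<bar>x\<bar> ^ m * cmod (a * complex_of_real (x ^ j * ?e x)) = cmod a * (\<bar>x\<bar> ^ (m + j) * ?e x)" for x
    by (simp add: norm_mult norm_power power_add)
  ultimately have "\<bar>x\<bar> ^ m * cmod (a * complex_of_real (x ^ j * ?e x)) \<le> cmod a * ?K" for x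
    by simp
  then show ?case by blast
next
  case (add f g)
  then obtain B B' where "\<And>x. \<bar>x\<bar> ^ m * cmod (f x) \<le> B" "\<And>x. \<bar>x\<bar> ^ m * cmod (g x) \<le> B'" by blast
  then have "\<bar>x\<bar> ^ m * cmod (f x + g x) \<le> B + B'" for x
    using mult_left_mono[OF norm_triangle_ineq[of "f x" "g x"], of "\<bar>x\<bar> ^ m"]
    by (smt (verit) distrib_left zero_le_power abs_ge_zero)
  then show ?case by blast
qed

lemma gauss_comb_schwartz:
  assumes "gauss_comb N f" "N > 0"
  shows "schwartz f"
proof -
  have d: "gauss_comb N (iter_deriv n f)" for n
  proof (induction n)
    case (Suc n)
    then obtain f' where f': "gauss_comb N f'" "\<And>x. (iter_deriv n f has_vector_derivative f' x) (at x)"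
      using gauss_comb_derivative by blast
    then have "iter_deriv (Suc n) f = f'"
      by (auto simp: iter_deriv_def vector_derivative_at)
    then show ?case using f'(1) by simp
  qed (use assms in \<open>simp add: iter_deriv_def\<close>)
  have "iter_deriv n f differentiable (at x)" for n x
    using gauss_comb_derivative[OF d[of n]] differentiableI_vector by blast
  then show ?thesis
    unfolding schwartz_def smooth_def using gauss_comb_bounded[OF d assms(2)] by blast
qed

text \<open>The shift \<open>d\<close> will be a rounding error to the grid. The constant 6 is the
  factor 3 of the shifted majorant times the 2 needed to compare with 1 + w^2/2, which is at most
  exp (w^2/2).\<close>

lemma std_normal_density_shift_le:
  assumes "0 \<le> d" "d \<le> 1"
  shows "std_normal_density (z - d) \<le> 6 / (1 + z\<^sup>2)"
proof -
  let ?w = "z - d"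
  have "1 + z\<^sup>2 \<le> 3 * (1 + ?w\<^sup>2)" using assms by (intro one_plus_square_shift_le) auto
  also have "\<dots> \<le> 6 * (1 + ?w\<^sup>2 / 2)" by simp
  also have "\<dots> \<le> 6 * exp (?w\<^sup>2 / 2)" using exp_ge_add_one_self[of "?w\<^sup>2 / 2"] by (intro mult_left_mono) auto
  finally have "exp (- ?w\<^sup>2 / 2) \<le> 6 / (1 + z\<^sup>2)"
    using one_plus_square_pos[of z] by (simp add: exp_minus field_simps)
  moreover have "std_normal_density ?w \<le> exp (- ?w\<^sup>2 / 2)"
  proof -
    have "1 \<le> sqrt (2 * pi)" using pi_gt3 by simp
    then have "1 / sqrt (2 * pi) \<le> 1" by simp
    then show ?thesis unfolding std_normal_density_def by (intro mult_left_le_one_le) auto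
  qed
  ultimately show ?thesis by linarith
qed

text \<open>The approximants are Riemann sums, with mesh \<open>1/n\<^sup>2\<close>, of the convolution of \<open>\<psi>\<close> with a
  Gaussian of width \<open>1/n\<close>; as finite combinations of Gaussians they are Schwartz functions.\<close>

lemma schwartz_approximation:
  fixes \<psi> :: "real \<Rightarrow> complex"
  assumes c: "continuous_on UNIV \<psi>" and b: "\<And>k. cmod (\<psi> k) \<le> B"
  obtains \<phi> B' where "\<And>n::nat. schwartz (\<phi> n)" "\<And>n k. cmod (\<phi> n k) \<le> B'" "\<And>k. (\<lambda>n. \<phi> n k) \<longlonglongrightarrow> \<psi> k"
proof -
  \<comment> \<open>The nodes j/n^2 fill the interval from -n^2 to n^2. The weight 1/n is the mesh
    1/n^2 times the height \<open>n\<close> of the kernel.\<close>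
  define \<phi>0 where "\<phi>0 n k = (\<Sum>j\<in>{- (int n ^ 4) .. int n ^ 4}.
    \<psi> (j / (real n)\<^sup>2) / n * std_normal_density (j / n - n * k))" for n k
  \<comment> \<open>For fixed \<open>k\<close> the indices are recentred at the node just below
    \<open>k\<close>. In the variable z = n (y - k) the sum becomes a Riemann sum of mesh 1/n;
    \<open>\<delta>\<close> is the rounding remainder in that variable, at most 1/n.\<close>
  define m where "m n k = \<lfloor>(real n)\<^sup>2 * k\<rfloor>" for n k
  define \<delta> where "\<delta> n k = ((real n)\<^sup>2 * k - m n k) / n" for n k
  define J where "J k n = {- (int n ^ 4) - m n k .. int n ^ 4 - m n k}" for k n
  define f where "f k n z = \<psi> (k + z / n - \<delta> n k / n) * std_normal_density (z - \<delta> n k)" for k n z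
  have \<delta>: "0 \<le> \<delta> n k" "\<delta> n k \<le> 1 / n" "\<delta> n k \<le> 1" for n k
  proof -
    have 1: "0 \<le> (real n)\<^sup>2 * k - m n k" "(real n)\<^sup>2 * k - m n k \<le> 1"
      unfolding m_def by linarith+
    show "0 \<le> \<delta> n k" "\<delta> n k \<le> 1 / n" unfolding \<delta>_def using 1 by (auto intro: divide_right_mono)
    moreover have "1 / real n \<le> 1" by (cases "n = 0") auto
    ultimately show "\<delta> n k \<le> 1" by linarith
  qed
  have B0: "0 \<le> B" using order_trans[OF norm_ge_zero b] .
  have eq: "\<phi>0 n k = (\<Sum>j\<in>J k n. f k n (of_int j / n) / n)" for n k
  proof (cases "n = 0")
    case False
    have "\<phi>0 n k = (\<Sum>j\<in>J k n. \<psi> ((j + m n k) / (real n)\<^sup>2) / n * std_normal_density ((j + m n k) / n - n * k))"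
      unfolding \<phi>0_def
      by (rule sum.reindex_bij_witness[where i = "\<lambda>j. j + m n k" and j = "\<lambda>j. j - m n k"]) (auto simp: J_def)
    also have "\<dots> = (\<Sum>j\<in>J k n. f k n (of_int j / n) / n)"
    proof (rule sum.cong[OF refl])
      fix j
      have "k + of_int j / n / n - \<delta> n k / n = (j + m n k) / (real n)\<^sup>2"
           "of_int j / n - \<delta> n k = (j + m n k) / n - n * k"
        using False by (simp_all add: \<delta>_def field_simps power2_eq_square)
      then show "\<psi> ((j + m n k) / (real n)\<^sup>2) / n * std_normal_density ((j + m n k) / n - n * k) = f k n (of_int j / n) / n"
        unfolding f_def by simp
    qed
    finally show ?thesis .
  qed (simp add: \<phi>0_def J_def m_def)
  have fB: "cmod (f k n z) \<le> (6 * B) / (1 + z\<^sup>2)" for k n z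
  proof -
    have "cmod (f k n z) \<le> B * (6 / (1 + z\<^sup>2))"
      unfolding f_def norm_mult using std_normal_density_shift_le[OF \<delta>(1,3)] B0 b
      by (intro mult_mono) auto
    then show ?thesis by (simp add: mult.commute)
  qed
  have J: "finite (J k n)" for k n unfolding J_def by simp
  note R = riemann_sum_bound_and_limit[where f = "f k" and J = "J k" and B = "6 * B" for k, OF J fB, folded eq]
  show ?thesis
  proof (rule that)
    fix n :: nat
    \<comment> \<open>The index starts at 1, so that the inverse width is positive.\<close>
    define \<phi>' where "\<phi>' = (\<lambda>k. \<phi>0 (Suc n) k)"
    have "gauss_comb (real (Suc n)) \<phi>'"
      unfolding \<phi>'_def \<phi>0_def
    proof (rule gauss_comb_sum)
      fix j
      show "gauss_comb (real (Suc n)) (\<lambda>k. \<psi> (j / (real (Suc n))\<^sup>2) / (Suc n) * std_normal_density (j / (Suc n) - (Suc n) * k))"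
        by (rule gauss_comb_std_normal_density)
    qed
    then show "schwartz (\<lambda>k. \<phi>0 (Suc n) k)" unfolding \<phi>'_def by (rule gauss_comb_schwartz) simp
  next
    show "cmod (\<phi>0 (Suc n) k) \<le> 3 * (6 * B) * pi" for n k by (rule R(1))
  next
    fix k
    have "(\<lambda>n. \<phi>0 n k) \<longlonglongrightarrow> (LBINT z. \<psi> k * std_normal_density z)"
    proof (rule R(2))
      fix x
      have "\<forall>\<^sub>F n in sequentially. \<bar>x\<bar> + \<bar>k\<bar> + 2 \<le> real n"
        by (rule eventually_ge_at_top[THEN filterlim_real_sequentially[THEN filterlim_iff[THEN iffD1], rule_format]])
      then show "\<forall>\<^sub>F n in sequentially. \<lfloor>real n * x\<rfloor> \<in> J k n"
      proof eventually_elim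
        case (elim n)
        have n1: "1 \<le> real n" using elim by linarith
        have "\<bar>real_of_int (\<lfloor>real n * x\<rfloor> + m n k)\<bar> \<le> \<bar>real n * x\<bar> + \<bar>(real n)\<^sup>2 * k\<bar> + 2"
          unfolding m_def by linarith
        also have "\<dots> \<le> (real n)\<^sup>2 * \<bar>x\<bar> + (real n)\<^sup>2 * \<bar>k\<bar> + (real n)\<^sup>2 * 2"
          using n1 mult_right_mono[of "real n" "(real n)\<^sup>2" "\<bar>x\<bar>"] self_le_power[of "real n" 2] one_le_power[of "real n" 2]
          by (intro add_mono) (auto simp: abs_mult)
        also have "\<dots> = (real n)\<^sup>2 * (\<bar>x\<bar> + \<bar>k\<bar> + 2)" by (simp add: algebra_simps)
        also have "\<dots> \<le> (real n)\<^sup>2 * real n" using elim by (intro mult_left_mono) auto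
        also have "\<dots> = real n ^ 3" by (simp add: eval_nat_numeral)
        also have "\<dots> \<le> real n ^ 4" using n1 by (intro power_increasing) auto
        finally have "\<bar>\<lfloor>real n * x\<rfloor> + m n k\<bar> \<le> (int n) ^ 4"
          by (metis of_int_abs of_int_le_iff of_int_of_nat_eq of_int_power)
        then show ?case unfolding J_def by auto
      qed
    next
      fix z :: real and Z :: "nat \<Rightarrow> real" assume Z: "Z \<longlonglongrightarrow> z"
      have d0: "(\<lambda>n. \<delta> n k) \<longlonglongrightarrow> 0"
        by (rule tendsto_sandwich[OF always_eventually always_eventually tendsto_const lim_1_over_n]) (use \<delta> in auto)
      have i0: "(\<lambda>n. 1 / real n) \<longlonglongrightarrow> 0" by (rule lim_1_over_n)
      have "(\<lambda>n. k + Z n * (1 / n) - \<delta> n k * (1 / n)) \<longlonglongrightarrow> k + z * 0 - 0 * 0"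
        by (intro tendsto_intros Z d0 i0)
      then have "(\<lambda>n. \<psi> (k + Z n / n - \<delta> n k / n)) \<longlonglongrightarrow> \<psi> k"
        using c by (intro isCont_tendsto_compose[of k \<psi>]) (auto simp: continuous_on_eq_continuous_at)
      moreover have "(\<lambda>n. std_normal_density (Z n - \<delta> n k)) \<longlonglongrightarrow> std_normal_density (z - 0)"
        unfolding std_normal_density_def by (intro tendsto_intros Z d0) auto
      ultimately show "(\<lambda>n. f k n (Z n)) \<longlonglongrightarrow> \<psi> k * std_normal_density z"
        unfolding f_def by (auto intro!: tendsto_intros)
    qed
    moreover have "(LBINT z. \<psi> k * std_normal_density z) = \<psi> k"
      by (simp add: integral_normal_density)
    ultimately show "(\<lambda>n. \<phi>0 (Suc n) k) \<longlonglongrightarrow> \<psi> k" using LIMSEQ_Suc by auto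
  qed
qed

section \<open>Spectral integrals\<close>

text \<open>The difference of two weak integrals may itself be taken as the test variable, and is
  then orthogonal to itself.\<close>

lemma has_L2_integral_unique:
  assumes I: "has_L2_integral M S g I" and I': "has_L2_integral M S g I'"
  shows "AE \<omega> in M. I \<omega> = I' \<omega>"
proof -
  let ?d = "\<lambda>\<omega>. I \<omega> - I' \<omega>"
  have s: "sq_integrable M I" "sq_integrable M I'"
    using I I' unfolding has_L2_integral_def by auto
  then have d: "sq_integrable M ?d" by (rule sq_integrable_diff)
  have "L2_inner M I ?d = L2_inner M I' ?d"
    using I[unfolded has_L2_integral_def, THEN conjunct2, THEN conjunct2, rule_format, OF d]
      I'[unfolded has_L2_integral_def, THEN conjunct2, THEN conjunct2, rule_format, OF d] by simp
  then have "L2_inner M ?d ?d = 0"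
    using sq_integrable_mult_cnj[OF s(1) d] sq_integrable_mult_cnj[OF s(2) d]
    by (simp only: left_diff_distrib Bochner_Integration.integral_diff) simp
  then have "L2_norm_sq M ?d = 0"
    using L2_norm_sq_eq[of M ?d] of_real_eq_0_iff by metis
  then have "AE \<omega> in M. ?d \<omega> = 0" using L2_norm_zero_AE[OF d] by blast
  then show ?thesis by auto
qed

lemma integrable_bounded_mult:
  fixes p S :: "'a \<Rightarrow> complex"
  assumes "p \<in> borel_measurable M" "\<And>k. cmod (p k) \<le> B" "integrable M S"
  shows "integrable M (\<lambda>k. p k * S k)"
proof (rule Bochner_Integration.integrable_bound)
  show "integrable M (\<lambda>k. B * cmod (S k))" using assms(3) by simp
  show "AE k in M. norm (p k * S k) \<le> norm (B * cmod (S k))"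
    using assms(2) by (intro AE_I2) (simp add: norm_mult abs_mult mult_right_mono order_trans[OF _ abs_ge_self])
qed (use assms in simp)

text \<open>A homogeneous field whose spectral measure has the integrable density \<open>S\<close>.
  As \<open>S\<close> is complex-valued here, mean squares are bounded by integrals against
  \<open>cmod (S k)\<close>.\<close>

locale spectral_field = prob_space M for M :: "'w measure" +
  fixes u :: "real \<Rightarrow> 'w \<Rightarrow> complex" and S :: "real \<Rightarrow> complex"
  assumes u: "\<And>x. sq_integrable M (u x)"
    and S: "integrable lborel S"
    and cov: "\<And>x y. L2_inner M (u x) (u y) = (LBINT k. cis (2 * pi * k * (x - y)) * S k)"
begin

text \<open>\<open>spec V \<psi>\<close>: under the spectral isometry \<open>u x \<mapsto> (k \<mapsto> cis (2 * pi * k * x))\<close> the random variable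
  \<open>V\<close> corresponds to \<open>\<psi>\<close>, i.e. \<open>V\<close> is the integral of \<open>\<psi>\<close> against the Fourier transform of \<open>u\<close>.\<close>

inductive spec :: "('w \<Rightarrow> complex) \<Rightarrow> (real \<Rightarrow> complex) \<Rightarrow> bool" where
  base: "spec (u x) (\<lambda>k. cis (2 * pi * k * x))"
| lin: "spec V p \<Longrightarrow> spec W q \<Longrightarrow> spec (\<lambda>\<omega>. V \<omega> + b * W \<omega>) (\<lambda>k. p k + b * q k)"
| lim: "(\<And>n::nat. spec (V n) (p n)) \<Longrightarrow> (\<And>n k. cmod (p n k) \<le> B) \<Longrightarrow> (\<And>k. (\<lambda>n. p n k) \<longlonglongrightarrow> \<psi> k)
    \<Longrightarrow> sq_integrable M W \<Longrightarrow> (\<lambda>n. L2_dist_sq M (V n) W) \<longlonglongrightarrow> 0 \<Longrightarrow> spec W \<psi>"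

lemma spec_regular:
  assumes "spec V p"
  shows "sq_integrable M V" "p \<in> borel_measurable borel" "\<exists>B. \<forall>k. cmod (p k) \<le> B"
proof -
  have "sq_integrable M V \<and> p \<in> borel_measurable borel \<and> (\<exists>B. \<forall>k. cmod (p k) \<le> B)"
    using assms
  proof induction
    case (base x)
    have "(\<lambda>k. cis (2 * pi * k * x)) \<in> borel_measurable borel"
      by (intro borel_measurable_continuous_onI continuous_intros)
    then show ?case using u by (auto intro!: exI[of _ 1])
  next
    case (lin V p W q b)
    then obtain B B' where "\<And>k. cmod (p k) \<le> B" "\<And>k. cmod (q k) \<le> B'" by blast
    then have "cmod (p k + b * q k) \<le> B + cmod b * B'" for k
      by (intro order_trans[OF norm_triangle_ineq] add_mono) (auto simp: norm_mult mult_left_mono)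
    then show ?case using lin by (auto intro!: sq_integrable_add sq_integrable_cmult)
  next
    case (lim V p B \<psi> W)
    have "cmod (\<psi> k) \<le> B" for k
      by (rule LIMSEQ_le_const2[OF tendsto_norm[OF lim(3)[of k]]]) (use lim(2) in blast)
    moreover have "\<psi> \<in> borel_measurable borel"
      by (rule borel_measurable_LIMSEQ_metric[OF _ lim(3)]) (use lim.IH in simp)
    ultimately show ?case using lim(4) by blast
  qed
  then show "sq_integrable M V" "p \<in> borel_measurable borel" "\<exists>B. \<forall>k. cmod (p k) \<le> B" by auto
qed

text \<open>A linear functional that agrees on the field values with integration of the symbol
  against \<open>T\<close> agrees on everything reached by the rules of \<open>spec\<close>: the
  limit rule is mean square continuity on one side and dominated convergence, with the bound on the
  symbols, on the other.\<close>

lemma spec_functional: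
  assumes Y: "sq_integrable M Y" and T: "integrable lborel T"
    and uY: "\<And>x. L2_inner M (u x) Y = (LBINT k. cis (2 * pi * k * x) * T k)"
    and V: "spec V p"
  shows "L2_inner M V Y = (LBINT k. p k * T k)"
  using V
proof induction
  case (base x)
  show ?case by (rule uY)
next
  case (lin V p W q b)
  have i: "integrable lborel (\<lambda>k. p k * T k)" if pr: "spec V p" for p V
    using spec_regular(2,3)[OF pr] integrable_bounded_mult[OF _ _ T] by auto
  have "(LINT \<omega>|M. (V \<omega> + b * W \<omega>) * cnj (Y \<omega>))
      = L2_inner M V Y + b * L2_inner M W Y"
    using sq_integrable_mult_cnj[OF spec_regular(1)[OF lin(1)] Y]
      sq_integrable_mult_cnj[OF spec_regular(1)[OF lin(2)] Y]
    by (simp add: distrib_right mult.assoc)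
  also have "\<dots> = (LBINT k. (p k + b * q k) * T k)"
    using i[OF lin(1)] i[OF lin(2)] lin.IH by (simp add: distrib_right mult.assoc)
  finally show ?case .
next
  case (lim V p B \<psi> W)
  have "(\<lambda>n. L2_inner M (V n) Y) \<longlonglongrightarrow> L2_inner M W Y"
    by (rule L2_tendsto_pairing[OF spec_regular(1)[OF lim(1)] lim(4) Y lim(5)])
  moreover have "(\<lambda>n. LBINT k. p n k * T k) \<longlonglongrightarrow> (LBINT k. \<psi> k * T k)"
  proof (rule integral_dominated_convergence[where w = "\<lambda>k. B * cmod (T k)"])
    have p: "p n \<in> borel_measurable borel" for n by (rule spec_regular(2)[OF lim(1)])
    then show "(\<lambda>k. p n k * T k) \<in> borel_measurable lborel" for n using T by simp
    have "\<psi> \<in> borel_measurable borel" by (rule borel_measurable_LIMSEQ_metric[OF p lim(3)])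
    then show "(\<lambda>k. \<psi> k * T k) \<in> borel_measurable lborel" using T by simp
    show "AE k in lborel. (\<lambda>n. p n k * T k) \<longlonglongrightarrow> \<psi> k * T k"
      using lim(3) by (intro AE_I2 tendsto_intros)
    show "AE k in lborel. norm (p n k * T k) \<le> B * cmod (T k)" for n
      using lim(2) by (intro AE_I2) (simp add: norm_mult mult_right_mono)
  qed (use T in simp)
  ultimately show ?case using lim.IH LIMSEQ_unique by simp
qed

lemma spec_mult_integrable:
  assumes "spec V p" "integrable lborel T"
  shows "integrable lborel (\<lambda>k. p k * T k)"
  using spec_regular(2,3)[OF assms(1)] integrable_bounded_mult[OF _ _ assms(2)] by auto

text \<open>The sesquilinear identity is extended in one argument at a time: against a field value
  \<open>u y\<close> the density is \<open>S\<close> times a phase, and conjugating the outcome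
  provides the density needed for an arbitrary second variable.\<close>

lemma spec_cov:
  assumes V: "spec V p" and W: "spec W q"
  shows "L2_inner M V W = (LBINT k. p k * cnj (q k) * S k)"
proof -
  have 1: "L2_inner M V (u y) = (LBINT k. p k * (cis (- (2 * pi * k * y)) * S k))" for y
  proof (rule spec_functional[OF u _ _ V])
    show "integrable lborel (\<lambda>k. cis (- (2 * pi * k * y)) * S k)"
      by (rule integrable_bounded_mult[where B = 1])
         (auto intro!: S borel_measurable_continuous_onI continuous_intros)
    show "L2_inner M (u x) (u y) = (LBINT k. cis (2 * pi * k * x) * (cis (- (2 * pi * k * y)) * S k))" for x
      unfolding cov mult.assoc[symmetric] cis_mult by (simp add: algebra_simps)
  qed
  have "L2_inner M W V = (LBINT k. q k * cnj (p k * S k))"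
  proof (rule spec_functional[OF spec_regular(1)[OF V] _ _ W])
    show "integrable lborel (\<lambda>k. cnj (p k * S k))"
      using spec_mult_integrable[OF V S] by (rule integrable_cnj)
    have "L2_inner M (u x) V = cnj (LBINT k. p k * (cis (- (2 * pi * k * x)) * S k))" for x
      unfolding L2_inner_cnj[of M "u x" V] 1 ..
    then show "L2_inner M (u x) V = (LBINT k. cis (2 * pi * k * x) * cnj (p k * S k))" for x
      unfolding Bochner_Integration.integral_cnj[symmetric] by (simp add: cis_cnj mult_ac)
  qed
  then have "L2_inner M V W = cnj (LBINT k. q k * cnj (p k * S k))"
    using L2_inner_cnj[of M V W] by simp
  then show ?thesis
    unfolding Bochner_Integration.integral_cnj[symmetric] by (simp add: mult_ac)
qed


text \<open>The same extension in two stages, with the conjugated test variable and the density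
  0.\<close>

lemma spec_pseudo_cov:
  assumes uu: "\<And>x y. (LINT \<omega>|M. u x \<omega> * u y \<omega>) = 0" and V: "spec V p" and W: "spec W q"
  shows "(LINT \<omega>|M. V \<omega> * W \<omega>) = 0"
proof -
  have *: "(LINT \<omega>|M. X \<omega> * Y \<omega>) = 0"
    if Y: "sq_integrable M Y" and 0: "\<And>x. (LINT \<omega>|M. u x \<omega> * Y \<omega>) = 0" and X: "spec X r" for X Y r
    using spec_functional[of "\<lambda>\<omega>. cnj (Y \<omega>)" "\<lambda>_. 0", OF sq_integrable_cnj[OF Y] _ _ X] 0 by simp
  have "(LINT \<omega>|M. u y \<omega> * V \<omega>) = 0" for y
    using *[OF u uu V, of y] by (simp add: mult.commute)
  from *[OF spec_regular(1)[OF V] this W] show ?thesis by (simp add: mult.commute)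
qed

lemma spec_diff:
  assumes "spec V p" "spec W q"
  shows "spec (\<lambda>\<omega>. V \<omega> - W \<omega>) (\<lambda>k. p k - q k)"
  using lin[OF assms, of "-1"] by simp

lemma spec_sum:
  assumes "\<And>i. i \<in> I \<Longrightarrow> spec (V i) (p i)"
  shows "spec (\<lambda>\<omega>. \<Sum>i\<in>I. b i * V i \<omega>) (\<lambda>k. \<Sum>i\<in>I. b i * p i k)"
proof -
  have "spec (\<lambda>\<omega>. 0) (\<lambda>k. 0)" using spec_diff[OF base[of 0] base[of 0]] by simp
  then show ?thesis using assms
  proof (induction I rule: infinite_finite_induct)
    case (insert i I)
    then have "spec (\<lambda>\<omega>. (\<Sum>i\<in>I. b i * V i \<omega>) + b i * V i \<omega>) (\<lambda>k. (\<Sum>i\<in>I. b i * p i k) + b i * p i k)"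
      by (intro lin) auto
    then show ?case using insert by (simp add: add.commute)
  qed auto
qed

lemma spec_L2_span:
  assumes "spec V p" and uX: "\<And>x. u x \<in> L2_span M I X" and X: "\<And>i. i \<in> I \<Longrightarrow> sq_integrable M (X i)"
  shows "V \<in> L2_span M I X"
  using assms(1)
proof induction
  case (lim V p B \<psi> W)
  show ?case by (rule L2_span_limit[OF lim.IH lim(4) X lim(5)])
qed (auto intro: uX L2_span_lincomb X)

lemma spec_norm_sq:
  assumes V: "spec V p"
  shows "complex_of_real (L2_norm_sq M V) = (LBINT k. complex_of_real ((cmod (p k))\<^sup>2) * S k)"
  unfolding L2_norm_sq_eq spec_cov[OF V V] complex_norm_sq_cnj ..

lemma spec_norm_sq_le:
  assumes V: "spec V p"
  shows "L2_norm_sq M V \<le> (LBINT k. (cmod (p k))\<^sup>2 * cmod (S k))"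
proof -
  have "L2_norm_sq M V = cmod (complex_of_real (L2_norm_sq M V))" by simp
  also have "\<dots> \<le> (LBINT k. cmod (complex_of_real ((cmod (p k))\<^sup>2) * S k))"
    unfolding spec_norm_sq[OF V] by (rule integral_norm_bound)
  also have "\<dots> = (LBINT k. (cmod (p k))\<^sup>2 * cmod (S k))"
    by (simp only: norm_mult norm_of_real abs_power2)
  finally show ?thesis .
qed

lemma spec_symbol_L2_tendsto:
  assumes p: "\<And>n::nat. p n \<in> borel_measurable borel" "\<And>n k. cmod (p n k) \<le> B" "\<And>k. (\<lambda>n. p n k) \<longlonglongrightarrow> \<psi> k"
  shows "(\<lambda>n. LBINT k. (cmod (p n k - \<psi> k))\<^sup>2 * cmod (S k)) \<longlonglongrightarrow> 0"
    and "\<And>n. integrable lborel (\<lambda>k. (cmod (p n k - \<psi> k))\<^sup>2 * cmod (S k))"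
proof -
  have \<psi>B: "cmod (\<psi> k) \<le> B" for k
    by (rule LIMSEQ_le_const2[OF tendsto_norm[OF p(3)[of k]]]) (use p(2) in blast)
  have \<psi>m: "\<psi> \<in> borel_measurable borel" by (rule borel_measurable_LIMSEQ_metric[OF p(1) p(3)])
  have le: "(cmod (p n k - \<psi> k))\<^sup>2 * cmod (S k) \<le> (2 * B)\<^sup>2 * cmod (S k)" for n k
    using norm_triangle_ineq4[of "p n k" "\<psi> k"] p(2)[of n k] \<psi>B[of k]
    by (intro mult_right_mono power_mono) auto
  have m: "(\<lambda>k. (cmod (p n k - \<psi> k))\<^sup>2 * cmod (S k)) \<in> borel_measurable lborel" for n
    using p(1)[of n] \<psi>m S by simp
  have w: "integrable lborel (\<lambda>k. (2 * B)\<^sup>2 * cmod (S k))" using S by simp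
  show "integrable lborel (\<lambda>k. (cmod (p n k - \<psi> k))\<^sup>2 * cmod (S k))" for n
    by (rule Bochner_Integration.integrable_bound[OF w m])
       (use le in \<open>auto intro!: AE_I2 simp: abs_mult\<close>)
  have "(\<lambda>n. LBINT k. (cmod (p n k - \<psi> k))\<^sup>2 * cmod (S k)) \<longlonglongrightarrow> (LBINT k::real. 0)"
  proof (rule integral_dominated_convergence[OF _ m w])
    show "AE k in lborel. (\<lambda>n. (cmod (p n k - \<psi> k))\<^sup>2 * cmod (S k)) \<longlonglongrightarrow> 0"
    proof (rule AE_I2)
      fix k
      have "(\<lambda>n. (cmod (p n k - \<psi> k))\<^sup>2 * cmod (S k)) \<longlonglongrightarrow> (cmod (\<psi> k - \<psi> k))\<^sup>2 * cmod (S k)"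
        by (intro tendsto_intros p(3))
      then show "(\<lambda>n. (cmod (p n k - \<psi> k))\<^sup>2 * cmod (S k)) \<longlonglongrightarrow> 0" by simp
    qed
    show "AE k in lborel. norm ((cmod (p n k - \<psi> k))\<^sup>2 * cmod (S k)) \<le> (2 * B)\<^sup>2 * cmod (S k)" for n
      using le by (intro AE_I2) (simp add: abs_mult)
  qed simp
  then show "(\<lambda>n. LBINT k. (cmod (p n k - \<psi> k))\<^sup>2 * cmod (S k)) \<longlonglongrightarrow> 0" by simp
qed

text \<open>This is why a spectral integral does not depend on its approximants: bounded pointwise
  convergence of the symbols forces convergence of the variables to any variable with the limiting
  symbol.\<close>

lemma spec_tendsto:
  assumes V: "\<And>n::nat. spec (V n) (p n)" and W: "spec W \<psi>"
    and p: "\<And>n k. cmod (p n k) \<le> B" "\<And>k. (\<lambda>n. p n k) \<longlonglongrightarrow> \<psi> k"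
  shows "(\<lambda>n. L2_dist_sq M (V n) W) \<longlonglongrightarrow> 0"
proof (rule tendsto_sandwich[OF always_eventually always_eventually tendsto_const])
  show "(\<lambda>n. LBINT k. (cmod (p n k - \<psi> k))\<^sup>2 * cmod (S k)) \<longlonglongrightarrow> 0"
    by (rule spec_symbol_L2_tendsto(1)[OF spec_regular(2)[OF V] p])
  show "\<forall>n. (L2_dist_sq M (V n) W) \<le> (LBINT k. (cmod (p n k - \<psi> k))\<^sup>2 * cmod (S k))"
    using spec_norm_sq_le[OF spec_diff[OF V W]] by blast
qed simp

text \<open>The distance of two terms is compared with the limiting symbol, which is not yet the
  symbol of a variable. This splits the bound into a part for \<open>n\<close> and a part for
  \<open>m\<close>, the form of the Cauchy condition in \<open>L2_complete\<close>.\<close>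

lemma spec_complete:
  assumes V: "\<And>n::nat. spec (V n) (p n)"
    and p: "\<And>n k. cmod (p n k) \<le> B" "\<And>k. (\<lambda>n. p n k) \<longlonglongrightarrow> \<psi> k"
  obtains W where "spec W \<psi>" "(\<lambda>n. L2_dist_sq M (V n) W) \<longlonglongrightarrow> 0"
proof -
  let ?b = "\<lambda>n. LBINT k. (cmod (p n k - \<psi> k))\<^sup>2 * cmod (S k)"
  note b = spec_symbol_L2_tendsto[OF spec_regular(2)[OF V] p]
  have le: "L2_dist_sq M (V n) (V m) \<le> 2 * ?b n + 2 * ?b m" for n m
  proof -
    have d: "spec (\<lambda>\<omega>. V n \<omega> - V m \<omega>) (\<lambda>k. p n k - p m k)" by (rule spec_diff[OF V V])
    have i: "integrable lborel (\<lambda>k. 2 * ((cmod (p n k - \<psi> k))\<^sup>2 * cmod (S k)) + 2 * ((cmod (p m k - \<psi> k))\<^sup>2 * cmod (S k)))"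
      using b(2) by simp
    have pw: "(cmod (p n k - p m k))\<^sup>2 * cmod (S k)
        \<le> 2 * ((cmod (p n k - \<psi> k))\<^sup>2 * cmod (S k)) + 2 * ((cmod (p m k - \<psi> k))\<^sup>2 * cmod (S k))" for k
      using mult_right_mono[OF cmod_add_sq_le[of "p n k - \<psi> k" "\<psi> k - p m k"], of "cmod (S k)"]
      by (simp add: norm_minus_commute[of "\<psi> k"] distrib_right mult.assoc)
    have "L2_dist_sq M (V n) (V m) \<le> (LBINT k. (cmod (p n k - p m k))\<^sup>2 * cmod (S k))"
      by (rule spec_norm_sq_le[OF d])
    also have "\<dots> \<le> (LBINT k. 2 * ((cmod (p n k - \<psi> k))\<^sup>2 * cmod (S k)) + 2 * ((cmod (p m k - \<psi> k))\<^sup>2 * cmod (S k)))"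
      by (rule integral_mono'[OF i pw]) simp
    also have "\<dots> = 2 * ?b n + 2 * ?b m" using b(2) by simp
    finally show ?thesis .
  qed
  have "(\<lambda>n. 2 * ?b n) \<longlonglongrightarrow> 0" using tendsto_mult_right_zero[OF b(1)] .
  then obtain W where W: "sq_integrable M W" "(\<lambda>n. L2_dist_sq M (V n) W) \<longlonglongrightarrow> 0"
    using L2_complete[of V "\<lambda>n. 2 * ?b n", OF spec_regular(1)[OF V] _ le] by blast
  show ?thesis by (rule that[OF lim[OF V p W] W(2)])
qed

lemma spec_cong_AE:
  assumes V: "spec V p" and W: "sq_integrable M W" "AE \<omega> in M. V \<omega> = W \<omega>"
  shows "spec W p"
proof -
  obtain B where B: "\<And>k. cmod (p k) \<le> B" using spec_regular(3)[OF V] by blast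
  have "L2_dist_sq M V W = (LINT \<omega>|M. 0)"
    using W spec_regular(1)[OF V] unfolding sq_integrable_def by (intro integral_cong_AE) auto
  \<comment> \<open>The limit rule with constant sequences absorbs the null set.\<close>
  then show ?thesis
    using lim[of "\<lambda>_. V" "\<lambda>_. p" B p W] V B W by simp
qed

section \<open>Pairings of the field with Schwartz functions\<close>

lemma u_L2_continuous:
  assumes "X \<longlonglongrightarrow> x"
  shows "(\<lambda>n. L2_dist_sq M (u (X n)) (u x)) \<longlonglongrightarrow> 0"
  by (rule spec_tendsto[OF base base, where B = 1]) (auto intro!: tendsto_intros assms)

text \<open>Makes the integrand of a weak integral measurable and accessible to Riemann
  sums.\<close>

lemma pairing_continuous:
  assumes "sq_integrable M Y"
  shows "continuous_on UNIV (\<lambda>x. L2_inner M (u x) Y)"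
  by (intro continuous_at_imp_continuous_on ballI continuous_at_sequentiallyI
      L2_tendsto_pairing u assms u_L2_continuous)

lemma pairing_bounded:
  assumes "sq_integrable M Y"
  shows "\<exists>K. \<forall>x. cmod (L2_inner M (u x) Y) \<le> K"
proof -
  let ?K = "(LBINT k. cmod (S k)) * L2_norm_sq M Y"
  have "cmod (L2_inner M (u x) Y) \<le> sqrt ?K" for x
  proof (rule real_le_rsqrt)
    have "L2_norm_sq M (u x) \<le> (LBINT k. cmod (S k))"
      using spec_norm_sq_le[OF base, of x] by simp
    then show "(cmod (L2_inner M (u x) Y))\<^sup>2 \<le> ?K"
      by (intro order_trans[OF L2_cauchy_schwarz[OF u assms]] mult_right_mono) auto
  qed
  then show ?thesis by blast
qed

text \<open>The variable is a mean square limit of Riemann sums for the integral of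
  \<open>fourier \<phi> x * u x\<close>. Their symbols are Riemann sums of the inversion formula, so
  they converge boundedly to \<open>\<phi>\<close>; paired with any \<open>Y\<close>, the same sums
  converge to the scalar integral that defines the weak one.\<close>

lemma fourier_pairing_exists:
  assumes \<phi>: "schwartz \<phi>"
  obtains U where "fourier_pairing M u \<phi> U" "spec U \<phi>"
proof -
  obtain B where B: "\<And>x. cmod (fourier \<phi> x) \<le> B / (1 + x\<^sup>2)"
    using schwartz_fourier_decay[OF \<phi>] by blast
  have cF: "continuous_on UNIV (fourier \<phi>)" by (intro continuous_fourier schwartz_integrable \<phi>)
  \<comment> \<open>With mesh 1/n the nodes fill the interval from -n to n.\<close>
  define J where "J n = {- (int n ^ 2) .. int n ^ 2}" for n
  have J: "finite (J n)" for n unfolding J_def by simp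
  have Jx: "\<forall>\<^sub>F n in sequentially. \<lfloor>real n * x\<rfloor> \<in> J n" for x
  proof -
    have "\<forall>\<^sub>F n in sequentially. \<bar>x\<bar> + 1 \<le> real n"
      using filterlim_real_sequentially by (auto simp: filterlim_at_top)
    then show ?thesis
    proof eventually_elim
      case (elim n)
      have "\<bar>real_of_int \<lfloor>real n * x\<rfloor>\<bar> \<le> \<bar>real n * x\<bar> + 1" by linarith
      also have "\<dots> \<le> real n * \<bar>x\<bar> + real n * 1" using elim by (simp add: abs_mult)
      also have "\<dots> = real n * (\<bar>x\<bar> + 1)" by (simp add: algebra_simps)
      also have "\<dots> \<le> real n * real n" using elim by (intro mult_left_mono) auto
      finally have "real_of_int \<bar>\<lfloor>real n * x\<rfloor>\<bar> \<le> real_of_int (int n ^ 2)" by (simp add: power2_eq_square)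
      then have "\<bar>\<lfloor>real n * x\<rfloor>\<bar> \<le> int n ^ 2" by (simp only: of_int_le_iff)
      then show ?case unfolding J_def by auto
    qed
  qed
  have bound: "cmod (\<Sum>j\<in>J n. f (of_int j / n) / n) \<le> 3 * B' * pi"
    if f: "\<And>x. cmod (f x) \<le> B' / (1 + x\<^sup>2)" for f :: "real \<Rightarrow> complex" and B' n
    by (rule riemann_sum_bound_and_limit(1)[where f = "\<lambda>_. f" and J = J, OF J f])
  have limit: "(\<lambda>n. \<Sum>j\<in>J n. f (of_int j / n) / n) \<longlonglongrightarrow> (LBINT x. f x)"
    if f: "\<And>x. cmod (f x) \<le> B' / (1 + x\<^sup>2)" "continuous_on UNIV f" for f :: "real \<Rightarrow> complex" and B'
  proof (rule riemann_sum_bound_and_limit(2)[where f = "\<lambda>_. f" and J = J, OF J f(1) Jx])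
    show "(\<lambda>n. f (X n)) \<longlonglongrightarrow> f x" if "X \<longlonglongrightarrow> x" for x X
      using that f(2) by (intro isCont_tendsto_compose[of x f]) (auto simp: continuous_on_eq_continuous_at)
  qed
  define R where "R n = (\<lambda>\<omega>. \<Sum>j\<in>J n. (fourier \<phi> (of_int j / n) / n) * u (of_int j / n) \<omega>)" for n :: nat
  define r where "r n = (\<lambda>k. \<Sum>j\<in>J n. (fourier \<phi> (of_int j / n) / n) * cis (2 * pi * k * (of_int j / n)))" for n :: nat
  have R: "spec (R n) (r n)" for n unfolding R_def r_def by (intro spec_sum base)
  have kB: "cmod (fourier \<phi> x * cis (2 * pi * k * x)) \<le> B / (1 + x\<^sup>2)" for k x
    using B by (simp add: norm_mult)
  have r_eq: "r n k = (\<Sum>j\<in>J n. fourier \<phi> (of_int j / n) * cis (2 * pi * k * (of_int j / n)) / n)" for n k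
    unfolding r_def by simp
  have r1: "cmod (r n k) \<le> 3 * B * pi" for n k
    unfolding r_eq using bound[of "\<lambda>x. fourier \<phi> x * cis (2 * pi * k * x)", OF kB] .
  have r2: "(\<lambda>n. r n k) \<longlonglongrightarrow> \<phi> k" for k
  proof -
    have "(\<lambda>n. r n k) \<longlonglongrightarrow> (LBINT x. fourier \<phi> x * cis (2 * pi * k * x))"
      unfolding r_eq
      by (rule limit[of "\<lambda>x. fourier \<phi> x * cis (2 * pi * k * x)", OF kB]) (intro continuous_intros cF)
    then show ?thesis
      using schwartz_fourier_inversion[OF \<phi>, of k] by (simp add: mult_ac)
  qed
  obtain U where U: "spec U \<phi>" "(\<lambda>n. L2_dist_sq M (R n) U) \<longlonglongrightarrow> 0"
    using spec_complete[OF R r1 r2] by blast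
  have "has_L2_integral M UNIV (\<lambda>x \<omega>. fourier \<phi> x * u x \<omega>) U"
    unfolding has_L2_integral_def
  proof (intro conjI ballI allI impI)
    show "sq_integrable M U" by (rule spec_regular(1)[OF U(1)])
    show "sq_integrable M (\<lambda>\<omega>. fourier \<phi> x * u x \<omega>)" for x by (intro sq_integrable_cmult u)
    fix Y assume Y: "sq_integrable M Y"
    define q where "q x = L2_inner M (u x) Y" for x
    have q: "(LINT \<omega>|M. fourier \<phi> x * u x \<omega> * cnj (Y \<omega>)) = fourier \<phi> x * q x" for x
      unfolding q_def mult.assoc by (rule integral_mult_right_zero)
    have cq: "continuous_on UNIV q" unfolding q_def by (rule pairing_continuous[OF Y])
    obtain K where K: "\<And>x. cmod (q x) \<le> K" using pairing_bounded[OF Y] unfolding q_def by blast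
    have B0: "0 \<le> B" using order_trans[OF norm_ge_zero B[of 0]] by simp
    have qB: "cmod (fourier \<phi> x * q x) \<le> (B * K) / (1 + x\<^sup>2)" for x
      using mult_mono[OF B[of x] K[of x]] B0 by (simp add: norm_mult add_nonneg_nonneg)
    have i: "integrable lborel (\<lambda>x. fourier \<phi> x * q x)"
      by (rule integrable_decay[OF _ qB]) (intro borel_measurable_continuous_onI continuous_intros cF cq)
    then show "set_integrable lborel UNIV (\<lambda>x. LINT \<omega>|M. fourier \<phi> x * u x \<omega> * cnj (Y \<omega>))"
      unfolding q set_integrable_def by simp
    have "(\<lambda>n. L2_inner M (R n) Y) \<longlonglongrightarrow> L2_inner M U Y"
      by (rule L2_tendsto_pairing[OF spec_regular(1)[OF R] spec_regular(1)[OF U(1)] Y U(2)])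
    moreover have "L2_inner M (R n) Y = (\<Sum>j\<in>J n. fourier \<phi> (of_int j / n) * q (of_int j / n) / n)" for n
    proof -
      have "L2_inner M (R n) Y
          = (LINT \<omega>|M. (\<Sum>j\<in>J n. (fourier \<phi> (of_int j / n) / n) * (u (of_int j / n) \<omega> * cnj (Y \<omega>))))"
        unfolding R_def by (simp add: sum_distrib_right mult.assoc)
      also have "\<dots> = (\<Sum>j\<in>J n. (fourier \<phi> (of_int j / n) / n) * q (of_int j / n))"
        unfolding q_def using sq_integrable_mult_cnj[OF u Y]
        by (subst Bochner_Integration.integral_sum) auto
      finally show ?thesis by simp
    qed
    moreover have "(\<lambda>n. \<Sum>j\<in>J n. fourier \<phi> (of_int j / n) * q (of_int j / n) / n) \<longlonglongrightarrow> (LBINT x. fourier \<phi> x * q x)"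
      by (rule limit[of "\<lambda>x. fourier \<phi> x * q x", OF qB]) (intro continuous_intros cF cq)
    ultimately show "L2_inner M U Y
        = (LBINT x:UNIV. (LINT \<omega>|M. fourier \<phi> x * u x \<omega> * cnj (Y \<omega>)))"
      unfolding q set_lebesgue_integral_def using LIMSEQ_unique by simp
  qed
  then have "fourier_pairing M u \<phi> U" unfolding fourier_pairing_def using \<phi> by simp
  then show ?thesis using that U(1) by blast
qed

lemma fourier_pairing_spec:
  assumes "fourier_pairing M u \<phi> U"
  shows "spec U \<phi>"
proof -
  obtain U' where U': "fourier_pairing M u \<phi> U'" "spec U' \<phi>"
    using fourier_pairing_exists assms unfolding fourier_pairing_def by blast
  have "AE \<omega> in M. U' \<omega> = U \<omega>"
    using has_L2_integral_unique U'(1) assms unfolding fourier_pairing_def by blast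
  then show ?thesis
    using spec_cong_AE[OF U'(2)] assms unfolding fourier_pairing_def has_L2_integral_def by blast
qed

text \<open>Every admissible value, whichever approximants define it, obeys the calculus of
  \<open>spec\<close>. For bounded continuous symbols \<open>spec_imp_has_spectral_integral\<close>
  is the converse.\<close>

lemma has_spectral_integral_imp_spec:
  assumes "has_spectral_integral M u \<psi> V"
  shows "spec V \<psi>"
proof -
  obtain \<phi> U B where *: "\<And>n::nat. fourier_pairing M u (\<phi> n) (U n)" "\<And>n k. cmod (\<phi> n k) \<le> B"
    "\<And>k. (\<lambda>n. \<phi> n k) \<longlonglongrightarrow> \<psi> k" "(\<lambda>n. L2_dist_sq M (U n) V) \<longlonglongrightarrow> 0"
    using assms unfolding has_spectral_integral_def by blast
  have "sq_integrable M V" using assms unfolding has_spectral_integral_def by blast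
  from lim[OF fourier_pairing_spec[OF *(1)] *(2,3) this *(4)] show ?thesis .
qed

lemma schwartz_pairing_approximation:
  assumes "continuous_on UNIV \<psi>" "\<And>k. cmod (\<psi> k) \<le> B"
  obtains \<phi> U B' where "\<And>n::nat. fourier_pairing M u (\<phi> n) (U n)" "\<And>n. spec (U n) (\<phi> n)"
    "\<And>n k. cmod (\<phi> n k) \<le> B'" "\<And>k. (\<lambda>n. \<phi> n k) \<longlonglongrightarrow> \<psi> k"
proof -
  obtain \<phi> B' where \<phi>: "\<And>n::nat. schwartz (\<phi> n)" "\<And>n k. cmod (\<phi> n k) \<le> B'" "\<And>k. (\<lambda>n. \<phi> n k) \<longlonglongrightarrow> \<psi> k"
    using schwartz_approximation[OF assms] by blast
  have "\<forall>n. \<exists>U. fourier_pairing M u (\<phi> n) U \<and> spec U (\<phi> n)"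
    using fourier_pairing_exists[OF \<phi>(1)] by blast
  from choice[OF this] obtain U where "\<And>n. fourier_pairing M u (\<phi> n) (U n)" "\<And>n. spec (U n) (\<phi> n)" by blast
  then show ?thesis using that \<phi> by blast
qed

lemma spec_imp_has_spectral_integral:
  assumes \<psi>: "continuous_on UNIV \<psi>" "\<And>k. cmod (\<psi> k) \<le> B" and V: "spec V \<psi>"
  shows "has_spectral_integral M u \<psi> V"
proof -
  obtain \<phi> U B' where *: "\<And>n::nat. fourier_pairing M u (\<phi> n) (U n)" "\<And>n. spec (U n) (\<phi> n)"
    "\<And>n k. cmod (\<phi> n k) \<le> B'" "\<And>k. (\<lambda>n. \<phi> n k) \<longlonglongrightarrow> \<psi> k"
    using schwartz_pairing_approximation[OF \<psi>] by blast
  from spec_tendsto[OF *(2) V *(3,4)] show ?thesis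
    unfolding has_spectral_integral_def using * spec_regular(1)[OF V] by blast
qed

lemma has_spectral_integral_exists:
  assumes \<psi>: "continuous_on UNIV \<psi>" "\<And>k. cmod (\<psi> k) \<le> B"
  shows "\<exists>V. has_spectral_integral M u \<psi> V"
proof -
  obtain \<phi> U B' where *: "\<And>n::nat. fourier_pairing M u (\<phi> n) (U n)" "\<And>n. spec (U n) (\<phi> n)"
    "\<And>n k. cmod (\<phi> n k) \<le> B'" "\<And>k. (\<lambda>n. \<phi> n k) \<longlonglongrightarrow> \<psi> k"
    using schwartz_pairing_approximation[OF \<psi>] by blast
  obtain V where "spec V \<psi>" using spec_complete[OF *(2,3,4)] by blast
  then show ?thesis using spec_imp_has_spectral_integral[OF \<psi>] by blast
qed

end

section \<open>The forced equation\<close>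

text \<open>The integral equation bootstraps regularity: an indefinite integral is continuous, hence
  the integral of a continuous function is differentiable, and exp(-a t) p(t) is constant with value
  0 at the origin.\<close>

lemma volterra_unique:
  fixes p :: "real \<Rightarrow> complex"
  assumes int: "set_integrable lborel {0..T} (\<lambda>s. a * p s)"
    and p: "\<And>t. 0 \<le> t \<Longrightarrow> t \<le> T \<Longrightarrow> p t = (LBINT s:{0..t}. a * p s)"
    and "0 \<le> T"
  shows "p T = 0"
proof -
  let ?f = "\<lambda>s. a * p s"
  have p': "p t = integral {0..t} ?f" if "t \<in> {0..T}" for t
  proof -
    have "set_integrable lborel {0..t} ?f"
      by (rule set_integrable_subset[OF int]) (use that in auto)
    from set_borel_integral_eq_integral(2)[OF this] show ?thesis using p that by simp
  qed
  have "?f integrable_on {0..T}" by (rule set_borel_integral_eq_integral(1)[OF int])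
  then have "continuous_on {0..T} (\<lambda>t. integral {0..t} ?f)" by (rule indefinite_integral_continuous_1)
  then have cp: "continuous_on {0..T} p" by (simp only: continuous_on_cong[OF refl p'])
  have dp: "(p has_vector_derivative a * p t) (at t within {0..T})" if "t \<in> {0..T}" for t
  proof (rule has_vector_derivative_transform[OF that])
    show "((\<lambda>t. integral {0..t} ?f) has_vector_derivative a * p t) (at t within {0..T})"
      using that cp by (intro integral_has_vector_derivative continuous_intros)
  qed (use p' in auto)
  have "exp (- a * of_real t) * p t = exp (- a * of_real 0) * p 0" if "t \<in> {0..T}" for t
  proof -
    obtain k where "\<And>t. t \<in> {0..T} \<Longrightarrow> exp (- a * complex_of_real t) * p t = k"
    proof (rule has_vector_derivative_zero_constant)
      fix t assume t: "t \<in> {0..T}"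
      have "((\<lambda>z. exp (- a * z)) has_field_derivative (- a * exp (- a * complex_of_real t))) (at (complex_of_real t))"
        by (auto intro!: derivative_eq_intros)
      from has_vector_derivative_mult[OF has_vector_derivative_real_field[OF this] dp[OF t]]
      show "((\<lambda>t. exp (- a * complex_of_real t) * p t) has_vector_derivative 0) (at t within {0..T})"
        by (simp add: algebra_simps)
    qed auto
    from this[OF that] this[of 0] show ?thesis using \<open>0 \<le> T\<close> by simp
  qed
  moreover have "p 0 = 0" using p'[of 0] \<open>0 \<le> T\<close> by simp
  ultimately show ?thesis using \<open>0 \<le> T\<close> by simp
qed

text \<open>Fubini on the triangle 0 \<le> r \<le> s \<le> t. For fixed \<open>r\<close> the
  integrand in \<open>s\<close> is the derivative of the phase, so the inner integral is the phase
  at \<open>t\<close> minus 1, times \<open>h r\<close>.\<close>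

lemma variation_of_constants:
  fixes h :: "real \<Rightarrow> complex" and \<alpha> :: real
  assumes h[measurable]: "h \<in> borel_measurable borel" and h1: "\<And>r. cmod (h r) \<le> 1" and "0 \<le> t"
  defines "d \<equiv> \<lambda>s. (LBINT r:{0..s}. cis (\<alpha> * (s - r)) * h r)"
  shows "set_integrable lborel {0..t} (\<lambda>s. \<i> * \<alpha> * d s)"
    and "d t = (LBINT s:{0..t}. \<i> * \<alpha> * d s) + (LBINT r:{0..t}. h r)"
proof -
  let ?g = "\<lambda>(s, r). if 0 \<le> r \<and> r \<le> s \<and> s \<le> t then \<i> * \<alpha> * (cis (\<alpha> * (s - r)) * h r) else 0"
  have ii: "integrable lborel (\<lambda>s. c * indicator {0..t} s)" for c :: real
    by (intro integrable_mult_right integrable_real_indicator) (auto simp: emeasure_lborel_Icc_eq)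
  have int: "integrable (lborel \<Otimes>\<^sub>M lborel) ?g"
  proof (rule lborel_pair_integrable_bound)
    show "cmod (?g (s, r)) \<le> (\<bar>\<alpha>\<bar> * indicator {0..t} s) * (1 * indicator {0..t} r)" for s r
      using h1[of r] by (auto simp: norm_mult indicator_def mult_left_le)
    show "integrable lborel (\<lambda>s. \<bar>\<alpha>\<bar> * indicator {0..t} s)" "integrable lborel (\<lambda>r. 1 * indicator {0..t} r :: real)"
      by (rule ii)+
  qed measurable
  have ad: "indicator {0..t} s *\<^sub>R (\<i> * \<alpha> * d s) = (LBINT r. ?g (s, r))" for s
  proof -
    have "indicator {0..t} s *\<^sub>R (\<i> * \<alpha> * d s)
        = (LBINT r. (indicator {0..t} s * (\<i> * \<alpha>)) * (indicator {0..s} r *\<^sub>R (cis (\<alpha> * (s - r)) * h r)))"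
      unfolding d_def set_lebesgue_integral_def integral_mult_right_zero
      by (simp add: scaleR_conv_of_real indicator_def)
    also have "\<dots> = (LBINT r. ?g (s, r))"
      by (intro Bochner_Integration.integral_cong refl) (auto simp: indicator_def)
    finally show ?thesis .
  qed
  show "set_integrable lborel {0..t} (\<lambda>s. \<i> * \<alpha> * d s)"
    unfolding set_integrable_def ad by (rule lborel_pair.integrable_fst'[OF int])
  have inner: "(LBINT s. ?g (s, r)) = indicator {0..t} r *\<^sub>R (cis (\<alpha> * (t - r)) * h r - h r)" for r
  proof (cases "0 \<le> r \<and> r \<le> t")
    case True
    have "(LBINT s. ?g (s, r)) = (LBINT s. (indicator {r..t} s *\<^sub>R (\<i> * \<alpha> * cis (\<alpha> * (s - r)))) * h r)"
      using True by (intro Bochner_Integration.integral_cong refl) (auto simp: indicator_def)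
    also have "\<dots> = (LBINT s. indicator {r..t} s *\<^sub>R (\<i> * \<alpha> * cis (\<alpha> * (s - r)))) * h r"
      by (rule integral_mult_left_zero)
    also have "(LBINT s. indicator {r..t} s *\<^sub>R (\<i> * \<alpha> * cis (\<alpha> * (s - r)))) = cis (\<alpha> * (t - r)) - cis (\<alpha> * (r - r))"
    proof (rule integral_FTC_atLeastAtMost)
      fix s
      have "((\<lambda>z. exp (\<i> * \<alpha> * (z - r))) has_field_derivative (\<i> * \<alpha> * exp (\<i> * \<alpha> * (complex_of_real s - r)))) (at (complex_of_real s))"
        by (auto intro!: derivative_eq_intros)
      from has_vector_derivative_real_field[OF this]
      show "((\<lambda>s. cis (\<alpha> * (s - r))) has_vector_derivative (\<i> * \<alpha> * cis (\<alpha> * (s - r)))) (at s within {r..t})"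
        by (simp add: cis_conv_exp mult.assoc)
    qed (use True in \<open>auto intro!: continuous_intros\<close>)
    finally show ?thesis using True by (simp add: algebra_simps)
  qed (auto simp: indicator_def intro!: integral_eq_zero_AE)
  have ih: "set_integrable lborel {0..t} h"
    unfolding set_integrable_def
    by (rule Bochner_Integration.integrable_bound[OF ii[of 1]]) (use h1 in \<open>auto simp: indicator_def\<close>)
  have ich: "set_integrable lborel {0..t} (\<lambda>r. cis (\<alpha> * (t - r)) * h r)"
    unfolding set_integrable_def
    by (rule Bochner_Integration.integrable_bound[OF ii[of 1]]) (use h1 in \<open>auto simp: indicator_def norm_mult\<close>)
  have "(LBINT s:{0..t}. \<i> * \<alpha> * d s) = (LBINT s. LBINT r. ?g (s, r))"
    unfolding set_lebesgue_integral_def ad ..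
  also have "\<dots> = (LBINT r. LBINT s. ?g (s, r))"
    using lborel_pair.Fubini_integral[of "\<lambda>s r. ?g (s, r)"] int by simp
  also have "\<dots> = (LBINT r:{0..t}. cis (\<alpha> * (t - r)) * h r - h r)"
    unfolding inner set_lebesgue_integral_def ..
  also have "\<dots> = d t - (LBINT r:{0..t}. h r)"
    unfolding d_def by (rule set_integral_diff(2)[OF ich ih])
  finally show "d t = (LBINT s:{0..t}. \<i> * \<alpha> * d s) + (LBINT r:{0..t}. h r)" by simp
qed

lemma time_test_indicator_cis: "time_test (\<lambda>s. indicator {0..t} s * cis (\<beta> * (t - s)))"
proof -
  have "integrable lborel (\<lambda>s::real. indicator {0..t} s :: real)"
    by (intro integrable_real_indicator) (auto simp: emeasure_lborel_Icc_eq)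
  then have "set_integrable lborel {0..} (\<lambda>s. (cmod (indicator {0..t} s * cis (\<beta> * (t - s))))\<^sup>2)"
    unfolding set_integrable_def
    by (rule Bochner_Integration.integrable_cong[OF refl, THEN iffD1, rotated])
       (auto simp: indicator_def norm_mult)
  then show ?thesis unfolding time_test_def by auto
qed

lemma forcing_moments:
  assumes F: "white_in_time_forcing M C F" and g: "time_test g" and h: "time_test h"
  shows forcing_mean: "(LINT \<omega>|M. F g x \<omega>) = 0"
    and forcing_cov: "L2_inner M (F g x) (F h y)
      = (LBINT s:{0..}. g s * cnj (h s)) * complex_of_real (C (x - y))"
    and forcing_pseudo_cov: "(LINT \<omega>|M. F g x \<omega> * F h y \<omega>) = 0"
proof -
  note F' = F[unfolded white_in_time_forcing_def, THEN conjunct2]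
  show "(LINT \<omega>|M. F g x \<omega>) = 0"
    by (rule F'[THEN conjunct1, rule_format, OF g])
  show "L2_inner M (F g x) (F h y)
      = (LBINT s:{0..}. g s * cnj (h s)) * complex_of_real (C (x - y))"
    by (rule F'[THEN conjunct2, THEN conjunct1, rule_format, OF conjI[OF g h]])
  show "(LINT \<omega>|M. F g x \<omega> * F h y \<omega>) = 0"
    by (rule F'[THEN conjunct2, THEN conjunct2, rule_format, OF conjI[OF g h]])
qed

lemma (in prob_space) forcing_sq_integrable:
  assumes "white_in_time_forcing M C F" "time_test g"
  shows "sq_integrable M (F g x)"
  using gaussian_family_sq_integrable[of "{g. time_test g} \<times> UNIV" "\<lambda>(g, x). F g x" "(g, x)"] assms
  unfolding white_in_time_forcing_def by auto

lemma set_integral_half_line_indicator: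
  "(LBINT s:{0..}. (indicator {0..t} s * f s) * g s) = (LBINT s:{0..t}. f s * (g s :: complex))"
  unfolding set_lebesgue_integral_def
  by (intro Bochner_Integration.integral_cong refl) (auto simp: indicator_def)

text \<open>Tested against stochastic integrals of the forcing, the equation becomes a scalar
  Volterra equation, also satisfied by the Duhamel integral \<open>D\<close>; hence
  \<open>w = u t x - D t\<close> is orthogonal to these integrals. Tested against \<open>w\<close>,
  the equation loses its noise term and becomes homogeneous, so \<open>u t x\<close> is orthogonal
  to \<open>w\<close>. As \<open>D t\<close> is a stochastic integral too, \<open>w\<close> is
  orthogonal to itself.\<close>

lemma (in prob_space) forced_solution_eq_duhamel:
  assumes F: "white_in_time_forcing M C F" and sol: "forced_solution M c F u" and "0 \<le> t"
  shows "AE \<omega> in M. u t x \<omega> = duhamel c F t x \<omega>"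
proof -
  define \<alpha> where "\<alpha> = 2 * pi * c * x"
  \<comment> \<open>One family of kernels contains both variables needed: \<open>\<beta> = 0\<close>
    gives the integrated noise and \<open>\<beta> = \<alpha>\<close> the Duhamel integral.\<close>
  define k where "k \<beta> T = (\<lambda>s. indicator {0..T} s * cis (\<beta> * (T - s)))" for \<beta> T :: real
  define D where "D s = F (k \<alpha> s) x" for s
  define N where "N s = F (k 0 s) x" for s
  have D_duhamel: "duhamel c F s x = D s" for s
    unfolding duhamel_def D_def k_def \<alpha>_def by simp
  have N_eq: "F (indicator {0..s}) x = N s" for s
    unfolding N_def k_def by (intro arg_cong[where f = "\<lambda>g. F g x"]) (auto simp: cis_conv_exp)
  have tk: "time_test (k \<beta> T)" for \<beta> T unfolding k_def by (rule time_test_indicator_cis)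
  have sF: "sq_integrable M (F g x)" if "time_test g" for g by (rule forcing_sq_integrable[OF F that])
  have sD: "sq_integrable M (D s)" and sN: "sq_integrable M (N s)" for s
    unfolding D_def N_def by (auto intro: sF tk)
  have su: "sq_integrable M (u s x)" if "0 \<le> s" for s
    using sol that unfolding forced_solution_def by blast
  have eqn: "set_integrable lborel {0..s} (\<lambda>r. \<i> * \<alpha> * L2_inner M (u r x) Y)
      \<and> (L2_inner M (u s x) Y)
        = (LBINT r:{0..s}. \<i> * \<alpha> * L2_inner M (u r x) Y) + L2_inner M (N s) Y"
    if Y: "sq_integrable M Y" and s: "0 \<le> s" for Y s
  proof -
    obtain I where I: "has_L2_integral M {0..s} (\<lambda>r \<omega>. 2 * \<i> * pi * c * x * u r x \<omega>) I"
      "AE \<omega> in M. u s x \<omega> = I \<omega> + N s \<omega>"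
      using sol s unfolding forced_solution_def N_eq[symmetric] by blast
    have sI: "sq_integrable M I" using I(1) unfolding has_L2_integral_def by blast
    have r: "(LINT \<omega>|M. 2 * \<i> * pi * c * x * u r x \<omega> * cnj (Y \<omega>)) = \<i> * \<alpha> * L2_inner M (u r x) Y" for r
      unfolding \<alpha>_def integral_mult_right_zero[symmetric] by (simp add: mult_ac)
    have "L2_inner M (u s x) Y = (LINT \<omega>|M. (I \<omega> + N s \<omega>) * cnj (Y \<omega>))"
    proof (rule integral_cong_AE)
      show "(\<lambda>\<omega>. u s x \<omega> * cnj (Y \<omega>)) \<in> borel_measurable M"
        by (rule borel_measurable_integrable[OF sq_integrable_mult_cnj[OF su[OF s] Y]])
      show "(\<lambda>\<omega>. (I \<omega> + N s \<omega>) * cnj (Y \<omega>)) \<in> borel_measurable M"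
        by (rule borel_measurable_integrable[OF sq_integrable_mult_cnj[OF sq_integrable_add[OF sI sN] Y]])
    qed (use I(2) in \<open>auto elim!: AE_mp\<close>)
    also have "\<dots> = L2_inner M I Y + L2_inner M (N s) Y"
      using sq_integrable_mult_cnj[OF sI Y] sq_integrable_mult_cnj[OF sN Y] by (simp add: distrib_right)
    finally have 1: "L2_inner M (u s x) Y
        = L2_inner M I Y + L2_inner M (N s) Y" .
    have IY: "set_integrable lborel {0..s} (\<lambda>r. LINT \<omega>|M. 2 * \<i> * pi * c * x * u r x \<omega> * cnj (Y \<omega>))
        \<and> (L2_inner M I Y) = (LBINT r:{0..s}. (LINT \<omega>|M. 2 * \<i> * pi * c * x * u r x \<omega> * cnj (Y \<omega>)))"
      using I(1) Y unfolding has_L2_integral_def by blast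
    show ?thesis
      unfolding 1 IY[unfolded r, THEN conjunct2] using IY[unfolded r, THEN conjunct1] by (rule conjI) (rule refl)
  qed
  have Dcov: "(L2_inner M (F (k \<beta> s) x) (F h x)) = (LBINT r:{0..s}. cis (\<beta> * (s - r)) * cnj (h r)) * C 0"
    if "time_test h" for h s \<beta>
  proof -
    have "(L2_inner M (F (k \<beta> s) x) (F h x)) = (LBINT r:{0..}. k \<beta> s r * cnj (h r)) * complex_of_real (C (x - x))"
      by (rule forcing_cov[OF F tk that])
    then show ?thesis unfolding k_def set_integral_half_line_indicator by simp
  qed
  have uh: "(L2_inner M (u s x) (F (k \<beta> T) x)) = (L2_inner M (D s) (F (k \<beta> T) x))"
    if s: "0 \<le> s" for s \<beta> T
  proof -
    define h where "h = (\<lambda>r. cnj (k \<beta> T r))"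
    define d where "d s = (LBINT r:{0..s}. cis (\<alpha> * (s - r)) * h r)" for s
    define p where "p s = (L2_inner M (u s x) (F (k \<beta> T) x))" for s
    have hm: "h \<in> borel_measurable borel" using tk[of \<beta> T] unfolding h_def time_test_def by auto
    have h1: "cmod (h r) \<le> 1" for r unfolding h_def k_def by (auto simp: indicator_def norm_mult)
    note d = variation_of_constants[OF hm h1, where \<alpha> = \<alpha>, folded d_def]
    have p: "set_integrable lborel {0..t} (\<lambda>r. \<i> * \<alpha> * p r)"
        "p t = (LBINT r:{0..t}. \<i> * \<alpha> * p r) + (LBINT r:{0..t}. h r) * C 0" if "0 \<le> t" for t
      using eqn[OF sF[OF tk] that, of \<beta> T] Dcov[OF tk, of 0 t \<beta> T]
      unfolding p_def N_def h_def by auto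
    \<comment> \<open>\<open>p\<close> and \<open>d\<close> times \<open>C 0\<close> satisfy the
      same inhomogeneous Volterra equation; the space point is the same in both factors, whence
      \<open>C\<close> at 0.\<close>
    have "p s - d s * C 0 = 0"
    proof (rule volterra_unique[where p = "\<lambda>s. p s - d s * C 0"])
      have i: "set_integrable lborel {0..t} (\<lambda>s. \<i> * \<alpha> * d s * C 0)" if "0 \<le> t" for t
        using d(1)[OF that] by (rule set_integrable_mult_left[rotated]) 
      have eq: "\<i> * \<alpha> * (p s - d s * C 0) = \<i> * \<alpha> * p s - \<i> * \<alpha> * d s * C 0" for s
        by (simp add: algebra_simps)
      show "set_integrable lborel {0..s} (\<lambda>s. \<i> * \<alpha> * (p s - d s * C 0))"
        unfolding eq by (rule set_integral_diff(1)[OF p(1)[OF s] i[OF s]])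
      fix t assume t: "0 \<le> t" "t \<le> s"
      have "(LBINT s:{0..t}. \<i> * \<alpha> * (p s - d s * C 0))
          = (LBINT s:{0..t}. \<i> * \<alpha> * p s) - (LBINT s:{0..t}. \<i> * \<alpha> * d s) * C 0"
        unfolding eq set_integral_diff(2)[OF p(1)[OF t(1)] i[OF t(1)]] by (simp add: set_integral_mult_left)
      then show "p t - d t * C 0 = (LBINT s:{0..t}. \<i> * \<alpha> * (p s - d s * C 0))"
        using p(2)[OF t(1)] d(2)[OF t(1)] by (simp add: algebra_simps)
    qed fact
    moreover have "(L2_inner M (D s) (F (k \<beta> T) x)) = d s * C 0"
      unfolding D_def d_def h_def by (rule Dcov[OF tk])
    ultimately show ?thesis unfolding p_def by simp
  qed
  define w where "w = (\<lambda>\<omega>. u t x \<omega> - D t \<omega>)"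
  have sw: "sq_integrable M w" unfolding w_def by (intro sq_integrable_diff su sD \<open>0 \<le> t\<close>)
  have orth: "(L2_inner M (F (k \<beta> T) x) w) = 0" for \<beta> T
  proof -
    have "(L2_inner M w (F (k \<beta> T) x)) = 0"
      using uh[OF \<open>0 \<le> t\<close>, of \<beta> T] sq_integrable_mult_cnj[OF su[OF \<open>0 \<le> t\<close>] sF[OF tk]] sq_integrable_mult_cnj[OF sD sF[OF tk]]
      unfolding w_def by (simp add: left_diff_distrib)
    then show ?thesis using L2_inner_cnj[of M "F (k \<beta> T) x" w] by simp
  qed
  have N0: "L2_inner M (N s) w = 0" for s unfolding N_def by (rule orth)
  have "L2_inner M (u t x) w = 0"
  proof (rule volterra_unique[where p = "\<lambda>s. L2_inner M (u s x) w"])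
    show "set_integrable lborel {0..t} (\<lambda>s. \<i> * \<alpha> * L2_inner M (u s x) w)"
      by (rule eqn[OF sw \<open>0 \<le> t\<close>, THEN conjunct1])
    fix s :: real assume "0 \<le> s"
    from eqn[OF sw this, THEN conjunct2, unfolded N0 add_0_right]
    show "L2_inner M (u s x) w = (LBINT r:{0..s}. \<i> * \<alpha> * L2_inner M (u r x) w)" .
  qed fact
  moreover have "L2_inner M (D t) w = 0" unfolding D_def by (rule orth)
  moreover have "L2_inner M w w
      = (LINT \<omega>|M. u t x \<omega> * cnj (w \<omega>) - D t \<omega> * cnj (w \<omega>))"
    by (intro Bochner_Integration.integral_cong refl) (simp only: w_def left_diff_distrib)
  moreover have "\<dots> = L2_inner M (u t x) w - L2_inner M (D t) w"
    by (rule Bochner_Integration.integral_diff[OF sq_integrable_mult_cnj[OF su[OF \<open>0 \<le> t\<close>] sw]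
        sq_integrable_mult_cnj[OF sD sw]])
  ultimately have "L2_inner M w w = 0" by simp
  then have "L2_norm_sq M w = 0"
    using L2_norm_sq_eq[of M w] of_real_eq_0_iff by metis
  from L2_norm_zero_AE[OF sw this] show ?thesis unfolding D_duhamel w_def by auto
qed

section \<open>Spectral density at time t\<close>

text \<open>If \<open>g\<close> is the spectral density of the forcing in space, then \<open>evolved_density c g t\<close> is that of
  the solution at time \<open>t\<close>: transport at speed \<open>c\<close> in the wavenumber spreads \<open>g\<close> over distance
  \<open>c * t\<close>.\<close>

definition evolved_density :: "real \<Rightarrow> (real \<Rightarrow> complex) \<Rightarrow> real \<Rightarrow> real \<Rightarrow> complex" where
  "evolved_density c g t k = (LBINT r. indicator {0..t} ((k - r) / c) *\<^sub>R g r) / \<bar>c\<bar>"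

context
  fixes c :: real and g :: "real \<Rightarrow> complex"
  assumes c: "c \<noteq> 0" and g: "integrable lborel g"
begin

lemma g_measurable [measurable]: "g \<in> borel_measurable borel"
  using g by simp

lemma indicator_reflect: "(indicator {0..t} (t - s) :: real) = indicator {0..t} (s :: real)"
  by (auto simp: indicator_def)

lemma window_substitution:
  fixes f :: "real \<Rightarrow> complex"
  shows "(LBINT k. indicator {0..t} ((k - r) / c) *\<^sub>R f k)
       = \<bar>c\<bar> *\<^sub>R (LBINT s:{0..t}. f (r + c * (t - s)))"
proof -
  have "(LBINT k. indicator {0..t} ((k - r) / c) *\<^sub>R f k)
      = \<bar>- c\<bar> *\<^sub>R (LBINT s. indicator {0..t} (((r + c * t) + (- c) * s - r) / c) *\<^sub>R f ((r + c * t) + (- c) * s))"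
    by (rule lborel_integral_real_affine) (use c in simp)
  also have "(LBINT s. indicator {0..t} (((r + c * t) + (- c) * s - r) / c) *\<^sub>R f ((r + c * t) + (- c) * s))
      = (LBINT s:{0..t}. f (r + c * (t - s)))"
    unfolding set_lebesgue_integral_def
  proof (intro Bochner_Integration.integral_cong refl)
    fix s
    have "((r + c * t) + (- c) * s - r) / c = t - s" "(r + c * t) + (- c) * s = r + c * (t - s)"
      using c by (simp_all add: field_simps)
    then show "indicator {0..t} (((r + c * t) + (- c) * s - r) / c) *\<^sub>R f ((r + c * t) + (- c) * s)
        = indicator {0..t} s *\<^sub>R f (r + c * (t - s))"
      by (simp only: indicator_reflect)
  qed
  finally show ?thesis by simp
qed

lemma window_integrable: "integrable lborel (\<lambda>k. indicator {0..t} ((k - r) / c) :: real)"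
  using lborel_integrable_real_affine[of "indicator {0..t} :: real \<Rightarrow> real" "1 / c" "- r / c"] c
  by (simp add: diff_divide_distrib emeasure_lborel_Icc_eq)

lemma window_pair_integrable:
  "integrable (lborel \<Otimes>\<^sub>M lborel) (\<lambda>(r, k). indicator {0..t} ((k - r) / c) *\<^sub>R g r)"
proof (rule lborel_pair.Fubini_integrable)
  let ?f = "\<lambda>(r, k). indicator {0..t} ((k - r) / c) *\<^sub>R g r"
  show "?f \<in> borel_measurable (lborel \<Otimes>\<^sub>M lborel)" by measurable
  show "AE r in lborel. integrable lborel (\<lambda>k. ?f (r, k))"
    using window_integrable by (intro AE_I2) (simp add: integrable_scaleR_left)
  have "(LBINT k. norm (?f (r, k))) = measure lborel {0..t} * \<bar>c\<bar> * cmod (g r)" for r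
  proof -
    have "(LBINT k. norm (?f (r, k))) = (LBINT k. indicator {0..t} ((k - r) / c)) * cmod (g r)"
      by (subst integral_mult_left_zero[symmetric]) (auto intro!: Bochner_Integration.integral_cong)
    moreover have "complex_of_real (LBINT k. indicator {0..t} ((k - r) / c)) = complex_of_real (measure lborel {0..t} * \<bar>c\<bar>)"
      using window_substitution[of t r "\<lambda>_. 1"]
      by (simp add: set_lebesgue_integral_def scaleR_conv_of_real mult.commute flip: integral_complex_of_real)
    ultimately show ?thesis by (simp only: of_real_eq_iff)
  qed
  then have "(\<lambda>r. LBINT k. norm (?f (r, k))) = (\<lambda>r. measure lborel {0..t} * \<bar>c\<bar> * cmod (g r))"
    by (rule ext)
  moreover have "integrable lborel (\<lambda>r. measure lborel {0..t} * \<bar>c\<bar> * cmod (g r))"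
    using g by (intro integrable_mult_right integrable_norm)
  ultimately show "integrable lborel (\<lambda>r. LBINT k. norm (?f (r, k)))"
    by (simp only:)
qed

lemma evolved_density_integrable: "integrable lborel (evolved_density c g t)"
proof -
  have "integrable lborel (\<lambda>k. LBINT r. indicator {0..t} ((k - r) / c) *\<^sub>R g r)"
    using lborel_pair.integrable_snd[of "\<lambda>r k. indicator {0..t} ((k - r) / c) *\<^sub>R g r"] window_pair_integrable[of t] by simp
  then show ?thesis unfolding evolved_density_def by simp
qed

text \<open>The density is a convolution of \<open>g\<close> with a window, so its transform is a
  product: the covariance of the forcing at distance \<open>z\<close> times the accumulated phase
  difference of two points at that distance.\<close>

lemma evolved_density_fourier:
  "(LBINT k. cis (2 * pi * k * z) * evolved_density c g t k)
     = (LBINT r. cis (2 * pi * r * z) * g r) * (LBINT s:{0..t}. cis (2 * pi * c * z * (t - s)))"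
proof -
  let ?e = "\<lambda>k. cis (2 * pi * k * z)"
  let ?f = "\<lambda>r k. ?e k * (indicator {0..t} ((k - r) / c) *\<^sub>R g r)"
  let ?J = "LBINT s:{0..t}. cis (2 * pi * c * z * (t - s))"
  have em: "?e \<in> borel_measurable borel" by (intro borel_measurable_continuous_onI continuous_intros)
  have int: "integrable (lborel \<Otimes>\<^sub>M lborel) (\<lambda>(r, k). ?f r k)"
  proof (rule Bochner_Integration.integrable_bound[OF window_pair_integrable[of t]])
    show "(\<lambda>(r, k). ?f r k) \<in> borel_measurable (lborel \<Otimes>\<^sub>M lborel)" using em by measurable
  qed (auto simp: norm_mult)
  have "(LBINT k. ?e k * evolved_density c g t k) = (LBINT k. LBINT r. ?f r k) / \<bar>c\<bar>"
    unfolding evolved_density_def times_divide_eq_right integral_mult_right_zero integral_divide_zero ..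
  also have "(LBINT k. LBINT r. ?f r k) = (LBINT r. LBINT k. ?f r k)"
    by (rule lborel_pair.Fubini_integral[OF int])
  also have "\<dots> = (LBINT r. \<bar>c\<bar> * (?e r * g r * ?J))"
  proof (rule Bochner_Integration.integral_cong[OF refl])
    fix r
    have "(LBINT k. ?f r k) = (LBINT k. indicator {0..t} ((k - r) / c) *\<^sub>R (?e k * g r))"
      by simp
    also have "\<dots> = \<bar>c\<bar> *\<^sub>R (LBINT s:{0..t}. ?e (r + c * (t - s)) * g r)"
      by (rule window_substitution)
    also have "(LBINT s:{0..t}. ?e (r + c * (t - s)) * g r) = (LBINT s:{0..t}. (?e r * g r) * cis (2 * pi * c * z * (t - s)))"
    proof -
      have "?e (r + c * (t - s)) = ?e r * cis (2 * pi * c * z * (t - s))" for s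
        by (simp add: cis_mult algebra_simps)
      then show ?thesis by (simp add: mult_ac)
    qed
    also have "\<dots> = ?e r * g r * ?J" by (rule set_integral_mult_right)
    finally show "(LBINT k. ?f r k) = \<bar>c\<bar> * (?e r * g r * ?J)" by (simp add: scaleR_conv_of_real)
  qed
  also have "\<dots> / \<bar>c\<bar> = (LBINT r. ?e r * g r) * ?J"
    using c by simp
  finally show ?thesis .
qed

section \<open>Large time limit of the density\<close>

lemma evolved_density_bound: "cmod (evolved_density c g t k) \<le> (LBINT r. cmod (g r)) / \<bar>c\<bar>"
proof -
  have "cmod (LBINT r. indicator {0..t} ((k - r) / c) *\<^sub>R g r) \<le> (LBINT r. cmod (g r))"
  proof (rule norm_integral_le)
    show "integrable lborel (\<lambda>r. indicator {0..t} ((k - r) / c) *\<^sub>R g r)"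
      by (rule Bochner_Integration.integrable_bound[OF g]) (auto simp: indicator_def)
  qed (use g in \<open>auto simp: indicator_def\<close>)
  then show ?thesis unfolding evolved_density_def by (simp add: norm_divide divide_right_mono)
qed

text \<open>A primitive of \<open>g\<close> divided by |c|: the integral runs over r \<le> k for
  positive \<open>c\<close> and over r \<ge> k for negative \<open>c\<close>.\<close>

definition limit_density :: "real \<Rightarrow> complex" where
  "limit_density k = (LBINT r. indicator {0..} ((k - r) / c) *\<^sub>R g r) / \<bar>c\<bar>"

lemma evolved_density_tendsto: "((\<lambda>t. evolved_density c g t k) \<longlongrightarrow> limit_density k) at_top"
proof -
  have "((\<lambda>t. LBINT r. indicator {0..t} ((k - r) / c) *\<^sub>R g r)
      \<longlongrightarrow> (LBINT r. indicator {0..} ((k - r) / c) *\<^sub>R g r)) at_top"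
  proof (rule integral_dominated_convergence_at_top[where w = "\<lambda>r. cmod (g r)"])
    show "AE r in lborel. ((\<lambda>t. indicator {0..t} ((k - r) / c) *\<^sub>R g r) \<longlongrightarrow> indicator {0..} ((k - r) / c) *\<^sub>R g r) at_top"
    proof (rule AE_I2, rule tendsto_eventually)
      fix r
      show "\<forall>\<^sub>F t in at_top. indicator {0..t} ((k - r) / c) *\<^sub>R g r = indicator {0..} ((k - r) / c) *\<^sub>R g r"
        using eventually_ge_at_top[of "(k - r) / c"] by eventually_elim (auto simp: indicator_def)
    qed
    show "\<forall>\<^sub>F t in at_top. AE r in lborel. norm (indicator {0..t} ((k - r) / c) *\<^sub>R g r) \<le> cmod (g r)"
      by (auto simp: indicator_def)
  qed (use g in measurable, use g in simp)
  then show ?thesis unfolding evolved_density_def limit_density_def by (intro tendsto_intros) (use c in auto)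
qed

text \<open>Reflecting the variable turns the half-line for \<open>- k\<close> into the half-line
  opposite to that for \<open>k\<close>. Together they cover the line and overlap only at
  \<open>r = k\<close>, a null set.\<close>

lemma limit_density_symmetric:
  assumes even: "\<And>r. g (- r) = g r"
  shows "limit_density k + limit_density (- k) = (LBINT r. g r) / \<bar>c\<bar>"
proof -
  have i: "integrable lborel (\<lambda>r. indicator {0..} (h r) *\<^sub>R g r)" if [measurable]: "h \<in> borel_measurable borel" for h :: "real \<Rightarrow> real"
    by (rule Bochner_Integration.integrable_bound[OF g]) (auto simp: indicator_def)
  have "(LBINT r. indicator {0..} ((- k - r) / c) *\<^sub>R g r)
      = \<bar>-1\<bar> *\<^sub>R (LBINT r. indicator {0..} ((- k - (0 + (-1) * r)) / c) *\<^sub>R g (0 + (-1) * r))"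
    by (rule lborel_integral_real_affine) simp
  also have "\<dots> = (LBINT r. indicator {0..} (- ((k - r) / c)) *\<^sub>R g r)"
    using even by (simp add: minus_divide_left)
  finally have "(LBINT r. indicator {0..} ((k - r) / c) *\<^sub>R g r) + (LBINT r. indicator {0..} ((- k - r) / c) *\<^sub>R g r)
      = (LBINT r. indicator {0..} ((k - r) / c) *\<^sub>R g r + indicator {0..} (- ((k - r) / c)) *\<^sub>R g r)"
    by (simp add: i)
  also have "\<dots> = (LBINT r. g r)"
  proof (rule integral_cong_AE)
    show "AE r in lborel. indicator {0..} ((k - r) / c) *\<^sub>R g r + indicator {0..} (- ((k - r) / c)) *\<^sub>R g r = g r"
    proof (rule AE_mp[OF AE_lborel_singleton[of k]], intro AE_I2 impI)
      fix r assume "r \<noteq> k"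
      then have "(k - r) / c \<noteq> 0" using c by simp
      then show "indicator {0..} ((k - r) / c) *\<^sub>R g r + indicator {0..} (- ((k - r) / c)) *\<^sub>R g r = g r"
        by (auto simp: indicator_def)
    qed
  qed measurable
  finally show ?thesis unfolding limit_density_def by (simp flip: add_divide_distrib)
qed

text \<open>Only the even part of the limit density matters, and it is constant.\<close>

lemma evolved_density_weighted_tendsto:
  assumes even: "\<And>r. g (- r) = g r" and w: "integrable lborel w" "\<And>k. w (- k) = (w k :: real)"
  shows "((\<lambda>t. LBINT k. complex_of_real (w k) * evolved_density c g t k)
    \<longlongrightarrow> (LBINT r. g r) / (2 * \<bar>c\<bar>) * (LBINT k. w k)) at_top"
proof -
  let ?B = "(LBINT r. cmod (g r)) / \<bar>c\<bar>"
  have [measurable]: "w \<in> borel_measurable borel" using w by simp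
  have em: "evolved_density c g t \<in> borel_measurable borel" for t using evolved_density_integrable by auto
  have lm: "limit_density \<in> borel_measurable borel"
  proof (rule borel_measurable_LIMSEQ_metric[where f = "\<lambda>n. evolved_density c g (real n)"])
    show "(\<lambda>n. evolved_density c g (real n) k) \<longlonglongrightarrow> limit_density k" for k
      using filterlim_compose[OF evolved_density_tendsto filterlim_real_sequentially] .
  qed (rule em)
  have lB: "cmod (limit_density k) \<le> ?B" for k
    using tendsto_upperbound[OF tendsto_norm[OF evolved_density_tendsto]] evolved_density_bound by auto
  have iB: "integrable lborel (\<lambda>k. \<bar>w k\<bar> * ?B)" using w by simp
  let ?I = "LBINT k. complex_of_real (w k) * limit_density k"
  have i: "integrable lborel (\<lambda>k. complex_of_real (w k) * limit_density k)"
  proof (rule Bochner_Integration.integrable_bound[OF iB])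
    show "AE k in lborel. norm (complex_of_real (w k) * limit_density k) \<le> norm (\<bar>w k\<bar> * ?B)"
      using mult_left_mono[OF lB] by (intro AE_I2) (simp add: norm_mult)
  qed (use lm in measurable)
  have i': "integrable lborel (\<lambda>k. complex_of_real (w k) * limit_density (- k))"
    using lborel_integrable_real_affine[OF i, of "-1" 0] w by simp
  have "?I = \<bar>-1\<bar> *\<^sub>R (LBINT k. complex_of_real (w (0 + (-1) * k)) * limit_density (0 + (-1) * k))"
    by (rule lborel_integral_real_affine) simp
  \<comment> \<open>One copy of the integral is reflected; evenness of the weight then exposes the
    constant symmetric sum of the density.\<close>
  then have "?I + ?I = ?I + (LBINT k. complex_of_real (w k) * limit_density (- k))"
    using w by simp
  also have "\<dots> = (LBINT k. complex_of_real (w k) * (limit_density k + limit_density (- k)))"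
    using i i' by (simp add: distrib_left)
  also have "\<dots> = (LBINT r. g r) / \<bar>c\<bar> * (LBINT k. w k)"
    unfolding limit_density_symmetric[OF even] by simp
  finally have I: "?I = (LBINT r. g r) / (2 * \<bar>c\<bar>) * (LBINT k. w k)"
    using c by (simp add: field_simps)
  show ?thesis
    unfolding I[symmetric]
  proof (rule integral_dominated_convergence_at_top[OF _ _ iB])
    show "AE k in lborel. ((\<lambda>t. complex_of_real (w k) * evolved_density c g t k) \<longlongrightarrow> complex_of_real (w k) * limit_density k) at_top"
      by (intro AE_I2 tendsto_intros evolved_density_tendsto)
    show "\<forall>\<^sub>F t in at_top. AE k in lborel. norm (complex_of_real (w k) * evolved_density c g t k) \<le> \<bar>w k\<bar> * ?B"
      by (intro always_eventually allI AE_I2) (simp only: norm_mult norm_of_real mult_left_mono[OF evolved_density_bound] abs_ge_zero)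
  qed (use em lm in measurable)
qed

end

section \<open>Small scale asymptotics\<close>

lemma lborel_integrable_if_integrable_on:
  fixes f :: "real \<Rightarrow> real"
  assumes "f integrable_on S" "\<And>x. x \<in> S \<Longrightarrow> 0 \<le> f x" "f \<in> borel_measurable borel" "S \<in> sets borel"
  shows "integrable lborel (\<lambda>x. indicator S x * f x)"
proof -
  have "integrable lebesgue (\<lambda>x. indicator S x *\<^sub>R f x)"
    using nonnegative_absolutely_integrable_1[OF assms(1,2)] unfolding set_integrable_def .
  then show ?thesis
    using assms(3,4) by (subst (asm) integrable_completion) auto
qed

text \<open>Reduces integrability on the line to a majorant described on the half-line;
  \<open>G x + G (- x)\<close> dominates \<open>G\<close> at |x|.\<close>

lemma even_integrable:
  fixes f G :: "real \<Rightarrow> real"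
  assumes f: "f \<in> borel_measurable borel" and G: "integrable lborel G"
    and le: "\<And>x. \<bar>f x\<bar> \<le> G \<bar>x\<bar>" and G0: "\<And>x. 0 \<le> G x"
  shows "integrable lborel f"
proof (rule Bochner_Integration.integrable_bound)
  have "integrable lborel (\<lambda>x. G (0 + (-1) * x))"
    by (rule lborel_integrable_real_affine[OF G]) simp
  then show "integrable lborel (\<lambda>x. G x + G (- x))" using G by simp
  show "AE x in lborel. norm (f x) \<le> norm (G x + G (- x))"
    using le G0 by (intro AE_I2) (smt (verit) real_norm_def)
qed (use f in simp)

definition powr_majorant :: "real \<Rightarrow> real \<Rightarrow> real \<Rightarrow> real" where
  "powr_majorant p q x = indicator {0..1} x * x powr p + indicator {1..} x * x powr (- q)"

lemma powr_majorant_integrable: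
  assumes "p > -1" "q > 1"
  shows "integrable lborel (powr_majorant p q)"
  unfolding powr_majorant_def[abs_def]
proof (rule Bochner_Integration.integrable_add)
  show "integrable lborel (\<lambda>x::real. indicator {0..1} x * x powr p)"
    using has_integral_powr_from_0[OF assms(1), of 1]
    by (intro lborel_integrable_if_integrable_on) (auto simp: integrable_on_def)
  show "integrable lborel (\<lambda>x::real. indicator {1..} x * x powr (- q))"
    using has_integral_powr_to_inf[of "- q" 1] assms(2)
    by (intro lborel_integrable_if_integrable_on) (auto simp: integrable_on_def)
qed

text \<open>Up to a constant factor, the spectral density of the unit increment of a fractional
  Brownian motion of parameter \<open>H\<close>.\<close>

definition fbm_kernel :: "real \<Rightarrow> real \<Rightarrow> real" where
  "fbm_kernel H k = (cmod (cis (2 * pi * k) - 1))\<^sup>2 / \<bar>k\<bar> powr (2 * H + 1)"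

lemma cmod_cis_minus_1_sq: "(cmod (cis x - 1))\<^sup>2 = 2 - 2 * cos x"
  using sin_cos_squared_add[of x] unfolding cmod_power2 by (simp add: power2_diff)

lemma cmod_cis_minus_1_measurable [measurable]: "(\<lambda>k. (cmod (cis (2 * pi * k * l) - 1))\<^sup>2) \<in> borel_measurable borel"
  by (intro borel_measurable_continuous_onI continuous_intros)

lemma fbm_kernel_measurable [measurable]: "fbm_kernel H \<in> borel_measurable borel"
  using cmod_cis_minus_1_measurable[of 1] unfolding fbm_kernel_def[abs_def] by simp

text \<open>Near 0 the numerator is O(k^2), leaving the exponent 1 - 2 H > -1, which is where
  \<open>H < 1\<close> enters; at infinity it is bounded and 2 H + 1 > 1. The constant (2 pi)^2
  serves both regimes since it exceeds 4.\<close>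

lemma fbm_kernel_integrable:
  assumes "0 < H" "H < 1"
  shows "integrable lborel (fbm_kernel H)"
proof (rule even_integrable)
  let ?G = "\<lambda>x. (2 * pi)\<^sup>2 * powr_majorant (1 - 2 * H) (2 * H + 1) x"
  show "integrable lborel ?G"
    using assms by (intro integrable_mult_right powr_majorant_integrable) auto
  show "0 \<le> ?G x" for x by (simp add: powr_majorant_def)
  show "\<bar>fbm_kernel H x\<bar> \<le> ?G \<bar>x\<bar>" for x
  proof (cases "x = 0")
    case True
    then show ?thesis by (simp add: fbm_kernel_def powr_majorant_def)
  next
    case False
    let ?N = "(cmod (cis (2 * pi * x) - 1))\<^sup>2"
    have N1: "?N \<le> (2 * pi)\<^sup>2 * \<bar>x\<bar>\<^sup>2"
    proof -
      have "cmod (cis (2 * pi * x) - 1) \<le> \<bar>2 * pi * x\<bar>" using cis_diff_le[of "2 * pi * x" 0] by simp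
      then have "?N \<le> \<bar>2 * pi * x\<bar>\<^sup>2" by (intro power_mono) auto
      then show ?thesis by (simp add: power_mult_distrib)
    qed
    have N2: "?N \<le> (2 * pi)\<^sup>2"
    proof -
      have "?N \<le> 4" unfolding cmod_cis_minus_1_sq using cos_ge_minus_one[of "2 * pi * x"] by linarith
      also have "4 \<le> (2 * pi)\<^sup>2" using pi_gt3 power_mono[of 2 "2 * pi" 2] by simp
      finally show ?thesis .
    qed
    have k: "fbm_kernel H x = ?N * \<bar>x\<bar> powr (- (2 * H + 1))" "0 \<le> ?N"
      unfolding fbm_kernel_def powr_minus divide_inverse by simp_all
    show ?thesis
    proof (cases "\<bar>x\<bar> \<le> 1")
      case True
      have "?N * \<bar>x\<bar> powr (- (2 * H + 1)) \<le> ((2 * pi)\<^sup>2 * \<bar>x\<bar>\<^sup>2) * \<bar>x\<bar> powr (- (2 * H + 1))"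
        using N1 by (intro mult_right_mono) auto
      also have "\<bar>x\<bar>\<^sup>2 = \<bar>x\<bar> powr 2" using False by (simp add: powr_numeral)
      also have "(2 * pi)\<^sup>2 * \<bar>x\<bar> powr 2 * \<bar>x\<bar> powr (- (2 * H + 1)) = (2 * pi)\<^sup>2 * \<bar>x\<bar> powr (1 - 2 * H)"
        unfolding mult.assoc powr_add[symmetric] by (simp add: algebra_simps)
      also have "\<dots> \<le> ?G \<bar>x\<bar>"
        unfolding powr_majorant_def using True by (intro mult_left_mono) auto
      finally show ?thesis using k by simp
    next
      case False
      have "?N * \<bar>x\<bar> powr (- (2 * H + 1)) \<le> (2 * pi)\<^sup>2 * \<bar>x\<bar> powr (- (2 * H + 1))"
        using N2 by (intro mult_right_mono) auto
      also have "\<dots> \<le> ?G \<bar>x\<bar>"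
        unfolding powr_majorant_def using False by (intro mult_left_mono) auto
      finally show ?thesis using k by simp
    qed
  qed
qed measurable

text \<open>For k between 1/4 and 1/2 the cosine is at most 0, so the numerator is at least 2, and
  the denominator is at most 1. Positivity is needed because the asymptotic equivalence divides by
  this integral.\<close>

lemma fbm_kernel_integral_pos:
  assumes "0 < H" "H < 1"
  shows "0 < (LBINT k. fbm_kernel H k)"
proof -
  have "2 * indicator {1/4..1/2} k \<le> fbm_kernel H k" for k :: real
  proof (cases "k \<in> {1/4..1/2}")
    case True
    then have "cos (2 * pi * k) \<le> 0"
    proof -
      have "cos (2 * pi * k) \<le> cos (pi / 2)" using True pi_gt_zero by (intro cos_monotone_0_pi_le) (auto simp: field_simps)
      then show ?thesis by simp
    qed
    then have "2 \<le> (cmod (cis (2 * pi * k) - 1))\<^sup>2" unfolding cmod_cis_minus_1_sq by linarith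
    moreover have "\<bar>k\<bar> powr (2 * H + 1) \<le> 1" "0 < \<bar>k\<bar> powr (2 * H + 1)"
      using True assms by (auto intro: powr_le1)
    ultimately show ?thesis unfolding fbm_kernel_def using True
      by (simp add: pos_le_divide_eq)
  qed (simp add: fbm_kernel_def)
  then have "(LBINT k. 2 * indicator {1/4..1/2::real} k) \<le> (LBINT k. fbm_kernel H k)"
    by (intro integral_mono fbm_kernel_integrable assms integrable_mult_right integrable_real_indicator)
      (auto simp: emeasure_lborel_Icc_eq)
  then show ?thesis by simp
qed

section \<open>Weights built from a regularized absolute value at one fixed scale\<close>

locale regularized_modulus =
  fixes a :: "real \<Rightarrow> real"
  assumes a_cont: "continuous_on UNIV a" and a_pos: "\<And>k. 0 < a k" and a_even: "\<And>k. a k = a \<bar>k\<bar>"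
    and a_inf: "((\<lambda>k. a k / \<bar>k\<bar>) \<longlongrightarrow> 1) at_infinity"
begin

lemma a_measurable [measurable]: "a \<in> borel_measurable borel"
  by (rule borel_measurable_continuous_onI[OF a_cont])

text \<open>Far out the ratio to |k| exceeds 1/2; on the remaining compact interval the positive
  continuous function attains a positive minimum. The comparison with 1 + |k| controls small and
  large wavenumbers at once.\<close>

lemma a_lower_bound: "\<exists>m>0. \<forall>k. m * (1 + \<bar>k\<bar>) \<le> a k"
proof -
  have "\<forall>\<^sub>F k in at_infinity. 1 / 2 < a k / \<bar>k\<bar>"
    using a_inf by (rule order_tendstoD) simp
  then obtain R0 where R0: "\<And>k. R0 \<le> \<bar>k\<bar> \<Longrightarrow> 1 / 2 < a k / \<bar>k\<bar>"
    by (auto simp: eventually_at_infinity)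
  define R where "R = max R0 1"
  have "\<exists>x\<in>{-R..R}. \<forall>y\<in>{-R..R}. a x \<le> a y"
    by (rule continuous_attains_inf) (auto simp: R_def intro: continuous_on_subset[OF a_cont])
  then obtain x where x: "\<forall>y\<in>{-R..R}. a x \<le> a y" by blast
  obtain \<delta> where \<delta>: "\<delta> > 0" "\<And>k. \<bar>k\<bar> \<le> R \<Longrightarrow> \<delta> \<le> a k"
  proof (rule that)
    show "a x > 0" by (rule a_pos)
    show "a x \<le> a k" if "\<bar>k\<bar> \<le> R" for k using x that by (auto simp: abs_le_iff)
  qed
  \<comment> \<open>The quarter is for |k| > R \<ge> 1, where 1 + |k| \<le> 2 |k| and a k > |k|/2;
    the other entry is for |k| \<le> R.\<close>
  define m where "m = min (1/4) (\<delta> / (1 + R))"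
  have R1: "1 \<le> R" unfolding R_def by simp
  have "m > 0" unfolding m_def using \<delta> R1 by simp
  moreover have "m * (1 + \<bar>k\<bar>) \<le> a k" for k
  proof (cases "\<bar>k\<bar> \<le> R")
    case True
    have "m * (1 + \<bar>k\<bar>) \<le> \<delta> / (1 + R) * (1 + R)"
      using True R1 \<delta> \<open>m > 0\<close> by (intro mult_mono) (auto simp: m_def)
    then show ?thesis using \<delta>(2)[OF True] R1 by simp
  next
    case False
    then have k: "1 < \<bar>k\<bar>" "1 / 2 < a k / \<bar>k\<bar>" using R0[of k] unfolding R_def by auto
    have "m \<le> 1/4" unfolding m_def by (rule min.cobounded1)
    then have "m * (1 + \<bar>k\<bar>) \<le> 1/4 * (1 + \<bar>k\<bar>)" by (intro mult_right_mono) auto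
    also have "\<dots> \<le> 1/4 * (2 * \<bar>k\<bar>)" using k(1) by simp
    also have "\<dots> \<le> a k"
      using k(2) pos_less_divide_eq[of "\<bar>k\<bar>" "1/2" "a k"] k(1) by auto
    finally show ?thesis .
  qed
  ultimately show ?thesis by blast
qed

text \<open>With exponent \<open>H + 1/2\<close> this makes the symbol of \<open>v\<close> bounded,
  so that the spectral integral is defined and has finite variance at every finite time.\<close>

lemma weight_bounded:
  assumes "q > 0"
  shows "\<exists>B. \<forall>k. 1 / a k powr q \<le> B"
proof -
  obtain m where m: "m > 0" "\<And>k. m * (1 + \<bar>k\<bar>) \<le> a k" using a_lower_bound by blast
  have "1 / a k powr q \<le> 1 / m powr q" for k
  proof -
    have "m * 1 \<le> m * (1 + \<bar>k\<bar>)" using m(1) by (intro mult_left_mono) auto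
    then have "m \<le> a k" using m(2)[of k] by linarith
    then show ?thesis using m(1) assms by (intro divide_left_mono powr_mono2) (auto intro: mult_pos_pos)
  qed
  then show ?thesis by blast
qed

text \<open>With exponent \<open>2 * H + 1\<close> this is the finiteness of the limiting
  variance.\<close>

lemma weight_integrable:
  assumes "q > 1"
  shows "integrable lborel (\<lambda>k. 1 / a k powr q)"
proof -
  obtain m where m: "m > 0" "\<And>k. m * (1 + \<bar>k\<bar>) \<le> a k" using a_lower_bound by blast
  let ?G = "\<lambda>x. 1 / m powr q * (indicator {0..1} x + powr_majorant 0 q x)"
  show ?thesis
  proof (rule even_integrable)
    show "integrable lborel ?G"
      using assms by (intro integrable_mult_right Bochner_Integration.integrable_add powr_majorant_integrable integrable_real_indicator)
        (auto simp: emeasure_lborel_Icc_eq)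
    show "0 \<le> ?G x" for x by (simp add: powr_majorant_def)
    show "\<bar>1 / a x powr q\<bar> \<le> ?G \<bar>x\<bar>" for x
    proof -
      have "1 / a x powr q \<le> 1 / (m * (1 + \<bar>x\<bar>)) powr q"
        using m a_pos[of x] assms by (intro divide_left_mono powr_mono2 mult_pos_pos) auto
      also have "\<dots> = 1 / m powr q * (1 / (1 + \<bar>x\<bar>) powr q)"
        using m(1) by (simp add: powr_mult)
      also have "\<dots> \<le> ?G \<bar>x\<bar>"
      proof (rule mult_left_mono)
        show "1 / (1 + \<bar>x\<bar>) powr q \<le> indicator {0..1} \<bar>x\<bar> + powr_majorant 0 q \<bar>x\<bar>"
        proof (cases "\<bar>x\<bar> \<le> 1")
          case True
          have "1 \<le> (1 + \<bar>x\<bar>) powr q" using assms by (intro ge_one_powr_ge_zero) auto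
          then have "1 / (1 + \<bar>x\<bar>) powr q \<le> 1" by simp
          then show ?thesis using True by (simp add: powr_majorant_def add_increasing2)
        next
          case False
          then have "1 / (1 + \<bar>x\<bar>) powr q \<le> 1 / \<bar>x\<bar> powr q"
            using assms by (intro divide_left_mono powr_mono2 mult_pos_pos) auto
          then show ?thesis using False by (simp add: powr_majorant_def powr_minus divide_inverse)
        qed
      qed simp
      finally show ?thesis by simp
    qed
  qed measurable
qed

lemma increment_weight_integrable:
  assumes "q > 1"
  shows "integrable lborel (\<lambda>k. (cmod (cis (2 * pi * k * l) - 1))\<^sup>2 / a k powr q)"
proof (rule Bochner_Integration.integrable_bound[OF integrable_mult_right[OF weight_integrable[OF assms], of 4]])
  show "AE k in lborel. norm ((cmod (cis (2 * pi * k * l) - 1))\<^sup>2 / a k powr q) \<le> norm (4 * (1 / a k powr q))"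
  proof (rule AE_I2)
    fix k
    have "(cmod (cis (2 * pi * k * l) - 1))\<^sup>2 \<le> 4"
      unfolding cmod_cis_minus_1_sq using cos_ge_minus_one[of "2 * pi * k * l"] by linarith
    then show "norm ((cmod (cis (2 * pi * k * l) - 1))\<^sup>2 / a k powr q) \<le> norm (4 * (1 / a k powr q))"
      by (simp add: divide_right_mono)
  qed
qed measurable

text \<open>Substituting k/|l| for k frees the numerator from \<open>l\<close>. The Jacobian and the
  normalization combine to |l| to the power -(2 H + 1), which moves inside the denominator.\<close>

lemma increment_scaling:
  assumes "l \<noteq> 0"
  shows "(LBINT k. (cmod (cis (2 * pi * k * l) - 1))\<^sup>2 / a k powr (2 * H + 1)) / \<bar>l\<bar> powr (2 * H)
       = (LBINT k. (cmod (cis (2 * pi * k) - 1))\<^sup>2 / (\<bar>l\<bar> * a (k / \<bar>l\<bar>)) powr (2 * H + 1))"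
proof -
  let ?q = "2 * H + 1"
  let ?f = "\<lambda>k. (cmod (cis (2 * pi * k * l) - 1))\<^sup>2 / a k powr ?q"
  have "(LBINT k. ?f k) = \<bar>1 / \<bar>l\<bar>\<bar> *\<^sub>R (LBINT k. ?f (0 + 1 / \<bar>l\<bar> * k))"
    by (rule lborel_integral_real_affine) (use assms in simp)
  then have "(LBINT k. ?f k) = 1 / \<bar>l\<bar> * (LBINT k. ?f (k / \<bar>l\<bar>))" by simp
  moreover have "1 / \<bar>l\<bar> * I / \<bar>l\<bar> powr (2 * H) = I / \<bar>l\<bar> powr ?q" for I
    using assms by (simp add: powr_add)
  ultimately have "(LBINT k. ?f k) / \<bar>l\<bar> powr (2 * H) = (LBINT k. ?f (k / \<bar>l\<bar>)) / \<bar>l\<bar> powr ?q"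
    by simp
  also have "\<dots> = (LBINT k. ?f (k / \<bar>l\<bar>) / \<bar>l\<bar> powr ?q)"
    by (rule integral_divide_zero[symmetric])
  also have "\<dots> = (LBINT k. (cmod (cis (2 * pi * k) - 1))\<^sup>2 / (\<bar>l\<bar> * a (k / \<bar>l\<bar>)) powr ?q)"
  proof (intro Bochner_Integration.integral_cong refl)
    fix k
    \<comment> \<open>The sign of \<open>l\<close> disappears because the cosine is even.\<close>
    have "cos (2 * pi * (k / \<bar>l\<bar>) * l) = cos (2 * pi * k)"
      using assms by (cases "l > 0") auto
    then show "?f (k / \<bar>l\<bar>) / \<bar>l\<bar> powr ?q = (cmod (cis (2 * pi * k) - 1))\<^sup>2 / (\<bar>l\<bar> * a (k / \<bar>l\<bar>)) powr ?q"
      unfolding cmod_cis_minus_1_sq using a_pos[of "k / \<bar>l\<bar>"] by (simp add: powr_mult mult.commute)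
  qed
  finally show ?thesis .
qed

text \<open>As \<open>l\<close> tends to 0, |l| a(k/|l|) tends to |k| for each k \<noteq> 0, because
  only the behaviour of \<open>a\<close> at infinity is sampled. This is why the form of the
  regularization at small wavenumbers leaves no trace.\<close>

lemma increment_asymptotics:
  assumes "0 < H" "H < 1"
  shows "((\<lambda>l. (LBINT k. (cmod (cis (2 * pi * k * l) - 1))\<^sup>2 / a k powr (2 * H + 1)) / \<bar>l\<bar> powr (2 * H))
    \<longlongrightarrow> (LBINT k. fbm_kernel H k)) (at 0)"
  unfolding tendsto_at_iff_sequentially comp_def
proof (intro allI impI)
  fix X :: "nat \<Rightarrow> real" assume X0: "\<forall>i. X i \<in> UNIV - {0}" and X: "X \<longlonglongrightarrow> 0"
  let ?q = "2 * H + 1"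
  have ne: "X n \<noteq> 0" for n using X0 by auto
  obtain m where m: "m > 0" "\<And>k. m * (1 + \<bar>k\<bar>) \<le> a k" using a_lower_bound by blast
  show "(\<lambda>n. (LBINT k. (cmod (cis (2 * pi * k * X n) - 1))\<^sup>2 / a k powr ?q) / \<bar>X n\<bar> powr (2 * H))
      \<longlonglongrightarrow> (LBINT k. fbm_kernel H k)"
    unfolding increment_scaling[OF ne]
  proof (rule integral_dominated_convergence[where w = "\<lambda>k. 1 / m powr ?q * fbm_kernel H k"])
    show "(\<lambda>k. (cmod (cis (2 * pi * k) - 1))\<^sup>2 / (\<bar>X n\<bar> * a (k / \<bar>X n\<bar>)) powr ?q) \<in> borel_measurable lborel" for n
      using cmod_cis_minus_1_measurable[of 1] by simp
    show "integrable lborel (\<lambda>k. 1 / m powr ?q * fbm_kernel H k)"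
      by (intro integrable_mult_right fbm_kernel_integrable assms)
    show "AE k in lborel. (\<lambda>n. (cmod (cis (2 * pi * k) - 1))\<^sup>2 / (\<bar>X n\<bar> * a (k / \<bar>X n\<bar>)) powr ?q) \<longlonglongrightarrow> fbm_kernel H k"
    proof (rule AE_mp[OF AE_lborel_singleton[of 0]], intro AE_I2 impI)
      fix k :: real assume k: "k \<noteq> 0"
      have "filterlim (\<lambda>n. k / \<bar>X n\<bar>) at_infinity sequentially"
      proof -
        have "(\<lambda>n. \<bar>X n\<bar>) \<longlonglongrightarrow> 0" using tendsto_rabs[OF X] by simp
        then have "filterlim (\<lambda>n. \<bar>X n\<bar>) (at 0) sequentially"
          using ne by (simp add: filterlim_at)
        from tendsto_mult_filterlim_at_infinity[OF tendsto_const[of k] k filterlim_compose[OF filterlim_inverse_at_infinity this]]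
        show ?thesis by (simp add: divide_inverse)
      qed
      from filterlim_compose[OF a_inf this]
      have "(\<lambda>n. \<bar>k\<bar> * (a (k / \<bar>X n\<bar>) / \<bar>k / \<bar>X n\<bar>\<bar>)) \<longlonglongrightarrow> \<bar>k\<bar> * 1" by (intro tendsto_intros)
      moreover have "\<bar>k\<bar> * (a (k / \<bar>X n\<bar>) / \<bar>k / \<bar>X n\<bar>\<bar>) = \<bar>X n\<bar> * a (k / \<bar>X n\<bar>)" for n
        using k ne[of n] by simp
      ultimately have "(\<lambda>n. \<bar>X n\<bar> * a (k / \<bar>X n\<bar>)) \<longlonglongrightarrow> \<bar>k\<bar>" by simp
      then show "(\<lambda>n. (cmod (cis (2 * pi * k) - 1))\<^sup>2 / (\<bar>X n\<bar> * a (k / \<bar>X n\<bar>)) powr ?q) \<longlonglongrightarrow> fbm_kernel H k"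
        unfolding fbm_kernel_def using k by (intro tendsto_intros) auto
    qed
    show "AE k in lborel. norm ((cmod (cis (2 * pi * k) - 1))\<^sup>2 / (\<bar>X n\<bar> * a (k / \<bar>X n\<bar>)) powr ?q)
        \<le> 1 / m powr ?q * fbm_kernel H k" for n
    proof (rule AE_mp[OF AE_lborel_singleton[of 0]], intro AE_I2 impI)
      fix k :: real assume k: "k \<noteq> 0"
      \<comment> \<open>The lower bound on \<open>a\<close> scales well: dropping its constant part
        leaves a majorant proportional to the limiting kernel and free of \<open>n\<close>.\<close>
      have "m * \<bar>k\<bar> \<le> \<bar>X n\<bar> * (m * (1 + \<bar>k / \<bar>X n\<bar>\<bar>))"
        using ne[of n] m(1) by (simp add: algebra_simps)
      also have "\<dots> \<le> \<bar>X n\<bar> * a (k / \<bar>X n\<bar>)" by (intro mult_left_mono m) simp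
      finally have "m * \<bar>k\<bar> \<le> \<bar>X n\<bar> * a (k / \<bar>X n\<bar>)" .
      moreover have "0 < m * \<bar>k\<bar>" using m(1) k by simp
      ultimately have "(m * \<bar>k\<bar>) powr ?q \<le> (\<bar>X n\<bar> * a (k / \<bar>X n\<bar>)) powr ?q" "0 < (m * \<bar>k\<bar>) powr ?q"
        using assms by (auto intro: powr_mono2)
      then have "(cmod (cis (2 * pi * k) - 1))\<^sup>2 / (\<bar>X n\<bar> * a (k / \<bar>X n\<bar>)) powr ?q
          \<le> (cmod (cis (2 * pi * k) - 1))\<^sup>2 / (m * \<bar>k\<bar>) powr ?q"
        by (intro divide_left_mono mult_pos_pos) auto
      also have "\<dots> = 1 / m powr ?q * fbm_kernel H k"
        unfolding fbm_kernel_def using m(1) by (simp add: powr_mult)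
      finally show "norm ((cmod (cis (2 * pi * k) - 1))\<^sup>2 / (\<bar>X n\<bar> * a (k / \<bar>X n\<bar>)) powr ?q)
        \<le> 1 / m powr ?q * fbm_kernel H k" by simp
    qed
  qed measurable
qed

end

text \<open>Positive definiteness at the two points 0 and \<open>z0\<close>, with coefficients 1 and
  the opposite of the sign of \<open>C z0\<close>, gives |C z0| \<le> C 0.\<close>

lemma spatial_covariance_0_pos:
  assumes "spatial_covariance C"
  shows "0 < C 0"
proof -
  have even: "C (- z) = C z" for z using assms unfolding spatial_covariance_def by blast
  have pd: "0 \<le> Re (\<Sum>x\<in>X. \<Sum>y\<in>X. z x * cnj (z y) * complex_of_real (C (x - y)))"
    if "finite X" for X and z :: "real \<Rightarrow> complex"
    using assms that unfolding spatial_covariance_def by blast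
  obtain z0 where z0: "C z0 \<noteq> 0" using assms unfolding spatial_covariance_def by blast
  show ?thesis
  proof (cases "z0 = 0")
    case True
    then show ?thesis using pd[of "{0}" "\<lambda>_. 1"] z0 by simp
  next
    case False
    define s where "s = - sgn (C z0)"
    have "0 \<le> C 0 + s * C z0 + (s * C z0 + s * s * C 0)"
      using pd[of "{0, z0}" "\<lambda>x. if x = 0 then 1 else complex_of_real s"] False even[of z0] by simp
    moreover have "s * s = 1" "s * C z0 = - \<bar>C z0\<bar>" using z0 unfolding s_def by (auto simp: sgn_if)
    ultimately have "\<bar>C z0\<bar> \<le> C 0" by simp
    then show ?thesis using z0 by linarith
  qed
qed

section \<open>The forced field\<close>

locale forced_field = prob_space M for M :: "'w measure" +
  fixes F :: "(real \<Rightarrow> complex) \<Rightarrow> real \<Rightarrow> 'w \<Rightarrow> complex" and C :: "real \<Rightarrow> real" and c :: real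
    and u :: "real \<Rightarrow> real \<Rightarrow> 'w \<Rightarrow> complex"
  assumes c: "c \<noteq> 0" and C: "spatial_covariance C" and F: "white_in_time_forcing M C F"
    and sol: "forced_solution M c F u"
begin

text \<open>The spatial spectral density of the forcing.\<close>

definition "g = fourier (\<lambda>x. complex_of_real (C x))"

abbreviation "dens \<equiv> evolved_density c g"

lemma C_schwartz: "schwartz (\<lambda>x. complex_of_real (C x))"
  using C unfolding spatial_covariance_def by (intro schwartz_of_real) blast

lemma g_integrable: "integrable lborel g"
  unfolding g_def by (rule schwartz_integrable[OF C_schwartz])

lemma g_inversion: "(LBINT k. cis (2 * pi * k * z) * g k) = complex_of_real (C z)"
  unfolding g_def by (rule schwartz_fourier_inversion[OF C_schwartz, symmetric])

lemma g_even: "g (- r) = g r"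
proof -
  have "g (- r) = \<bar>-1\<bar> *\<^sub>R (LBINT k. cis (- (2 * pi * (0 + (-1) * k) * (- r))) * complex_of_real (C (0 + (-1) * k)))"
    unfolding g_def fourier_def by (rule lborel_integral_real_affine) simp
  also have "\<dots> = g r"
    using C unfolding g_def fourier_def spatial_covariance_def by simp
  finally show ?thesis .
qed

lemma u_sq_integrable: "0 \<le> t \<Longrightarrow> sq_integrable M (u t x)"
  using sol unfolding forced_solution_def by blast

definition kern :: "real \<Rightarrow> real \<Rightarrow> real \<Rightarrow> complex" where
  "kern t x = (\<lambda>s. indicator {0..t} s * cis (2 * pi * c * x * (t - s)))"

lemma kern_time_test: "time_test (kern t x)"
  unfolding kern_def by (rule time_test_indicator_cis)

lemma u_AE: "0 \<le> t \<Longrightarrow> AE \<omega> in M. u t x \<omega> = F (kern t x) x \<omega>"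
  using forced_solution_eq_duhamel[OF F sol] unfolding duhamel_def kern_def by blast

lemma F_kern_sq_integrable: "sq_integrable M (F (kern t x) x)"
  by (rule forcing_sq_integrable[OF F kern_time_test])

text \<open>The Duhamel phase at \<open>x\<close> times the conjugate of that at \<open>y\<close> is
  the phase at \<open>x - y\<close>: although the equation has a coefficient depending on
  \<open>x\<close>, the solution stays homogeneous.\<close>

lemma u_cov:
  assumes "0 \<le> t"
  shows "L2_inner M (u t x) (u t y) = (LBINT k. cis (2 * pi * k * (x - y)) * dens t k)"
proof -
  have "L2_inner M (u t x) (u t y) = (L2_inner M (F (kern t x) x) (F (kern t y) y))"
  proof (rule integral_cong_AE)
    show "AE \<omega> in M. u t x \<omega> * cnj (u t y \<omega>) = F (kern t x) x \<omega> * cnj (F (kern t y) y \<omega>)"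
      using u_AE[OF assms, of x] u_AE[OF assms, of y] by eventually_elim simp
  qed (intro borel_measurable_integrable sq_integrable_mult_cnj u_sq_integrable F_kern_sq_integrable assms)+
  also have "\<dots> = (LBINT s:{0..}. kern t x s * cnj (kern t y s)) * complex_of_real (C (x - y))"
    by (rule forcing_cov[OF F kern_time_test kern_time_test])
  also have "(LBINT s:{0..}. kern t x s * cnj (kern t y s))
      = (LBINT s:{0..t}. cis (2 * pi * c * x * (t - s)) * cnj (kern t y s))"
    unfolding kern_def by (rule set_integral_half_line_indicator)
  also have "\<dots> = (LBINT s:{0..t}. cis (2 * pi * c * (x - y) * (t - s)))"
    unfolding set_lebesgue_integral_def kern_def
    by (intro Bochner_Integration.integral_cong refl)
      (auto simp: indicator_def cis_cnj cis_mult algebra_simps)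
  finally show ?thesis
    unfolding evolved_density_fourier[OF c g_integrable] g_inversion by simp
qed

lemma spectral: "0 \<le> t \<Longrightarrow> spectral_field M (u t) (dens t)"
  by unfold_locales (auto intro: u_sq_integrable evolved_density_integrable[OF c g_integrable] u_cov)

lemma u_pseudo_cov:
  assumes "0 \<le> t"
  shows "(LINT \<omega>|M. u t x \<omega> * u t y \<omega>) = 0"
proof -
  have "(LINT \<omega>|M. u t x \<omega> * u t y \<omega>) = (LINT \<omega>|M. F (kern t x) x \<omega> * F (kern t y) y \<omega>)"
  proof (rule integral_cong_AE)
    show "AE \<omega> in M. u t x \<omega> * u t y \<omega> = F (kern t x) x \<omega> * F (kern t y) y \<omega>"
      using u_AE[OF assms, of x] u_AE[OF assms, of y] by eventually_elim simp
  qed (use u_sq_integrable[OF assms] F_kern_sq_integrable in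
      \<open>auto simp: sq_integrable_def intro!: borel_measurable_times\<close>)
  then show ?thesis using forcing_pseudo_cov[OF F kern_time_test kern_time_test] by simp
qed

abbreviation "forcing_index \<equiv> {g. time_test g} \<times> (UNIV :: real set)"

lemma forcing_family:
  shows "gaussian_family M forcing_index (\<lambda>(g, x). F g x)"
    and "i \<in> forcing_index \<Longrightarrow> sq_integrable M ((\<lambda>(g, x). F g x) i)"
    and "i \<in> forcing_index \<Longrightarrow> (LINT \<omega>|M. (\<lambda>(g, x). F g x) i \<omega>) = 0"
proof -
  show "gaussian_family M forcing_index (\<lambda>(g, x). F g x)"
    by (rule F[unfolded white_in_time_forcing_def, THEN conjunct1])
qed (auto intro: forcing_sq_integrable[OF F] forcing_mean[OF F])

text \<open>The solution equals a stochastic integral only almost surely; a constant sequence in the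
  closure property of the span bridges the null set.\<close>

lemma u_L2_span:
  assumes "0 \<le> t"
  shows "u t x \<in> L2_span M forcing_index (\<lambda>(g, x). F g x)"
proof (rule L2_span_limit[where V = "\<lambda>_. F (kern t x) x"])
  show "F (kern t x) x \<in> L2_span M forcing_index (\<lambda>(g, x). F g x)"
    using L2_span_base[of "(kern t x, x)" forcing_index M "\<lambda>(g, x). F g x"] kern_time_test F_kern_sq_integrable by simp
  have "(L2_dist_sq M (F (kern t x) x) (u t x)) = (LINT \<omega>|M. 0)"
    using u_AE[OF assms, of x] F_kern_sq_integrable[of t x] u_sq_integrable[OF assms, of x]
    unfolding sq_integrable_def by (intro integral_cong_AE) auto
  then show "(\<lambda>n. L2_dist_sq M (F (kern t x) x) (u t x)) \<longlonglongrightarrow> 0" by simp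
qed (use assms u_sq_integrable forcing_family(2) in auto)

text \<open>Stated for a symbol fixed in time with arbitrary even weight, so as to serve both the
  field and its increments. The constant arises because \<open>g\<close> integrates to
  \<open>C 0\<close>, by inversion at the origin.\<close>

lemma variance_tendsto:
  assumes V: "\<And>t. 0 \<le> t \<Longrightarrow> spectral_field.spec M (u t) (V t) \<psi>"
    and w: "\<And>k. (cmod (\<psi> k))\<^sup>2 = w k" "integrable lborel w" "\<And>k. w (- k) = w k"
  shows "((\<lambda>t. L2_norm_sq M (V t)) \<longlongrightarrow> C 0 / (2 * \<bar>c\<bar>) * (LBINT k. w k)) at_top"
proof -
  have "((\<lambda>t. LBINT k. complex_of_real (w k) * dens t k)
      \<longlongrightarrow> (LBINT r. g r) / (2 * \<bar>c\<bar>) * (LBINT k. w k)) at_top"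
    by (rule evolved_density_weighted_tendsto[OF c g_integrable g_even w(2,3)])
  then have "((\<lambda>t. complex_of_real (L2_norm_sq M (V t)))
      \<longlongrightarrow> (LBINT r. g r) / (2 * \<bar>c\<bar>) * (LBINT k. w k)) at_top"
  proof (rule Lim_transform_eventually)
    show "\<forall>\<^sub>F t in at_top. (LBINT k. complex_of_real (w k) * dens t k) = complex_of_real (L2_norm_sq M (V t))"
      using eventually_ge_at_top[of 0]
      by eventually_elim (simp only: spectral_field.spec_norm_sq[OF spectral V] w(1))
  qed
  moreover have "(LBINT r. g r) = complex_of_real (C 0)" using g_inversion[of 0] by simp
  ultimately have "((\<lambda>t. complex_of_real (L2_norm_sq M (V t)))
      \<longlongrightarrow> complex_of_real (C 0 / (2 * \<bar>c\<bar>) * (LBINT k. w k))) at_top" by simp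
  then show ?thesis by (simp only: tendsto_of_real_iff)
qed

end

theorem proposition2:
  fixes M :: "'w measure"
    and F :: "(real \<Rightarrow> complex) \<Rightarrow> real \<Rightarrow> 'w \<Rightarrow> complex"
    and C :: "real \<Rightarrow> real"
    and A :: "real \<Rightarrow> real \<Rightarrow> real"
    and u\<^sub>0 :: "real \<Rightarrow> real \<Rightarrow> 'w \<Rightarrow> complex"
    and c L H :: real
  assumes "prob_space M"
    and "c \<noteq> 0" and "L > 0" and "H > 0"
    and "spatial_covariance C"
    and "white_in_time_forcing M C F"
    and "regularized_abs A"
    and "forced_solution M c F u\<^sub>0"
  shows
    "(\<forall>t\<ge>0. \<forall>x. AE \<omega> in M. u\<^sub>0 t x \<omega> = duhamel c F t x \<omega>) \<and>
     (\<exists>v. is_P M A L H u\<^sub>0 v) \<and>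
     (\<forall>v. is_P M A L H u\<^sub>0 v \<longrightarrow>
        gaussian_family M ({0..} \<times> UNIV) (\<lambda>(t, x). v t x) \<and>
        (\<forall>t\<ge>0. \<forall>x. (LINT \<omega>|M. v t x \<omega>) = 0) \<and>
        (\<exists>R. \<forall>t\<ge>0. \<forall>x y. (LINT \<omega>|M. v t x \<omega> * cnj (v t y \<omega>)) = R t (x - y)) \<and>
        (\<forall>t\<ge>0. \<forall>x y. (LINT \<omega>|M. v t x \<omega> * v t y \<omega>) = 0) \<and>
        (\<forall>t\<ge>0. \<forall>x. sq_integrable M (v t x)) \<and>
        integrable lborel (\<lambda>k. 1 / A (1 / L) k powr (2 * H + 1)) \<and>
        (\<forall>x. ((\<lambda>t. LINT \<omega>|M. (cmod (v t x \<omega>))\<^sup>2) \<longlongrightarrow>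
               C 0 / (2 * \<bar>c\<bar>) * (LINT k|lborel. 1 / A (1 / L) k powr (2 * H + 1))) at_top) \<and>
        (\<forall>t\<ge>0. \<forall>l x. has_spectral_integral M (u\<^sub>0 t)
           (\<lambda>k. cis (2 * pi * k * x) * (cis (2 * pi * k * l) - 1)
                  * complex_of_real (1 / A (1 / L) k powr (H + 1/2)))
           (\<lambda>\<omega>. v t (x + l) \<omega> - v t x \<omega>)) \<and>
        (H < 1 \<longrightarrow>
          (\<exists>\<Lambda>.
            (\<forall>l x. ((\<lambda>t. LINT \<omega>|M. (cmod (v t (x + l) \<omega> - v t x \<omega>))\<^sup>2) \<longlongrightarrow> \<Lambda> l) at_top) \<and>
            ((\<lambda>l. \<Lambda> l / (\<bar>l\<bar> powr (2 * H) * (C 0 / (2 * \<bar>c\<bar>)) *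
                (LINT k|lborel. (cmod (cis (2 * pi * k) - 1))\<^sup>2 / \<bar>k\<bar> powr (2 * H + 1))))
              \<longlongrightarrow> 1) (at 0))))"
proof -
  interpret forced_field M F C c u\<^sub>0
    using assms by (simp add: forced_field_def forced_field_axioms_def)
  define a where "a = A (1 / L)"
  have "0 < 1 / L" using assms(3) by simp
  then have reg: "smooth a" "\<And>k. 0 < a k" "\<And>k. a k = a \<bar>k\<bar>" "((\<lambda>k. a k / \<bar>k\<bar>) \<longlongrightarrow> 1) at_infinity"
    using assms(7) unfolding regularized_abs_def a_def by blast+
  interpret regularized_modulus a
    using reg smooth_imp_continuous[OF reg(1), of 0] by unfold_locales (auto simp: iter_deriv_def)
  have H: "0 < H + 1 / 2" "1 < 2 * H + 1" using assms(4) by auto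
  define \<psi> where "\<psi> x k = cis (2 * pi * k * x) * complex_of_real (1 / a k powr (H + 1/2))" for x k
  define \<delta>\<psi> where "\<delta>\<psi> x l k = cis (2 * pi * k * x) * (cis (2 * pi * k * l) - 1) * complex_of_real (1 / a k powr (H + 1/2))" for x l k
  define w where "w k = 1 / a k powr (2 * H + 1)" for k
  define wl where "wl l k = (cmod (cis (2 * pi * k * l) - 1))\<^sup>2 / a k powr (2 * H + 1)" for l k
  obtain B where B: "\<And>k. 1 / a k powr (H + 1/2) \<le> B" using weight_bounded[OF H(1)] by blast
  have c\<psi>: "continuous_on UNIV (\<psi> x)" for x
    unfolding \<psi>_def using a_pos
    by (intro continuous_intros a_cont) (auto simp: less_imp_neq[symmetric])
  have b\<psi>: "cmod (\<psi> x k) \<le> B" for x k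
    unfolding \<psi>_def using B[of k] by (simp add: norm_mult norm_divide)
  have w_sq: "(1 / a k powr (H + 1/2))\<^sup>2 = w k" for k
    unfolding w_def by (simp add: power2_eq_square flip: powr_add)
  have \<psi>_sq: "(cmod (\<psi> x k))\<^sup>2 = w k" for x k
    unfolding \<psi>_def norm_mult norm_of_real power_mult_distrib power2_abs w_sq by simp
  \<comment> \<open>Translating the field multiplies the symbol by a phase; linearity of
    \<open>spec\<close> then yields the representation of the increment.\<close>
  have \<delta>\<psi>_eq: "\<psi> (x + l) k - \<psi> x k = \<delta>\<psi> x l k" for x l k
    unfolding \<psi>_def \<delta>\<psi>_def by (simp add: cis_mult[symmetric] distrib_left left_diff_distrib right_diff_distrib diff_divide_distrib)
  have \<delta>\<psi>_sq: "(cmod (\<delta>\<psi> x l k))\<^sup>2 = wl l k" for x l k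
    unfolding \<delta>\<psi>_def norm_mult norm_of_real power_mult_distrib power2_abs w_sq
    by (simp add: wl_def w_def)
  have P: "is_P M A L H u\<^sub>0 v \<longleftrightarrow> (\<forall>t\<ge>0. \<forall>x. has_spectral_integral M (u\<^sub>0 t) (\<psi> x) (v t x))" for v
    unfolding is_P_def \<psi>_def a_def ..
  have ex: "\<exists>v. is_P M A L H u\<^sub>0 v"
    unfolding P
  proof (intro exI allI impI)
    fix t x :: real assume "0 \<le> t"
    from spectral_field.has_spectral_integral_exists[OF spectral[OF this] c\<psi> b\<psi>]
    \<comment> \<open>The values are chosen separately for each \<open>t\<close> and
      \<open>x\<close>; \<open>is_P\<close> ties them together only through their symbols.\<close>
    show "has_spectral_integral M (u\<^sub>0 t) (\<psi> x) (SOME V. has_spectral_integral M (u\<^sub>0 t) (\<psi> x) V)"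
      by (rule someI_ex)
  qed
  have duhamel: "\<forall>t\<ge>0. \<forall>x. AE \<omega> in M. u\<^sub>0 t x \<omega> = duhamel c F t x \<omega>"
    using forced_solution_eq_duhamel[OF F sol] by blast
  have main: "gaussian_family M ({0..} \<times> UNIV) (\<lambda>(t, x). v t x) \<and>
      (\<forall>t\<ge>0. \<forall>x. (LINT \<omega>|M. v t x \<omega>) = 0) \<and>
      (\<exists>R. \<forall>t\<ge>0. \<forall>x y. (L2_inner M (v t x) (v t y)) = R t (x - y)) \<and>
      (\<forall>t\<ge>0. \<forall>x y. (LINT \<omega>|M. v t x \<omega> * v t y \<omega>) = 0) \<and>
      (\<forall>t\<ge>0. \<forall>x. sq_integrable M (v t x)) \<and>
      integrable lborel w \<and>
      (\<forall>x. ((\<lambda>t. L2_norm_sq M (v t x)) \<longlongrightarrow> C 0 / (2 * \<bar>c\<bar>) * (LBINT k. w k)) at_top) \<and>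
      (\<forall>t\<ge>0. \<forall>l x. has_spectral_integral M (u\<^sub>0 t) (\<delta>\<psi> x l) (\<lambda>\<omega>. v t (x + l) \<omega> - v t x \<omega>)) \<and>
      (H < 1 \<longrightarrow>
        (\<exists>\<Lambda>.
          (\<forall>l x. ((\<lambda>t. L2_dist_sq M (v t (x + l)) (v t x)) \<longlongrightarrow> \<Lambda> l) at_top) \<and>
          ((\<lambda>l. \<Lambda> l / (\<bar>l\<bar> powr (2 * H) * (C 0 / (2 * \<bar>c\<bar>)) * (LBINT k. fbm_kernel H k))) \<longlongrightarrow> 1) (at 0)))" if v: "is_P M A L H u\<^sub>0 v" for v
  proof -
    have sp: "spectral_field.spec M (u\<^sub>0 t) (v t x) (\<psi> x)" if "0 \<le> t" for t x
      using spectral_field.has_spectral_integral_imp_spec[OF spectral[OF that]] v that unfolding P by blast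
    have \<delta>sp: "spectral_field.spec M (u\<^sub>0 t) (\<lambda>\<omega>. v t (x + l) \<omega> - v t x \<omega>) (\<delta>\<psi> x l)" if "0 \<le> t" for t x l
      using spectral_field.spec_diff[OF spectral[OF that] sp[OF that] sp[OF that], of "x + l" x]
      unfolding \<delta>\<psi>_eq .
    \<comment> \<open>Joint Gaussianity concerns different times, whereas \<open>spec\<close> is
      bound to a single one; the span of the forcing is common to all times.\<close>
    have span: "v t x \<in> L2_span M forcing_index (\<lambda>(g, x). F g x)" if "0 \<le> t" for t x
      by (rule spectral_field.spec_L2_span[OF spectral sp u_L2_span forcing_family(2)]) (use that in auto)
    have g1: "gaussian_family M ({0..} \<times> UNIV) (\<lambda>(t, x). v t x)"
      by (rule gaussian_family_L2_span[OF forcing_family(1,3)]) (use span in auto)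
    have g2: "(LINT \<omega>|M. v t x \<omega>) = 0" if "0 \<le> t" for t x
      by (rule L2_span_integral_zero[OF forcing_family(2,3) span[OF that]])
    have g3: "L2_inner M (v t x) (v t y)
        = (LBINT k. cis (2 * pi * k * (x - y)) * complex_of_real (w k) * dens t k)" if "0 \<le> t" for t x y
    proof -
      have "\<psi> x k * cnj (\<psi> y k) = cis (2 * pi * k * (x - y)) * complex_of_real (w k)" for k
      proof -
        have "cis (2 * pi * k * (x - y)) = cis (2 * pi * k * x) * cnj (cis (2 * pi * k * y))"
          by (simp add: cis_cnj cis_mult algebra_simps)
        then show ?thesis unfolding w_sq[symmetric] \<psi>_def by (simp add: power2_eq_square)
      qed
      then show ?thesis using spectral_field.spec_cov[OF spectral sp sp, OF that that that] by simp
    qed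
    have g4: "(LINT \<omega>|M. v t x \<omega> * v t y \<omega>) = 0" if "0 \<le> t" for t x y
      by (rule spectral_field.spec_pseudo_cov[OF spectral u_pseudo_cov sp sp]) (rule that)+
    have g5: "sq_integrable M (v t x)" if "0 \<le> t" for t x
      by (rule spectral_field.spec_regular(1)[OF spectral sp]) (rule that)+
    have g6: "integrable lborel w" unfolding w_def[abs_def] by (rule weight_integrable[OF H(2)])
    have g7: "((\<lambda>t. L2_norm_sq M (v t x)) \<longlongrightarrow> C 0 / (2 * \<bar>c\<bar>) * (LBINT k. w k)) at_top" for x
    proof (rule variance_tendsto[OF sp \<psi>_sq g6])
      show "w (- k) = w k" for k using a_even[of k] a_even[of "- k"] unfolding w_def by simp
    qed
    have g8: "has_spectral_integral M (u\<^sub>0 t) (\<delta>\<psi> x l) (\<lambda>\<omega>. v t (x + l) \<omega> - v t x \<omega>)" if "0 \<le> t" for t l x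
    proof (rule spectral_field.spec_imp_has_spectral_integral[OF spectral[OF that] _ _ \<delta>sp[OF that]])
      show "continuous_on UNIV (\<delta>\<psi> x l)"
        unfolding \<delta>\<psi>_eq[symmetric, abs_def] by (intro continuous_intros c\<psi>)
      show "cmod (\<delta>\<psi> x l k) \<le> B + B" for k
        unfolding \<delta>\<psi>_eq[symmetric] by (rule order_trans[OF norm_triangle_ineq4 add_mono[OF b\<psi> b\<psi>]])
    qed
    define \<Lambda> where "\<Lambda> l = C 0 / (2 * \<bar>c\<bar>) * (LBINT k. wl l k)" for l
    have g9: "((\<lambda>t. L2_dist_sq M (v t (x + l)) (v t x)) \<longlongrightarrow> \<Lambda> l) at_top" for l x
      unfolding \<Lambda>_def
    proof (rule variance_tendsto[OF \<delta>sp \<delta>\<psi>_sq])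
      show "integrable lborel (wl l)"
        unfolding wl_def[abs_def] by (rule increment_weight_integrable[OF H(2)])
      show "wl l (- k) = wl l k" for k
        using a_even[of k] a_even[of "- k"] unfolding wl_def cmod_cis_minus_1_sq by simp
    qed
    have g10: "((\<lambda>l. \<Lambda> l / (\<bar>l\<bar> powr (2 * H) * (C 0 / (2 * \<bar>c\<bar>)) * (LBINT k. fbm_kernel H k))) \<longlongrightarrow> 1) (at 0)"
      if "H < 1"
    proof -
      let ?I = "LBINT k. fbm_kernel H k"
      have I: "0 < ?I" by (rule fbm_kernel_integral_pos[OF assms(4) that])
      have "((\<lambda>l. ((LBINT k. wl l k) / \<bar>l\<bar> powr (2 * H)) / ?I) \<longlongrightarrow> ?I / ?I) (at 0)"
        using increment_asymptotics[OF assms(4) that] I unfolding wl_def[abs_def] by (intro tendsto_intros) auto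
      \<comment> \<open>The variance constant \<open>C 0 / (2 * \<bar>c\<bar>)\<close> is nonzero
        and cancels.\<close>
      moreover have "((LBINT k. wl l k) / \<bar>l\<bar> powr (2 * H)) / ?I
          = \<Lambda> l / (\<bar>l\<bar> powr (2 * H) * (C 0 / (2 * \<bar>c\<bar>)) * ?I)" for l
        unfolding \<Lambda>_def using spatial_covariance_0_pos[OF C] c by simp
      ultimately show ?thesis using I by simp
    qed
    show ?thesis
      \<comment> \<open>Homogeneity is witnessed by the Fourier transform of the weighted density, a
        function of \<open>x - y\<close> at each time.\<close>
      by (intro conjI allI impI g1 g2 g4 g5 g6 g7 g8
          exI[of _ "\<lambda>t z. LBINT k. cis (2 * pi * k * z) * complex_of_real (w k) * dens t k"] g3
          exI[of _ \<Lambda>] g9 g10)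
  qed
  show ?thesis
    by (rule conjI[OF duhamel conjI[OF ex]], intro allI impI)
      (rule main[unfolded \<delta>\<psi>_def[abs_def] w_def[abs_def] fbm_kernel_def a_def])
qed

end
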